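(* Let $G$ be the group $H_3(\mathbb{Z})\rtimes C_2$ given by the presentation $$G=\langle x,y,t \mid [x,[x,y]]=[y,[x,y]]=t^2=e,\ txt=y\rangle,$$ and let $S$ be the generating multiset $S=\{x,x^{-1},t,t,t,t,t,t,t,t\}$ (the element $t$ occurs with multiplicity $8$). Then the Green series $\Gamma_{(G,S)}(z)\in\mathbb{Z}[[z]]$ of $G$ with respect to $S$ is not $D$-finite.
   Context: Green series: for a group $G$ and a finite generating multiset $S$ of $G$, $\Gamma_{(G,S)}(z)=\sum_{\ell\ge 0}c_\ell z^\ell\in\mathbb{Z}[[z]]$, where $c_\ell=\#\{(s_1,\ldots,s_\ell)\in S^\ell \mid s_1\cdots s_\ell=e_G\}$; here tuples are counted with multiplicity, i.e. different copies of the same element in the multiset $S$ are regarded as distinct choices. $D$-finite: a series $\sum_{n\ge 0}a_n z^n\in\mathbb{Z}[[z]]$ is $D$-finite if there exist polynomials $p_0,\ldots,p_k\in\mathbb{Z}[X]$ with $p_0\neq 0$ such that $p_0(n)a_n+p_1(n)a_{n-1}+\cdots+p_k(n)a_{n-k}=0$ for all $n\ge k$. Here $H_3(\mathbb{Z})=\langle x,y\mid [x,[x,y]]=[y,[x,y]]=e\rangle$ is the discrete Heisenberg group, and $C_2=\langle t\rangle$ acts on it by swapping $x$ and $y$. Since $y=txt$, the elements $x$ and $t$ generate $G$. *)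

theory Defs
  imports
    "HOL-Library.Multiset"
    "HOL-Computational_Algebra.Polynomial"
    "HOL-Computational_Algebra.Formal_Power_Series"
    "HOL-Algebra.Generated_Groups"
begin

text \<open>
  The letter \<open>(g, True)\<close> stands for the generator \<open>g\<close>, and \<open>(g, False)\<close> for its formal inverse.
\<close>

type_synonym 'g gword = "('g \<times> bool) list"

definition gword_inv :: "'g gword \<Rightarrow> 'g gword" where
  "gword_inv w = rev (map (\<lambda>(g, e). (g, \<not> e)) w)"

definition gword_comm :: "'g gword \<Rightarrow> 'g gword \<Rightarrow> 'g gword" where
  "gword_comm u v = u @ v @ gword_inv u @ gword_inv v"

text \<open>
  The least congruence on words that contains the relations \<open>R\<close> and makes \<open>(g, e)\<close> and
  \<open>(g, \<not> e)\<close> mutually inverse. A relation \<open>u = v\<close> is encoded as the pair \<open>(u, v)\<close>.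
\<close>

inductive_set pres_rel :: "('g gword \<times> 'g gword) set \<Rightarrow> ('g gword \<times> 'g gword) set"
  for R :: "('g gword \<times> 'g gword) set"
where
  relation: "(u, v) \<in> R \<Longrightarrow> (u, v) \<in> pres_rel R"
| cancel: "([(g, e), (g, \<not> e)], []) \<in> pres_rel R"
| refl: "(u, u) \<in> pres_rel R"
| sym: "(u, v) \<in> pres_rel R \<Longrightarrow> (v, u) \<in> pres_rel R"
| trans: "(u, v) \<in> pres_rel R \<Longrightarrow> (v, w) \<in> pres_rel R \<Longrightarrow> (u, w) \<in> pres_rel R"
| append: "(u, v) \<in> pres_rel R \<Longrightarrow> (u', v') \<in> pres_rel R \<Longrightarrow> (u @ u', v @ v') \<in> pres_rel R"

definition presented_group :: "('g gword \<times> 'g gword) set \<Rightarrow> 'g gword set monoid" where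
  "presented_group R =
     \<lparr>carrier = UNIV // pres_rel R,
      mult = (\<lambda>A B. \<Union>u\<in>A. \<Union>v\<in>B. pres_rel R `` {u @ v}),
      one = pres_rel R `` {[]}\<rparr>"

definition pres_gen :: "('g gword \<times> 'g gword) set \<Rightarrow> 'g \<Rightarrow> 'g gword set" where
  "pres_gen R g = pres_rel R `` {[(g, True)]}"

lemma equiv_pres_rel: "equiv UNIV (pres_rel R)"
  by (auto intro!: equivI refl_onI symI transI intro: pres_rel.intros)

lemma presented_group_mult:
  "pres_rel R `` {u} \<otimes>\<^bsub>presented_group R\<^esub> pres_rel R `` {v} = pres_rel R `` {u @ v}"
proof -
  have "congruent2 (pres_rel R) (pres_rel R) (\<lambda>u v. pres_rel R `` {u @ v})"
    by (auto intro!: congruent2I' equiv_class_eq[OF equiv_pres_rel] intro: pres_rel.append)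
  then show ?thesis
    unfolding presented_group_def
    by (simp add: UN_equiv_class2[OF equiv_pres_rel equiv_pres_rel])
qed

lemma presented_group_carrier:
  "A \<in> carrier (presented_group R) \<longleftrightarrow> (\<exists>u. A = pres_rel R `` {u})"
  by (auto simp: presented_group_def quotient_def)

lemma presented_group_one: "\<one>\<^bsub>presented_group R\<^esub> = pres_rel R `` {[]}"
  by (simp add: presented_group_def)

lemma gword_inv_left: "(gword_inv w @ w, []) \<in> pres_rel R"
proof (induction w)
  case Nil
  show ?case by (simp add: gword_inv_def pres_rel.refl)
next
  case (Cons a w)
  obtain g e where a: "a = (g, e)" by (cases a)
  have "([(g, \<not> e), (g, e)], []) \<in> pres_rel R"
    using pres_rel.cancel[of g "\<not> e" R] by simp
  then have "(gword_inv w @ [(g, \<not> e), (g, e)] @ w, gword_inv w @ [] @ w) \<in> pres_rel R"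
    by (intro pres_rel.append pres_rel.refl)
  then show ?case
    using Cons.IH by (auto simp: gword_inv_def a intro: pres_rel.trans)
qed

lemma group_presented_group: "group (presented_group R)"
proof (rule groupI)
  fix A assume "A \<in> carrier (presented_group R)"
  then obtain u where u: "A = pres_rel R `` {u}"
    by (auto simp: presented_group_carrier)
  have "pres_rel R `` {gword_inv u} \<otimes>\<^bsub>presented_group R\<^esub> A = \<one>\<^bsub>presented_group R\<^esub>"
    unfolding u presented_group_mult presented_group_one
    by (rule equiv_class_eq[OF equiv_pres_rel gword_inv_left])
  then show "\<exists>B\<in>carrier (presented_group R). B \<otimes>\<^bsub>presented_group R\<^esub> A = \<one>\<^bsub>presented_group R\<^esub>"
    by (rule bexI) (unfold presented_group_carrier, blast)
qed (auto simp: presented_group_carrier presented_group_mult presented_group_one)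

text \<open>Different copies of one element of a multiset are told apart by an index.\<close>

definition mset_copies :: "'a multiset \<Rightarrow> ('a \<times> nat) set" where
  "mset_copies S = (SIGMA s : set_mset S. {..<count S s})"

definition green_coeff :: "('a, 'b) monoid_scheme \<Rightarrow> 'a multiset \<Rightarrow> nat \<Rightarrow> nat" where
  "green_coeff G S l =
     card {ss. set ss \<subseteq> mset_copies S \<and> length ss = l \<and>
               foldr (\<otimes>\<^bsub>G\<^esub>) (map fst ss) \<one>\<^bsub>G\<^esub> = \<one>\<^bsub>G\<^esub>}"

definition green_series :: "('a, 'b) monoid_scheme \<Rightarrow> 'a multiset \<Rightarrow> int fps" where
  "green_series G S = Abs_fps (\<lambda>l. int (green_coeff G S l))"

definition D_finite :: "int fps \<Rightarrow> bool" where
  "D_finite f \<longleftrightarrow>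
     (\<exists>k. \<exists>p :: nat \<Rightarrow> int poly. p 0 \<noteq> 0 \<and>
        (\<forall>n\<ge>k. (\<Sum>i\<le>k. poly (p i) (int n) * fps_nth f (n - i)) = 0))"

datatype heis_gen = Gen_x | Gen_y | Gen_t

definition heis_C2_relations :: "(heis_gen gword \<times> heis_gen gword) set" where
  "heis_C2_relations =
     (let x = [(Gen_x, True)]; y = [(Gen_y, True)]; t = [(Gen_t, True)] in
       {(gword_comm x (gword_comm x y), []),
        (gword_comm y (gword_comm x y), []),
        (t @ t, []),
        (t @ x @ t, y)})"

definition heis_C2 :: "heis_gen gword set monoid" where
  "heis_C2 = presented_group heis_C2_relations"

definition heis_x :: "heis_gen gword set" where
  "heis_x = pres_gen heis_C2_relations Gen_x"

definition heis_t :: "heis_gen gword set" where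
  "heis_t = pres_gen heis_C2_relations Gen_t"

definition heis_C2_gens :: "heis_gen gword set multiset" where
  "heis_C2_gens = {#heis_x, inv\<^bsub>heis_C2\<^esub> heis_x#} + replicate_mset 8 heis_t"

lemma group_heis_C2: "group heis_C2"
  unfolding heis_C2_def by (rule group_presented_group)

lemma heis_C2_gens_generate: "generate heis_C2 (set_mset heis_C2_gens) = carrier heis_C2"
proof -
  interpret group heis_C2 by (rule group_heis_C2)
  let ?c = "\<lambda>w. pres_rel heis_C2_relations `` {w}"
  let ?H = "generate heis_C2 (set_mset heis_C2_gens)"
  have mult: "?c u \<otimes>\<^bsub>heis_C2\<^esub> ?c v = ?c (u @ v)" for u v
    unfolding heis_C2_def by (rule presented_group_mult)
  have carr: "A \<in> carrier heis_C2 \<longleftrightarrow> (\<exists>u. A = ?c u)" for A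
    unfolding heis_C2_def by (rule presented_group_carrier)
  have one: "\<one>\<^bsub>heis_C2\<^esub> = ?c []"
    unfolding heis_C2_def by (rule presented_group_one)
  have gens: "set_mset heis_C2_gens = {heis_x, inv\<^bsub>heis_C2\<^esub> heis_x, heis_t}"
    by (auto simp: heis_C2_gens_def)
  have gen_carr: "heis_x \<in> carrier heis_C2" "heis_t \<in> carrier heis_C2"
    unfolding carr heis_x_def heis_t_def pres_gen_def by blast+
  have sub: "set_mset heis_C2_gens \<subseteq> carrier heis_C2"
    unfolding gens using gen_carr by simp
  have H: "subgroup ?H heis_C2" by (rule generate_is_subgroup[OF sub])
  have x: "?c [(Gen_x, True)] \<in> ?H"
    unfolding heis_x_def[unfolded pres_gen_def, symmetric]
    by (rule generate.incl) (unfold gens, rule insertI1)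
  have t: "?c [(Gen_t, True)] \<in> ?H"
    unfolding heis_t_def[unfolded pres_gen_def, symmetric]
    by (rule generate.incl) (unfold gens, blast)
  have "?c [(Gen_y, True)] = ?c ([(Gen_t, True)] @ [(Gen_x, True)] @ [(Gen_t, True)])"
    by (rule equiv_class_eq[OF equiv_pres_rel], rule pres_rel.sym, rule pres_rel.relation)
      (simp add: heis_C2_relations_def Let_def)
  also have "\<dots> \<in> ?H"
    using generate.eng[OF t generate.eng[OF x t]] by (simp only: mult)
  finally have y: "?c [(Gen_y, True)] \<in> ?H" .
  have gen: "?c [(g, True)] \<in> ?H" for g
    using x y t by (cases g) auto
  have letter: "?c [(g, e)] \<in> ?H" for g e
  proof (cases e)
    case False
    have "?c [(g, False)] \<otimes>\<^bsub>heis_C2\<^esub> ?c [(g, True)] = \<one>\<^bsub>heis_C2\<^esub>"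
      unfolding mult one using pres_rel.cancel[of g False]
      by (intro equiv_class_eq[OF equiv_pres_rel]) simp
    then have "inv\<^bsub>heis_C2\<^esub> ?c [(g, True)] = ?c [(g, False)]"
      by (rule inv_equality) (unfold carr, blast+)
    then show ?thesis
      using subgroup.m_inv_closed[OF H gen[of g]] False by simp
  qed (simp add: gen)
  have "?c w \<in> ?H" for w
  proof (induction w)
    case Nil
    show ?case using generate.one[of heis_C2] by (simp add: one)
  next
    case (Cons a w)
    have "?c ([a] @ w) \<in> ?H"
      using generate.eng[OF letter[of "fst a" "snd a"] Cons.IH] by (simp only: mult prod.collapse)
    then show ?case by simp
  qed
  then show ?thesis
    using subgroup.subset[OF H] by (auto simp: carr)
qed

end

theory Submission
  imports
    Defs
    "HOL-Number_Theory.Cong"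
    "HOL-Computational_Algebra.Squarefree"
    "HOL-Computational_Algebra.Polynomial_FPS"
begin

text \<open>
  The argument is \<open>2\<close>-adic. Substituting $z = X / (1 + X^2)$ turns the Green series into the generating
  function of reduced words $x^{a_0} t x^{a_1} \cdots t x^{a_m} = e$, up to explicit rational factors and the
  weight $8^m$. Modulo $2^{24}$ only $m = 0, 2, 4, 6$ matter; the first three terms are rational, while for
  $m = 6$ the reduced words correspond to pairs of parallel vectors in the hexagonal norm on $\mathbb{Z}^2$
  and are counted by the gcd-sum function $P(n) = \sum_{k < n} \gcd(k, n)$ of Pillai. The factor $8^6 = 2^{18}$
  leaves just enough room for $P$ modulo \<open>8\<close> to be visible.

  A polynomial recurrence survives the substitution. Restricted to a residue class modulo $2^K$ its coefficients are
  \<open>2\<close>-adically almost constant, so it yields a linear relation with constant coefficients, one of them odd,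
  between values $P(8 (s - e) - 1)$ modulo \<open>8\<close> for all $s$ in that class. But $P$ is multiplicative, and
  modulo \<open>8\<close> one has $P(k) \equiv 1$ for squarefree $k \equiv 1$, whereas $P(p^2) \equiv 5$ for every prime $p$
  congruent to \<open>3\<close> modulo \<open>4\<close>; a sieve for square factors produces an $s$ at which exactly one of these values is flipped.
\<close>

section \<open>Pillai's function\<close>

text \<open>With four letters \<open>t\<close> the central coordinate only forces a product of two
  exponents to vanish, which still gives a rational series; six letters give the first genuine
  determinant equation, and with it gcd sums. An odd number of letters \<open>t\<close> never
  returns to the identity. The relevant difference of counts for m = 6 carries an extra factor 4, so
  the arithmetic sits at 2^20 and is read modulo 2^23. Indices 32 s + 2 isolate one unknown: the
  coefficient involves P at n = 16 s - 2, at n - 1 and at n - 2, where P(n) = 3 P(8 s - 1), P(n - 2)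
  is divisible by 8, and 6 P(n - 1) is 6 modulo 8. Since P is 1 modulo 4 at odd arguments, P(8 s -
  1) modulo 8 is a single bit, and multiplication by 5 toggles it. The obstacle is that a recurrence
  of unknown order couples many such bits, so all but one of them must be frozen at once, inside a
  2-adic class that is prescribed in advance.\<close>

definition pillai :: "nat \<Rightarrow> nat" where
  "pillai n = (\<Sum>k<n. gcd k n)"

lemma pillai_1 [simp]: "pillai (Suc 0) = 1"
  by (simp add: pillai_def)

lemma gcd_mult_coprime:
  fixes k m n :: nat
  assumes "coprime m n"
  shows "gcd k (m * n) = gcd k m * gcd k n"
proof (rule dvd_antisym)
  obtain b c where bc: "gcd k (m * n) = b * c" "b dvd m" "c dvd n"
    using division_decomp[of "gcd k (m * n)" m n] by auto
  then have "b dvd k" "c dvd k" by (metis dvd_mult_left dvd_mult_right gcd_dvd1)+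
  then show "gcd k (m * n) dvd gcd k m * gcd k n"
    using bc by (simp add: mult_dvd_mono)
  have "coprime (gcd k m) (gcd k n)"
    by (rule coprime_divisors[OF _ _ assms]) simp_all
  then show "gcd k m * gcd k n dvd gcd k (m * n)"
    by (simp add: divides_mult)
qed

text \<open>Chinese remainder theorem: k below m n corresponds to its pair of residues, and the gcd
  splits along the coprime factors.\<close>

lemma pillai_mult:
  assumes "coprime m n"
  shows "pillai (m * n) = pillai m * pillai n"
proof (cases "m = 0 \<or> n = 0")
  case False
  have "bij_betw (\<lambda>k. (k mod m, k mod n)) {..<m * n} ({..<m} \<times> {..<n})"
  proof (rule bij_betw_imageI)
    show inj: "inj_on (\<lambda>k. (k mod m, k mod n)) {..<m * n}"
    proof (rule inj_onI)
      fix x y assume *: "x \<in> {..<m * n}" "y \<in> {..<m * n}" "(x mod m, x mod n) = (y mod m, y mod n)"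
      then have "[x = y] (mod m)" "[x = y] (mod n)" by (simp_all add: cong_def)
      then have "[x = y] (mod m * n)" using assms coprime_cong_mult_nat by blast
      then show "x = y" using * by (simp add: cong_less_modulus_unique_nat)
    qed
    have "(\<lambda>k. (k mod m, k mod n)) ` {..<m * n} \<subseteq> {..<m} \<times> {..<n}" using False by auto
    then show "(\<lambda>k. (k mod m, k mod n)) ` {..<m * n} = {..<m} \<times> {..<n}"
      by (rule card_subset_eq[rotated]) (simp_all add: card_image[OF inj])
  qed
  then have "(\<Sum>k<m * n. gcd (k mod m) m * gcd (k mod n) n) = (\<Sum>(i, j)\<in>{..<m} \<times> {..<n}. gcd i m * gcd j n)"
    using sum.reindex_bij_betw[of _ _ _ "\<lambda>(i, j). gcd i m * gcd j n"] by fastforce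
  moreover have "gcd k (m * n) = gcd (k mod m) m * gcd (k mod n) n" for k
    unfolding gcd_mult_coprime[OF assms] by (metis gcd.commute gcd_red_nat)
  ultimately show ?thesis
    by (simp add: pillai_def sum_product sum.cartesian_product)
qed (auto simp: pillai_def)

lemma pillai_prime:
  assumes "prime p"
  shows "pillai p = 2 * p - 1"
proof -
  have p: "p > 0" using assms prime_gt_0_nat by blast
  then have "{..<p} = insert 0 {0<..<p}" by auto
  then have "pillai p = p + (\<Sum>k\<in>{0<..<p}. gcd k p)" by (simp add: pillai_def)
  also have "(\<Sum>k\<in>{0<..<p}. gcd k p) = (\<Sum>k\<in>{0<..<p}. 1)"
  proof (rule sum.cong)
    fix k assume "k \<in> {0<..<p}"
    then have "\<not> p dvd k" by (auto dest: dvd_imp_le)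
    then show "gcd k p = 1" using assms by (metis coprime_commute coprime_iff_gcd_eq_1 prime_imp_coprime_nat)
  qed simp
  finally show ?thesis using p by simp
qed

lemma pillai_prime_square:
  assumes "prime p"
  shows "pillai (p ^ 2) = 3 * p ^ 2 - 2 * p"
proof -
  have p: "p > 1" using assms prime_gt_1_nat by blast
  \<comment> \<open>The positive multiples of p below p^2 have gcd p with p^2; every other positive
    k below p^2 has gcd 1.\<close>
  let ?A = "(\<lambda>i. i * p) ` {0<..<p}"
  have sub: "?A \<subseteq> {0<..<p ^ 2}" using p by (auto simp: power2_eq_square)
  have "{..<p ^ 2} = insert 0 {0<..<p ^ 2}" using p by auto
  then have "pillai (p ^ 2) = p ^ 2 + (\<Sum>k\<in>{0<..<p ^ 2}. gcd k (p ^ 2))" by (simp add: pillai_def)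
  also have "(\<Sum>k\<in>{0<..<p ^ 2}. gcd k (p ^ 2)) =
      (\<Sum>k\<in>{0<..<p ^ 2} - ?A. gcd k (p ^ 2)) + (\<Sum>k\<in>?A. gcd k (p ^ 2))"
    by (rule sum.subset_diff[OF sub]) simp
  also have "(\<Sum>k\<in>?A. gcd k (p ^ 2)) = (\<Sum>i\<in>{0<..<p}. p)"
  proof (subst sum.reindex)
    show "inj_on (\<lambda>i. i * p) {0<..<p}" using p by (auto simp: inj_on_def)
    show "sum ((\<lambda>k. gcd k (p ^ 2)) \<circ> (\<lambda>i. i * p)) {0<..<p} = (\<Sum>i\<in>{0<..<p}. p)"
    proof (rule sum.cong)
      fix i assume "i \<in> {0<..<p}"
      then have "\<not> p dvd i" by (auto dest: dvd_imp_le)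
      then have "gcd i p = 1"
        using assms by (metis coprime_commute coprime_iff_gcd_eq_1 prime_imp_coprime_nat)
      then show "((\<lambda>k. gcd k (p ^ 2)) \<circ> (\<lambda>i. i * p)) i = p"
        by (simp add: power2_eq_square mult.commute[of i] flip: gcd_mult_distrib_nat)
    qed simp
  qed
  also have "(\<Sum>k\<in>{0<..<p ^ 2} - ?A. gcd k (p ^ 2)) = (\<Sum>k\<in>{0<..<p ^ 2} - ?A. 1)"
  proof (rule sum.cong)
    fix k assume k: "k \<in> {0<..<p ^ 2} - ?A"
    have "\<not> p dvd k"
    proof
      assume "p dvd k"
      then obtain i where "k = i * p" by (metis dvd_div_mult_self)
      then show False using k by (auto simp: power2_eq_square)
    qed
    then have "coprime k (p ^ 2)"
      using assms by (metis coprime_commute coprime_power_right_iff prime_imp_coprime_nat)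
    then show "gcd k (p ^ 2) = 1" by simp
  qed simp
  also have "card ?A = p - 1"
    using p by (subst card_image) (auto simp: inj_on_def)
  then have "(\<Sum>k\<in>{0<..<p ^ 2} - ?A. 1) = p ^ 2 - 1 - (p - 1)"
    using sub by (simp add: card_Diff_subset)
  finally have "pillai (p ^ 2) = p ^ 2 + ((p ^ 2 - 1 - (p - 1)) + (p - 1) * p)" by simp
  moreover have "p \<le> p ^ 2" "(p - 1) * p = p ^ 2 - p" using p by (simp_all add: power2_eq_square diff_mult_distrib)
  ultimately show ?thesis using p by simp
qed

lemma pillai_2: "pillai 2 = 3" and pillai_4: "pillai 4 = 8"
  using pillai_prime[of 2] pillai_prime_square[of 2] by simp_all

section \<open>Residues of the gcd-sum function modulo 4 and 8\<close>

text \<open>Pairing k with n - k gives P(n) = n + 2 S, where n = 2 m + 1 and S is a sum of m odd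
  gcds. Hence S and m have the same parity, and n + 2 S is 4 m + 1 modulo 4.\<close>

lemma pillai_odd_mod_4:
  assumes "odd n"
  shows "pillai n mod 4 = 1"
proof -
  from assms obtain m where n: "n = 2 * m + 1" by (elim oddE)
  have img: "(\<lambda>k. n - k) ` {1..m} = {m + 1..2 * m}"
  proof
    show "{m + 1..2 * m} \<subseteq> (\<lambda>k. n - k) ` {1..m}"
    proof
      fix x assume "x \<in> {m + 1..2 * m}"
      then have "x = n - (n - x)" "n - x \<in> {1..m}" using n by auto
      then show "x \<in> (\<lambda>k. n - k) ` {1..m}" by blast
    qed
  qed (use n in auto)
  have "{..<n} = insert 0 ({1..m} \<union> (\<lambda>k. n - k) ` {1..m})"
    unfolding img by (auto simp: n)
  moreover have "(\<Sum>k\<in>(\<lambda>k. n - k) ` {1..m}. gcd k n) = (\<Sum>k\<in>{1..m}. gcd k n)"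
  proof (subst sum.reindex)
    show "inj_on (\<lambda>k. n - k) {1..m}" using n by (auto simp: inj_on_def)
    show "sum ((\<lambda>k. gcd k n) \<circ> (\<lambda>k. n - k)) {1..m} = (\<Sum>k\<in>{1..m}. gcd k n)"
      using n by (intro sum.cong) (auto simp: gcd_diff2_nat)
  qed
  moreover have "0 \<notin> {1..m} \<union> (\<lambda>k. n - k) ` {1..m}" "{1..m} \<inter> (\<lambda>k. n - k) ` {1..m} = {}"
    unfolding img by auto
  ultimately have "pillai n = n + 2 * (\<Sum>k\<in>{1..m}. gcd k n)"
    by (simp add: pillai_def sum.union_disjoint)
  moreover have "(\<Sum>k\<in>{1..m}. gcd k n) mod 2 = m mod 2"
  proof -
    have "odd (gcd k n)" for k
      using assms by (meson dvd_trans gcd_dvd2)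
    then have "gcd k n mod 2 = 1" for k
      using odd_iff_mod_2_eq_one by blast
    then have "(\<Sum>k\<in>{1..m}. gcd k n mod 2) = m" by simp
    then show ?thesis using mod_sum_eq[of "\<lambda>k. gcd k n" 2 "{1..m}"] by simp
  qed
  moreover define S where "S = (\<Sum>k\<in>{1..m}. gcd k n)"
  ultimately have "pillai n = n + 2 * S" "S mod 2 = m mod 2" by simp_all
  moreover have "(2 * m + 1 + 2 * S) mod 4 = 1" if "S mod 2 = m mod 2"
  proof -
    have "even (m + S)" using that by presburger
    then obtain q where "m + S = 2 * q" by blast
    then have "2 * m + 1 + 2 * S = 1 + q * 4" by simp
    then show ?thesis by (simp only: mod_mult_self1) simp
  qed
  ultimately show ?thesis using n by simp
qed

text \<open>The map n -> 2 n - 1 gives the values at primes and is multiplicative modulo 8 on odd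
  numbers; squarefreeness makes the prime factor split off coprime to the rest.\<close>

lemma pillai_squarefree_mod_8:
  assumes "odd n" "squarefree n"
  shows "[pillai n = 2 * n - 1] (mod 8)"
  using assms
proof (induction n rule: less_induct)
  case (less n)
  show ?case
  proof (cases "n = 1")
    case False
    then obtain p where p: "prime p" "p dvd n" using prime_factor_nat by blast
    then obtain m where n: "n = p * m" by auto
    have m: "odd m" "odd p" using less.prems n by auto
    have cop: "coprime p m"
    proof -
      have "\<not> p dvd m"
      proof
        assume "p dvd m"
        then have "p ^ 2 dvd n" by (simp add: n power2_eq_square)
        then show False using less.prems(2) p(1) squarefreeD by (metis nat_dvd_1_iff_1 not_prime_1)
      qed
      then show ?thesis using p(1) prime_imp_coprime_nat by blast
    qed
    have "m < n" using n prime_gt_1_nat[OF p(1)] odd_pos[OF m(1)] by simp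
    moreover have "squarefree m" using less.prems(2) n squarefree_multD by blast
    ultimately have "[pillai m = 2 * m - 1] (mod 8)" using less.IH m by blast
    then have "[pillai n = (2 * p - 1) * (2 * m - 1)] (mod 8)"
      unfolding n pillai_mult[OF cop] pillai_prime[OF p(1)] by (rule cong_scalar_left)
    moreover have "[(2 * p - 1) * (2 * m - 1) = 2 * n - 1] (mod 8)"
    proof -
      obtain a b where ab: "p = 2 * a + 1" "m = 2 * b + 1" using m by (elim oddE)
      have "(2 * p - 1) * (2 * m - 1) = 2 * n - 1 + 8 * (a * b)"
        unfolding n ab by (simp add: algebra_simps)
      then show ?thesis by (simp add: cong_def)
    qed
    ultimately show ?thesis by (rule cong_trans)
  qed simp
qed

section \<open>Integral linear algebra and a count for the elimination between shifted
  recurrences\<close>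

text \<open>Fraction-free Gaussian elimination, by induction on the equations. It later supplies the
  multipliers that cancel the unwanted positions of a recurrence.\<close>

lemma homogeneous_system_int:
  fixes A :: "'q \<Rightarrow> 's \<Rightarrow> int"
  assumes "finite Q" "finite S" "card Q < card S"
  shows "\<exists>l. (\<exists>s\<in>S. l s \<noteq> 0) \<and> (\<forall>q\<in>Q. (\<Sum>s\<in>S. l s * A q s) = 0)"
  using assms
proof (induction Q arbitrary: A S rule: finite_induct)
  case empty
  then have "S \<noteq> {}" by auto
  then show ?case by (intro exI[of _ "\<lambda>_. 1"]) auto
next
  case (insert r Q)
  show ?case
  proof (cases "\<forall>s\<in>S. A r s = 0")
    case True
    have "card Q < card S" using insert.hyps insert.prems by simp
    then obtain l where "\<exists>s\<in>S. l s \<noteq> 0" "\<forall>q\<in>Q. (\<Sum>s\<in>S. l s * A q s) = 0"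
      using insert.IH[of S A] insert.prems by blast
    then show ?thesis using True by (intro exI[of _ l]) simp
  next
    case False
    then obtain p where p: "p \<in> S" "A r p \<noteq> 0" by blast
    let ?S = "S - {p}"
    \<comment> \<open>Equation \<open>r\<close> has pivot \<open>p\<close>; cross multiplication
      removes the unknown \<open>p\<close> from the other equations without division.\<close>
    define B where "B q s = A r p * A q s - A r s * A q p" for q s
    have "card Q < card ?S" using insert.hyps insert.prems p by simp
    then obtain l where l: "\<exists>s\<in>?S. l s \<noteq> 0" "\<forall>q\<in>Q. (\<Sum>s\<in>?S. l s * B q s) = 0"
      using insert.IH[of ?S B] insert.prems by auto
    \<comment> \<open>Scaling the other unknowns by the pivot coefficient lets the value at
      \<open>p\<close> solve equation \<open>r\<close> within the integers.\<close>
    define l' where "l' s = (if s = p then - (\<Sum>s\<in>?S. l s * A r s) else A r p * l s)" for s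
    have "(\<Sum>s\<in>S. l' s * A q s) = (\<Sum>s\<in>?S. l s * B q s)" for q
    proof -
      have "(\<Sum>s\<in>S. l' s * A q s) = l' p * A q p + (\<Sum>s\<in>?S. l' s * A q s)"
        by (rule sum.remove) (use insert.prems p in auto)
      also have "(\<Sum>s\<in>?S. l' s * A q s) = (\<Sum>s\<in>?S. A r p * l s * A q s)"
        by (rule sum.cong) (auto simp: l'_def)
      finally show ?thesis
        by (simp add: l'_def B_def sum_distrib_right sum_distrib_left sum_subtractf right_diff_distrib mult_ac)
    qed
    then have "\<forall>q\<in>insert r Q. (\<Sum>s\<in>S. l' s * A q s) = 0"
      using l(2) by (simp add: B_def)
    moreover have "\<exists>s\<in>S. l' s \<noteq> 0" using l(1) p by (auto simp: l'_def)
    ultimately show ?thesis by blast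
  qed
qed

lemma card_multiples_less:
  assumes "M > 0"
  shows "card {e. e < M * n \<and> \<not> M dvd e} = (M - 1) * n"
proof -
  have mult: "{e. e < M * n \<and> M dvd e} = (\<lambda>i. M * i) ` {..<n}"
    using assms by (auto elim!: dvdE)
  have "{e. e < M * n \<and> \<not> M dvd e} = {..<M * n} - {e. e < M * n \<and> M dvd e}" by auto
  moreover have "card ({..<M * n} - {e. e < M * n \<and> M dvd e}) = M * n - card {e. e < M * n \<and> M dvd e}"
    by (subst card_Diff_subset) auto
  moreover have "card {e. e < M * n \<and> M dvd e} = n"
    unfolding mult using assms by (subst card_image) (auto simp: inj_on_def)
  ultimately show ?thesis by (simp add: diff_mult_distrib)
qed

section \<open>A sieve for square factors of 8 (s - e) - 1\<close>

text \<open>All solutions lie in one residue class modulo q, so each is determined by its quotient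
  by q.\<close>

lemma card_dvd_linear_le:
  fixes a b q T :: nat
  assumes "coprime b q" "q > 0"
  shows "card {t. t < T \<and> q dvd a + b * t} \<le> T div q + 1"
proof -
  let ?B = "{t. t < T \<and> q dvd a + b * t}"
  have "inj_on (\<lambda>t. t div q) ?B"
  proof (rule inj_onI)
    fix s t assume st: "s \<in> ?B" "t \<in> ?B" "s div q = t div q"
    have "[a + b * s = a + b * t] (mod q)"
      using st by (metis (mono_tags, lifting) cong_0_iff cong_sym cong_trans mem_Collect_eq)
    then have "[s = t] (mod q)"
      using assms(1) by (simp add: cong_add_lcancel_nat cong_mult_lcancel_nat)
    then show "s = t" using st(3) by (metis cong_def mult_div_mod_eq)
  qed
  moreover have "(\<lambda>t. t div q) ` ?B \<subseteq> {..T div q}" by (auto intro: div_le_mono)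
  ultimately have "card ?B \<le> card {..T div q}" by (rule card_inj_on_le) simp
  then show ?thesis by simp
qed

text \<open>Telescoping, with 1 / (Z + 1)^2 at most 1 / Z - 1 / (Z + 1).\<close>

lemma sum_inverse_squares_le:
  assumes "0 < Y" "Y \<le> Z"
  shows "(\<Sum>p\<in>{Y<..Z}. 1 / real p ^ 2) \<le> 1 / real Y - 1 / real Z"
  using assms(2)
proof (induction Z rule: dec_induct)
  case (step Z)
  have "{Y<..Suc Z} = insert (Suc Z) {Y<..Z}" using step by auto
  then have "(\<Sum>p\<in>{Y<..Suc Z}. 1 / real p ^ 2) = 1 / real (Suc Z) ^ 2 + (\<Sum>p\<in>{Y<..Z}. 1 / real p ^ 2)" by simp
  moreover have "1 / real (Suc Z) ^ 2 \<le> 1 / real Z - 1 / real (Suc Z)"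
  proof -
    have Z: "real Z > 0" using assms(1) step by simp
    then have "1 / real (Suc Z) ^ 2 \<le> 1 / (real Z * real (Suc Z))"
      unfolding power2_eq_square by (intro frac_le mult_right_mono) auto
    also have "\<dots> = 1 / real Z - 1 / real (Suc Z)" using Z by (simp add: field_simps)
    finally show ?thesis .
  qed
  ultimately show ?case using step.IH by linarith
qed simp

text \<open>The bad \<open>t\<close> below \<open>T\<close> number at most
  $(E + 1) \sum_{Y < p \le Z} (T / p^2 + 1) \le (E + 1) (T / Y + Z) < T$ where $Z$ is of order $\sqrt T$.\<close>

lemma square_sieve:
  fixes D r E Y :: nat
  assumes "D > 0" "r > E" "Y \<ge> 4 * (E + 1)"
  shows "\<exists>s. s \<ge> r \<and> [s = r] (mod D) \<and>
    (\<forall>e\<le>E. \<forall>p. prime p \<longrightarrow> p > Y \<longrightarrow> coprime p (2 * D) \<longrightarrow> \<not> p ^ 2 dvd 8 * (s - e) - 1)"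
proof -
  \<comment> \<open>These sizes balance two demands. Z^2 exceeds 8 (r + D T), so primes above Z are
    harmless; and T = z Z with z at least 2 (E + 1), so the error terms (E + 1) Z stay below T / 2.
    The condition on \<open>Y\<close> bounds the main term by T / 4.\<close>
  define z where "z = r + 2 * E + 3"
  define T where "T = 16 * D * z ^ 2"
  define Z where "Z = 16 * D * z"
  define Bad where "Bad e p = {t. t < T \<and> p ^ 2 dvd 8 * (r + D * t - e) - 1}" for e p :: nat
  define G where "G = {p. prime p \<and> p > Y \<and> coprime p (2 * D) \<and> p \<le> Z}"
  have z: "z > 0" and T: "T > 0" using assms by (auto simp: z_def T_def)
  have "G \<subseteq> {Y<..Z}" by (auto simp: G_def)
  then have finG: "finite G" by (rule finite_subset) simp
  have large: "p \<le> Z" if "p ^ 2 dvd 8 * (r + D * t - e) - 1" "t < T" "e \<le> E" for e p t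
  proof -
    have "r \<le> z" by (simp add: z_def)
    also have "z \<le> D * D * z * z" using assms(1) z by simp
    finally have rz: "r \<le> D * D * z * z" .
    have "p ^ 2 \<le> 8 * (r + D * t - e) - 1" using that assms by (intro dvd_imp_le) auto
    also have "\<dots> \<le> 8 * (r + D * T)"
    proof -
      have "D * t \<le> D * T" using that by simp
      then have "r + D * t - e \<le> r + D * T" by linarith
      then show ?thesis by (intro order_trans[OF diff_le_self]) simp
    qed
    also have "\<dots> \<le> Z ^ 2"
      using rz by (simp add: T_def Z_def power2_eq_square algebra_simps)
    finally show ?thesis by (rule power2_le_imp_le) simp
  qed
  have card_Bad: "real (card (Bad e p)) \<le> real T / real p ^ 2 + 1" if "p \<in> G" "e \<le> E" for e p
  proof -
    have p: "prime p" "coprime p (2 * D)" using that by (auto simp: G_def)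
    have "odd p" using p(2) by auto
    then have "coprime (8 * D) (p ^ 2)" using p(2)
      by (metis coprime_commute coprime_mult_left_iff coprime_mult_right_iff coprime_power_right_iff
          mult_2 numeral_Bit0 mult.assoc)
    moreover have "8 * (r + D * t - e) - 1 = (8 * (r - e) - 1) + (8 * D) * t" for t
      using assms(2) that by (simp add: algebra_simps diff_mult_distrib2)
    ultimately have "card (Bad e p) \<le> T div p ^ 2 + 1"
      unfolding Bad_def using card_dvd_linear_le[of "8 * D" "p ^ 2" T "8 * (r - e) - 1"] prime_gt_0_nat[OF p(1)]
      by simp
    moreover have "real (T div p ^ 2) \<le> real T / real p ^ 2"
      using of_nat_div_le_of_nat[of T "p ^ 2", where 'a = real] by simp
    ultimately show ?thesis by linarith
  qed
  have "real (card (\<Union>e\<le>E. \<Union>p\<in>G. Bad e p)) \<le> (\<Sum>e\<le>E. \<Sum>p\<in>G. real (card (Bad e p)))"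
  proof -
    have "card (\<Union>e\<le>E. \<Union>p\<in>G. Bad e p) \<le> (\<Sum>e\<le>E. card (\<Union>p\<in>G. Bad e p))" by (rule card_UN_le) simp
    also have "\<dots> \<le> (\<Sum>e\<le>E. \<Sum>p\<in>G. card (Bad e p))" by (intro sum_mono card_UN_le finG)
    finally show ?thesis by (simp flip: of_nat_sum)
  qed
  also have "\<dots> \<le> (\<Sum>e\<le>E. \<Sum>p\<in>G. real T / real p ^ 2 + 1)"
    by (intro sum_mono card_Bad) auto
  also have "\<dots> \<le> (\<Sum>e\<le>E. \<Sum>p\<in>{Y<..Z}. real T / real p ^ 2 + 1)"
    by (intro sum_mono sum_mono2) (auto simp: G_def)
  also have "\<dots> = real (E + 1) * (real T * (\<Sum>p\<in>{Y<..Z}. 1 / real p ^ 2) + real (Z - Y))"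
    by (simp add: sum.distrib sum_distrib_left)
  also have "\<dots> \<le> real (E + 1) * (real T * (1 / real Y) + real Z)"
  proof -
    have "(\<Sum>p\<in>{Y<..Z}. 1 / real p ^ 2) \<le> 1 / real Y"
    proof (cases "Y \<le> Z")
      case True
      have "0 \<le> 1 / real Z" by simp
      moreover have "0 < Y" using assms(3) by simp
      ultimately show ?thesis using sum_inverse_squares_le[OF \<open>0 < Y\<close> True] by linarith
    qed simp
    then show ?thesis by (intro mult_left_mono add_mono) auto
  qed
  also have "\<dots> \<le> real T / 4 + real T / 2"
  proof -
    have "real (E + 1) * (1 / real Y) \<le> 1 / 4" using assms(3) by (simp add: field_simps)
    then have 1: "real T * (real (E + 1) * (1 / real Y)) \<le> real T * (1 / 4)" by (rule mult_left_mono) simp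
    have "2 * (E + 1) * (16 * D * z) \<le> z * (16 * D * z)" by (rule mult_right_mono) (simp_all add: z_def)
    then have "2 * (E + 1) * Z \<le> T" by (simp add: T_def Z_def power2_eq_square mult_ac)
    then have "real (2 * (E + 1) * Z) \<le> real T" by (simp only: of_nat_le_iff)
    then have 2: "real (E + 1) * real Z \<le> real T / 2" by (simp add: algebra_simps)
    show ?thesis using 1 2 by (simp add: algebra_simps)
  qed
  also have "\<dots> < real (card {..<T})" using T by simp
  finally have less: "card (\<Union>e\<le>E. \<Union>p\<in>G. Bad e p) < card {..<T}" by simp
  have "\<not> {..<T} \<subseteq> (\<Union>e\<le>E. \<Union>p\<in>G. Bad e p)"
  proof
    assume "{..<T} \<subseteq> (\<Union>e\<le>E. \<Union>p\<in>G. Bad e p)"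
    moreover have "finite (\<Union>e\<le>E. \<Union>p\<in>G. Bad e p)" using finG by (auto simp: Bad_def)
    ultimately show False
      using less card_mono by (metis leD)
  qed
  then obtain t where t: "t < T" "\<And>e p. e \<le> E \<Longrightarrow> p \<in> G \<Longrightarrow> t \<notin> Bad e p"
    unfolding subset_iff UN_iff atMost_iff lessThan_iff by blast
  show ?thesis
  proof (intro exI[of _ "r + D * t"] conjI allI impI)
    show "[r + D * t = r] (mod D)" by (simp add: cong_def)
    fix e p assume *: "e \<le> E" "prime p" "p > Y" "coprime p (2 * D)"
    show "\<not> p ^ 2 dvd 8 * (r + D * t - e) - 1"
    proof
      assume dvd: "p ^ 2 dvd 8 * (r + D * t - e) - 1"
      then have "p \<in> G" using large[OF dvd t(1) *(1)] * by (simp add: G_def)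
      then show False using t(2)[OF *(1)] dvd t(1) by (simp add: Bad_def)
    qed
  qed simp
qed

section \<open>Primes congruent to 3 modulo 4 and the flip of a single value\<close>

lemma mod_4_eq_1_of_prime_factors:
  fixes n :: nat
  assumes "n > 0" "\<And>p. prime p \<Longrightarrow> p dvd n \<Longrightarrow> p mod 4 = 1"
  shows "n mod 4 = 1"
  using assms
proof (induction n rule: less_induct)
  case (less n)
  show ?case
  proof (cases "n = 1")
    case False
    then obtain p where p: "prime p" "p dvd n" using prime_factor_nat by blast
    then obtain m where n: "n = p * m" by auto
    have "m > 0" using less.prems n by auto
    moreover have "m < n" using n prime_gt_1_nat[OF p(1)] \<open>m > 0\<close> by simp
    moreover have "q mod 4 = 1" if "prime q" "q dvd m" for q using that less.prems(2) n by simp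
    ultimately have "m mod 4 = 1" using less.IH by blast
    moreover have "p mod 4 = 1" using p less.prems(2) by blast
    ultimately show ?thesis unfolding n by (metis mod_mult_eq mult_1 mod_mod_trivial)
  qed simp
qed

text \<open>Euclid's argument with 4 Y! - 1: it is 3 modulo 4, so some prime factor is not 1 modulo
  4, and no prime up to Y divides it.\<close>

lemma ex_prime_3_mod_4_greater: "\<exists>p > Y. prime p \<and> p mod 4 = (3 :: nat)"
proof -
  let ?N = "4 * fact Y - 1 :: nat"
  have fact: "(fact Y :: nat) > 0" by simp
  then have N: "?N mod 4 = 3" "?N > 0" by (cases "fact Y :: nat"; simp)+
  then obtain p where p: "prime p" "p dvd ?N" "p mod 4 \<noteq> 1"
    using mod_4_eq_1_of_prime_factors[of ?N] by fastforce
  have "odd ?N" using fact by simp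
  then have "odd p" using p(2) dvd_trans by blast
  then have "p mod 4 = 3" using p(3) by presburger
  moreover have "p > Y"
  proof (rule ccontr)
    assume "\<not> p > Y"
    then have "p dvd fact Y" using p(1) by (simp add: prime_dvd_fact_iff)
    then have "p dvd 4 * fact Y" by simp
    then have "p dvd 1" using p(2) fact
      by (metis dvd_diff_nat diff_diff_cancel le_numeral_extra(4) Suc_leI One_nat_def mult_pos_pos zero_less_numeral)
    then show False using p(1) not_prime_1 by simp
  qed
  ultimately show ?thesis using p by blast
qed

text \<open>Modulo 8, p^2 is 1 and 2 p is 6, so 3 p^2 - 2 p is -3. For p congruent to 1 modulo 4 the
  same formula gives 1, and nothing would flip.\<close>

lemma pillai_prime_square_mod_8:
  assumes "prime p" "p mod 4 = 3"
  shows "[pillai (p ^ 2) = 5] (mod 8)"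
proof -
  define a where "a = p div 4"
  have p: "p = 4 * a + 3" using assms(2) by (simp add: a_def) presburger
  obtain x where "3 * p ^ 2 - 2 * p = 5 + 8 * x"
  proof
    show "3 * p ^ 2 - 2 * p = 5 + 8 * (6 * a ^ 2 + 8 * a + 2)"
      by (simp add: p power2_eq_square algebra_simps)
  qed
  then show ?thesis
    unfolding pillai_prime_square[OF assms(1)] by (simp add: cong_def)
qed

text \<open>The cofactor contributes 2 k - 1, which is 1 modulo 8; such a factor is
  invisible.\<close>

lemma pillai_mult_squarefree_mod_8:
  assumes "coprime m k" "[k = 1] (mod 8)" "squarefree k"
  shows "[pillai (m * k) = pillai m] (mod 8)"
proof -
  have "k mod 8 = 1" using assms(2) by (simp add: cong_def)
  then have "k = 1 + 8 * (k div 8)" by (metis mod_mult_div_eq)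
  then obtain q where k: "k = 1 + 8 * q" by blast
  have "odd k" by (simp add: k)
  then have "[pillai k = 2 * k - 1] (mod 8)" using assms(3) by (rule pillai_squarefree_mod_8)
  also have "2 * k - 1 = 1 + 8 * (2 * q)" by (simp add: k)
  also have "[1 + 8 * (2 * q) = 1] (mod 8)" unfolding cong_def by (rule mod_mult_self2)
  finally have "[pillai k = 1] (mod 8)" .
  then have "[pillai m * pillai k = pillai m * 1] (mod 8)" by (rule cong_scalar_left)
  then show ?thesis using pillai_mult[OF assms(1)] by simp
qed

text \<open>The sieve provides \<open>s\<close> for which each \<open>8 (s - e) - 1\<close> with \<open>e \<noteq> e0\<close> is \<open>8 (s0 - e) - 1\<close> times a
  squarefree number with large prime factors, whereas for \<open>e = e0\<close> there is an additional factor
  $p^2$ with $p \equiv 3$ modulo \<open>4\<close>.\<close>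

lemma pillai_flip:
  fixes s0 E e0 K :: nat
  assumes "s0 > E" "e0 \<le> E"
  shows "\<exists>s\<ge>s0. [s = s0] (mod 2 ^ K) \<and> [pillai (8 * (s - e0) - 1) = 5 * pillai (8 * (s0 - e0) - 1)] (mod 8) \<and>
    (\<forall>e\<le>E. e \<noteq> e0 \<longrightarrow> [pillai (8 * (s - e) - 1) = pillai (8 * (s0 - e) - 1)] (mod 8))"
proof -
  define m where "m e = 8 * (s0 - e) - 1" for e
  \<comment> \<open>\<open>Y\<close> exceeds every base value \<open>m e\<close> and every
    difference of two of the arguments. \<open>D\<close> contains both Y! and the product of the
    \<open>m e\<close>, so dividing it by one \<open>m e\<close> leaves a multiple of Y!, while the
    power of 2 keeps the prescribed class.\<close>
  define Y where "Y = 8 * s0 + 8 * E + 8"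
  define D where "D = 2 ^ K * fact Y * (\<Prod>e\<le>E. m e)"
  have m: "0 < m e" "m e \<le> Y" if "e \<le> E" for e
    using that assms by (auto simp: m_def Y_def)
  have "(\<Prod>e\<le>E. m e) > 0" using m by (intro prod_pos) auto
  then have D: "D > 0" by (simp add: D_def)
  obtain p where p: "p > Y" "prime p" "p mod 4 = 3" using ex_prime_3_mod_4_greater by blast
  have copD: "coprime q (2 * D)" if "prime q" "q > Y" for q
  proof -
    have small: "coprime q a" if "0 < a" "a \<le> Y" for a
      using that \<open>q > Y\<close> \<open>prime q\<close> by (intro prime_imp_coprime_nat) (auto dest: dvd_imp_le)
    have "coprime q (\<Prod>e\<le>E. m e)" by (intro prod_coprime_right small m) auto
    moreover have "coprime q (fact Y)"
      using that by (intro prime_imp_coprime_nat) (auto simp: prime_dvd_fact_iff)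
    moreover have "coprime q 2" by (rule small) (simp_all add: Y_def)
    ultimately show ?thesis by (simp add: D_def)
  qed
  have "coprime (8 * D) (p ^ 3)"
  proof -
    have "coprime p 2" "coprime p D" using copD[OF p(2,1)] by (simp_all only: coprime_mult_right_iff)
    then have "coprime p (2 ^ 3 * D)" by (simp only: coprime_mult_right_iff coprime_power_right_iff) simp
    then have "coprime (2 ^ 3 * D) (p ^ 3)" by (simp only: coprime_power_right_iff coprime_commute) simp
    then show ?thesis by simp
  qed
  then obtain t0 where t0: "[8 * D * t0 = 1] (mod p ^ 3)" using cong_solve_coprime_nat by (metis One_nat_def)
  \<comment> \<open>Solves m e0 + 8 D t = p^2 modulo p^3, so that p divides the value at
    \<open>e0\<close> exactly twice; the factor p^3 - 1 stands for -1 among the natural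
    numbers.\<close>
  define t where "t = t0 * (p ^ 2 + (p ^ 3 - 1) * m e0)"
  define s1 where "s1 = s0 + D * t"
  have s1_cong: "[m e0 + 8 * D * t = p ^ 2] (mod p ^ 3)"
  proof -
    have "[8 * D * t0 * (p ^ 2 + (p ^ 3 - 1) * m e0) = 1 * (p ^ 2 + (p ^ 3 - 1) * m e0)] (mod p ^ 3)"
      using t0 by (rule cong_scalar_right)
    then have "[m e0 + 8 * D * t = m e0 + 1 * (p ^ 2 + (p ^ 3 - 1) * m e0)] (mod p ^ 3)"
      unfolding t_def mult.assoc by (rule cong_add[OF cong_refl])
    also have "m e0 + 1 * (p ^ 2 + (p ^ 3 - 1) * m e0) = p ^ 2 + p ^ 3 * m e0"
      using prime_gt_0_nat[OF p(2)] by (cases "p ^ 3") simp_all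
    finally show ?thesis by (simp add: cong_def)
  qed
  \<comment> \<open>Sieving along the modulus D p^3 preserves the condition at p and exempts p
    itself from the sieve.\<close>
  have "D * p ^ 3 > 0" "s1 > E" "Y \<ge> 4 * (E + 1)"
    using D prime_gt_0_nat[OF p(2)] assms(1) by (auto simp: s1_def Y_def)
  then obtain s where s: "s \<ge> s1" "[s = s1] (mod D * p ^ 3)"
    and sieve: "\<And>e q. e \<le> E \<Longrightarrow> prime q \<Longrightarrow> q > Y \<Longrightarrow> coprime q (2 * (D * p ^ 3)) \<Longrightarrow> \<not> q ^ 2 dvd 8 * (s - e) - 1"
    using square_sieve[of "D * p ^ 3" E s1 Y] by blast
  have no_square: "\<not> q ^ 2 dvd 8 * (s - e) - 1" if "e \<le> E" "prime q" "q > Y" "q \<noteq> p" for e q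
  proof (rule sieve[OF that(1-3)])
    have "coprime q p" using that(2,4) p(2) by (simp add: primes_coprime)
    then show "coprime q (2 * (D * p ^ 3))" using copD[OF that(2,3)] by simp
  qed
  obtain u' where u': "s = s1 + D * p ^ 3 * u'"
  proof -
    have "D * p ^ 3 dvd s - s1" using s cong_altdef_nat by blast
    then obtain v where "s - s1 = D * p ^ 3 * v" by blast
    then show thesis using that[of v] s(1) by simp
  qed
  define u where "u = t + p ^ 3 * u'"
  have u: "s = s0 + D * u"
    by (simp add: u' s1_def u_def algebra_simps)
  \<comment> \<open>The cofactor of \<open>m e\<close> in 8 (s - e) - 1. It is 1 modulo 8 and modulo
    every prime up to \<open>Y\<close>, which makes it coprime to \<open>m e\<close> with only large
    prime factors.\<close>
  define k where "k e = 1 + 8 * (D div m e) * u" for e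
  have D_div: "D = m e * (D div m e)" "fact Y dvd D div m e" if "e \<le> E" for e
  proof -
    have "m e dvd (\<Prod>e\<le>E. m e)" using that by (intro dvd_prodI) auto
    then obtain c where "(\<Prod>e\<le>E. m e) = m e * c" by blast
    then have "D = m e * (fact Y * (2 ^ K * c))" by (simp add: D_def mult_ac)
    then show "D = m e * (D div m e)" "fact Y dvd D div m e" using m[OF that] by simp_all
  qed
  have val: "8 * (s - e) - 1 = m e + 8 * D * u" if "e \<le> E" for e
    using that assms by (simp add: u m_def algebra_simps diff_mult_distrib2)
  have mk: "8 * (s - e) - 1 = m e * k e" if "e \<le> E" for e
  proof -
    have "8 * D * u = m e * (8 * (D div m e) * u)" by (subst D_div(1)[OF that]) (simp only: mult_ac)
    then show ?thesis unfolding val[OF that] k_def by (simp add: distrib_left)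
  qed
  have k8: "[k e = 1] (mod 8)" for e
    unfolding k_def cong_def mult.assoc by (rule mod_mult_self2)
  have k_prime: "q > Y" if "e \<le> E" "prime q" "q dvd k e" for e q
  proof (rule ccontr)
    assume "\<not> q > Y"
    then have "q dvd fact Y" using that(2) by (simp add: prime_dvd_fact_iff)
    then have "q dvd 8 * (D div m e) * u" using D_div(2)[OF that(1)] by (meson dvd_mult dvd_mult2 dvd_trans)
    then have "q dvd 1" using that(3) unfolding k_def by (simp only: dvd_add_left_iff)
    then show False using that(2) not_prime_1 by simp
  qed
  have m_k: "coprime (m e) (k e)" if "e \<le> E" for e
  proof -
    have "m e dvd fact Y" using m[OF that] by (intro dvd_fact) auto
    then have "m e dvd 8 * (D div m e) * u" using D_div(2)[OF that] by (meson dvd_mult dvd_mult2 dvd_trans)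
    then obtain x where x: "8 * (D div m e) * u = m e * x" by blast
    have "k e = x * m e + 1" unfolding k_def x by simp
    then show ?thesis by (simp only: coprime_iff_gcd_eq_1 gcd_add_mult) simp
  qed
  have p_m: "\<not> p dvd m e" if "e \<le> E" for e
    using m[OF that] p(1) by (auto dest: dvd_imp_le)
  have squarefree: "squarefree c" if "e \<le> E" "c dvd k e" "\<not> p dvd c" for e c
  proof (rule ccontr)
    assume "\<not> squarefree c"
    moreover have "c \<noteq> 0" using that(3) by (metis dvd_0_right)
    ultimately obtain q where q: "prime q" "q ^ 2 dvd c"
      using squarefree_factorial_semiring[of c] by auto
    have qc: "q dvd c" using q(2) by (meson dvd_trans dvd_power pos2)
    then have "q > Y" using k_prime[OF that(1) q(1)] that(2) by (meson dvd_trans)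
    moreover have "q \<noteq> p" using qc that(3) by blast
    moreover have "q ^ 2 dvd 8 * (s - e) - 1"
      unfolding mk[OF that(1)] using q(2) that(2) by (meson dvd_mult dvd_trans)
    ultimately show False using no_square[OF that(1) q(1)] by blast
  qed
  have p_square: "[8 * (s - e0) - 1 = p ^ 2] (mod p ^ 3)"
  proof -
    have "8 * (s - e0) - 1 = m e0 + 8 * D * t + p ^ 3 * (8 * D * u')"
      unfolding val[OF assms(2)] by (simp add: u_def algebra_simps)
    then show ?thesis using s1_cong by (simp add: cong_def)
  qed
  have p23: "p ^ 2 dvd p ^ 3" by (rule le_imp_power_dvd) simp
  have p2_dvd: "p ^ 2 dvd 8 * (s - e0) - 1"
    using cong_dvd_iff[OF cong_dvd_modulus_nat[OF p_square p23]] by simp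
  have p3_ndvd: "\<not> p ^ 3 dvd 8 * (s - e0) - 1"
  proof
    assume "p ^ 3 dvd 8 * (s - e0) - 1"
    then have "p ^ 3 dvd p ^ 2" using cong_dvd_iff[OF p_square] by simp
    then have "p ^ 3 \<le> p ^ 2" using prime_gt_0_nat[OF p(2)] by (intro dvd_imp_le) simp_all
    then show False using power_strict_increasing[of 2 3 p] prime_gt_1_nat[OF p(2)] by simp
  qed
  have other: "[pillai (8 * (s - e) - 1) = pillai (m e)] (mod 8)" if e: "e \<le> E" "e \<noteq> e0" for e
    unfolding mk[OF e(1)]
  proof (rule pillai_mult_squarefree_mod_8[OF m_k[OF e(1)] k8 squarefree[OF e(1) dvd_refl]])
    show "\<not> p dvd k e"
    proof
      assume "p dvd k e"
      then have pe: "p dvd 8 * (s - e) - 1" unfolding mk[OF e(1)] by simp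
      have pe0: "p dvd 8 * (s - e0) - 1"
        using p2_dvd by (meson dvd_power dvd_trans pos2)
      have sE: "s > E" using u assms(1) by simp
      \<comment> \<open>The absolute difference of the two arguments: one of the two truncated
        subtractions is zero. It is nonzero and at most \<open>Y\<close>, hence too small for
        p.\<close>
      have "p dvd 8 * (e0 - e) + 8 * (e - e0)"
      proof (cases "e \<le> e0")
        case True
        then have "8 * (s - e) - 1 = (8 * (s - e0) - 1) + 8 * (e0 - e)" using sE e(1) assms(2) by linarith
        then show ?thesis using True pe pe0 dvd_add_right_iff[OF pe0] by simp
      next
        case False
        then have "8 * (s - e0) - 1 = (8 * (s - e) - 1) + 8 * (e - e0)" using sE e(1) assms(2) by linarith
        then show ?thesis using False pe pe0 dvd_add_right_iff[OF pe] by simp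
      qed
      moreover have "0 < 8 * (e0 - e) + 8 * (e - e0)" using e(2) by linarith
      ultimately have "p \<le> 8 * (e0 - e) + 8 * (e - e0)" by (rule dvd_imp_le)
      then show False using p(1) e(1) assms(2) unfolding Y_def by linarith
    qed
  qed
  have flip: "[pillai (8 * (s - e0) - 1) = 5 * pillai (m e0)] (mod 8)"
  proof -
    have cop0: "coprime (p ^ 2) (m e0)"
      using p_m[OF assms(2)] p(2) by (simp add: prime_imp_coprime_nat)
    then have "p ^ 2 dvd k e0"
      using p2_dvd unfolding mk[OF assms(2)] by (simp only: coprime_dvd_mult_right_iff)
    then obtain k' where k': "k e0 = p ^ 2 * k'" by blast
    have pk': "\<not> p dvd k'"
    proof
      assume "p dvd k'"
      then have "p ^ 2 * p dvd p ^ 2 * k'" by (rule mult_dvd_mono[OF dvd_refl])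
      then have "p ^ 3 dvd k e0" unfolding k' by (simp add: power3_eq_cube power2_eq_square mult.assoc)
      then show False using p3_ndvd unfolding mk[OF assms(2)] by simp
    qed
    have p8: "[p ^ 2 = 1] (mod 8)"
    proof -
      define a where "a = p div 4"
      have "p = 4 * a + 3" using p(3) unfolding a_def by presburger
      then have "p ^ 2 = 1 + 8 * (2 * a ^ 2 + 3 * a + 1)" by (simp add: power2_eq_square algebra_simps)
      then show ?thesis unfolding cong_def by (metis mod_mult_self2)
    qed
    have "[p ^ 2 * k' = 1 * k'] (mod 8)" using p8 by (rule cong_scalar_right)
    then have k'8: "[k' = 1] (mod 8)" using k8[of e0] unfolding k' by (simp add: cong_def)
    have sq: "squarefree k'" by (rule squarefree[OF assms(2) _ pk']) (simp add: k')
    have cop1: "coprime (m e0) k'" using m_k[OF assms(2)] unfolding k' by simp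
    have "coprime (p ^ 2) k'" using pk' p(2) by (simp add: prime_imp_coprime_nat)
    then have cop2: "coprime (p ^ 2) (m e0 * k')" using cop0 by simp
    have "8 * (s - e0) - 1 = p ^ 2 * (m e0 * k')" unfolding mk[OF assms(2)] k' by (simp only: mult_ac)
    then have "pillai (8 * (s - e0) - 1) = pillai (p ^ 2) * pillai (m e0 * k')"
      using pillai_mult[OF cop2] by simp
    then show ?thesis
      using cong_mult[OF pillai_prime_square_mod_8[OF p(2,3)] pillai_mult_squarefree_mod_8[OF cop1 k'8 sq]] by simp
  qed
  have "s \<ge> s0" "[s = s0] (mod 2 ^ K)"
    unfolding u D_def by (simp_all add: cong_def mult.assoc)
  then show ?thesis using flip other unfolding m_def by blast
qed

section \<open>Parallel pairs of vectors in the hexagonal norm\<close>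

text \<open>Twice a norm whose unit ball is a hexagon. It arises as the total length of three
  exponents with sum zero, two of which are free.\<close>

definition hexnorm :: "int \<times> int \<Rightarrow> int" where
  "hexnorm C = \<bar>fst C\<bar> + \<bar>snd C\<bar> + \<bar>fst C + snd C\<bar>"

definition scale :: "int \<Rightarrow> int \<times> int \<Rightarrow> int \<times> int" where
  "scale k C = (k * fst C, k * snd C)"

definition vec_content :: "int \<times> int \<Rightarrow> nat" where
  "vec_content C = nat (gcd (fst C) (snd C))"

text \<open>The primitive vector in the direction of \<open>C\<close>; for the zero vector, division
  by 0 returns zero, so \<open>scale_prim\<close> has no exception.\<close>

definition prim :: "int \<times> int \<Rightarrow> int \<times> int" where
  "prim C = (fst C div gcd (fst C) (snd C), snd C div gcd (fst C) (snd C))"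

lemma hexnorm_scale: "hexnorm (scale k C) = \<bar>k\<bar> * hexnorm C"
  by (simp add: hexnorm_def scale_def abs_mult algebra_simps flip: distrib_left)

lemma hexnorm_eq_0_iff: "hexnorm C = 0 \<longleftrightarrow> C = (0, 0)"
  by (cases C) (auto simp: hexnorm_def)

lemma vec_content_scale: "vec_content (scale k C) = nat \<bar>k\<bar> * vec_content C"
  by (simp add: vec_content_def scale_def nat_mult_distrib flip: gcd_mult_distrib_int)

lemma scale_prim: "scale (int (vec_content C)) (prim C) = C"
  by (simp add: vec_content_def scale_def prim_def)

lemma vec_content_eq_0_iff: "vec_content C = 0 \<longleftrightarrow> C = (0, 0)"
  by (cases C) (simp add: vec_content_def nat_eq_iff2 order_antisym_conv[OF gcd_ge_0_int])

lemma vec_content_prim: "C \<noteq> (0, 0) \<Longrightarrow> vec_content (prim C) = 1"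
  by (cases C) (auto simp: vec_content_def prim_def div_gcd_coprime)

lemma prim_scale: "vec_content E = 1 \<Longrightarrow> k > 0 \<Longrightarrow> prim (scale k E) = E"
  by (cases E) (simp add: vec_content_def prim_def scale_def nat_eq_iff flip: gcd_mult_distrib_int)

section \<open>Lattice points on a hexagon\<close>

definition hexagon :: "nat \<Rightarrow> (int \<times> int) set" where
  "hexagon n = {C. hexnorm C = 2 * int n}"

lemma finite_hexagon: "finite (hexagon n)"
proof (rule finite_subset)
  show "hexagon n \<subseteq> {- int (2 * n)..int (2 * n)} \<times> {- int (2 * n)..int (2 * n)}"
    by (auto simp: hexagon_def hexnorm_def)
qed simp

text \<open>Six half-open sides with \<open>n\<close> points each, so that every corner is met
  once.\<close>

lemma sum_hexagon:
  fixes F :: "int \<times> int \<Rightarrow> int"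
  assumes "n > 0"
  shows "sum F (hexagon n) = (\<Sum>k<n. F (int n - int k, int k) + F (- int k, int n) + F (- int n, int n - int k)
    + F (int k - int n, - int k) + F (int k, - int n) + F (int n, int k - int n))"
proof -
  define g where "g = (\<lambda>(i :: nat, k :: nat). [(int n - int k, int k), (- int k, int n), (- int n, int n - int k),
    (int k - int n, - int k), (int k, - int n), (int n, int k - int n)] ! i)"
  \<comment> \<open>The inverse of \<open>g\<close>: the index of the side, followed by the position
    on it.\<close>
  define h where "h = (\<lambda>(x, y). if x > 0 \<and> y \<ge> 0 then (0 :: nat, nat y)
    else if x \<le> 0 \<and> x + y > 0 then (1, nat (- x)) else if y > 0 \<and> x + y \<le> 0 then (2, nat (- x - y))
    else if x < 0 \<and> y \<le> 0 then (3, nat (- y)) else if x \<ge> 0 \<and> x + y < 0 then (4, nat x) else (5, nat (x + y)))"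
  have range: "{..<6 :: nat} = {0, 1, 2, 3, 4, 5}" by auto
  have "sum F (hexagon n) = (\<Sum>p\<in>{..<6} \<times> {..<n}. F (g p))"
  proof (rule sum.reindex_bij_witness[of _ g h])
    fix C assume C: "C \<in> hexagon n"
    obtain x y where xy: "C = (x, y)" by (cases C)
    have nz: "\<bar>x\<bar> + \<bar>y\<bar> + \<bar>x + y\<bar> = 2 * int n" using C xy by (simp add: hexagon_def hexnorm_def)
    show "g (h C) = C" "h C \<in> {..<6} \<times> {..<n}"
      using nz assms by (auto simp: xy g_def h_def split: if_splits)
    then show "F (g (h C)) = F C" by simp
  next
    fix p assume p: "p \<in> {..<6 :: nat} \<times> {..<n}"
    then obtain i k where ik: "p = (i, k)" "k < n" "i \<in> {0, 1, 2, 3, 4, 5}"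
      unfolding range by (cases p) auto
    show "h (g p) = p" "g p \<in> hexagon n"
      using ik by (auto simp: g_def h_def hexagon_def hexnorm_def eval_nat_numeral)
  qed
  also have "\<dots> = (\<Sum>k<n. \<Sum>i<6. F (g (i, k)))"
    by (subst sum.swap) (simp add: sum.cartesian_product)
  also have "\<dots> = (\<Sum>k<n. F (int n - int k, int k) + F (- int k, int n) + F (- int n, int n - int k)
    + F (int k - int n, - int k) + F (int k, - int n) + F (int n, int k - int n))"
    unfolding range by (simp add: g_def eval_nat_numeral add.assoc)
  finally show ?thesis .
qed

text \<open>On every side the coordinates are, up to sign, two of k, n - k and n. This is where
  Pillai's gcd sum enters.\<close>

lemma vec_content_sides:
  assumes "k < n"
  shows "vec_content (int n - int k, int k) = gcd k n" "vec_content (- int k, int n) = gcd k n"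
    "vec_content (- int n, int n - int k) = gcd k n" "vec_content (int k - int n, - int k) = gcd k n"
    "vec_content (int k, - int n) = gcd k n" "vec_content (int n, int k - int n) = gcd k n"
proof -
  have g: "gcd (int k) (int n) = int (gcd k n)" by simp
  have d: "gcd (int n - int k) (int n) = gcd (int k) (int n)" "gcd (int n - int k) (int k) = gcd (int k) (int n)"
    by (metis gcd.commute gcd_diff1 gcd_diff2)+
  have d': "gcd (int k - int n) (int n) = gcd (int k) (int n)" "gcd (int k - int n) (int k) = gcd (int k) (int n)"
    using d by (metis gcd_neg1_int minus_diff_eq)+
  show "vec_content (int n - int k, int k) = gcd k n" "vec_content (- int k, int n) = gcd k n"
    "vec_content (- int n, int n - int k) = gcd k n" "vec_content (int k - int n, - int k) = gcd k n"
    "vec_content (int k, - int n) = gcd k n" "vec_content (int n, int k - int n) = gcd k n"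
    unfolding vec_content_def by (simp_all add: d d' g gcd.commute[of "int n"])
qed

lemma card_hexagon: "n > 0 \<Longrightarrow> card (hexagon n) = 6 * n"
  using sum_hexagon[of n "\<lambda>_. 1"] by simp

lemma sum_vec_content_hexagon: "n > 0 \<Longrightarrow> (\<Sum>C\<in>hexagon n. int (vec_content C)) = 6 * int (pillai n)"
  unfolding sum_hexagon pillai_def of_nat_sum sum_distrib_left
  by (intro sum.cong) (simp_all add: vec_content_sides)

text \<open>The weight takes the values n, n - k, k on three consecutive sides and again on the
  opposite ones: altogether 4 n, independent of k.\<close>

lemma sum_vec_content_abs_hexagon:
  "n > 0 \<Longrightarrow> (\<Sum>C\<in>hexagon n. \<bar>fst C + snd C\<bar> * int (vec_content C)) = 4 * int n * int (pillai n)"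
  unfolding sum_hexagon pillai_def of_nat_sum sum_distrib_left
  by (intro sum.cong) (simp_all add: vec_content_sides algebra_simps)

section \<open>Pairs of parallel vectors\<close>

definition dot :: "int \<times> int \<Rightarrow> int \<times> int \<Rightarrow> int" where
  "dot A B = fst A * fst B + snd A * snd B"

definition parallel_pairs :: "nat \<Rightarrow> ((int \<times> int) \<times> (int \<times> int)) set" where
  "parallel_pairs n = {(A, B). fst A * snd B = snd A * fst B \<and> hexnorm A + hexnorm B = 2 * int n}"

lemma finite_parallel_pairs: "finite (parallel_pairs n)"
proof (rule finite_subset)
  let ?I = "{- int (2 * n)..int (2 * n)}"
  show "parallel_pairs n \<subseteq> (?I \<times> ?I) \<times> (?I \<times> ?I)"
    by (auto simp: parallel_pairs_def hexnorm_def)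
qed simp

text \<open>Both vectors are multiples of one primitive vector. Pairs with a zero vector have
  \<open>dot\<close> equal to 0 and fall under \<open>same\<close>, so that both multipliers are
  positive under \<open>opposite\<close>.\<close>

lemma parallel_cases:
  assumes "fst A * snd B = snd A * fst B" "(A, B) \<noteq> ((0, 0), (0, 0))"
  obtains (same) E a b where "vec_content E = 1" "A = scale (int a) E" "B = scale (int b) E" "a + b > 0" "dot A B \<ge> 0"
    | (opposite) E a b where "vec_content E = 1" "A = scale (int a) E" "B = scale (- int b) E" "a > 0" "b > 0" "dot A B < 0"
proof (cases "A = (0, 0)")
  case True
  then have B: "B \<noteq> (0, 0)" using assms by auto
  show thesis
    by (rule same[of "prim B" 0 "vec_content B"])
      (use True B scale_prim[of B] vec_content_prim[OF B] vec_content_eq_0_iff[of B] in \<open>auto simp: scale_def dot_def\<close>)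
next
  case False
  define E where "E = prim A"
  define a where "a = vec_content A"
  have E: "vec_content E = 1" and A: "A = scale (int a) E" and a: "a > 0"
    using False vec_content_eq_0_iff[of A] by (auto simp: E_def a_def scale_prim vec_content_prim)
  have "gcd (fst E) (snd E) = 1" using E by (simp add: vec_content_def nat_eq_iff)
  \<comment> \<open>Bezout coefficients of the primitive vector recover the multiplier of
    \<open>B\<close> as a linear form.\<close>
  then obtain u v where uv: "u * fst E + v * snd E = 1" using bezout_int by metis
  have par: "fst E * snd B = snd E * fst B" using assms(1) a by (simp add: A scale_def)
  define t where "t = u * fst B + v * snd B"
  have "t * fst E = fst B * (u * fst E + v * snd E)" "t * snd E = snd B * (u * fst E + v * snd E)"
    using par by (simp_all add: t_def algebra_simps)
  then have B: "B = scale t E" using uv by (cases B) (simp add: scale_def)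
  have "dot A B = int a * t * ((fst E)\<^sup>2 + (snd E)\<^sup>2)"
    by (simp add: A B dot_def scale_def power2_eq_square algebra_simps)
  moreover have "(fst E)\<^sup>2 + (snd E)\<^sup>2 > 0"
    using E vec_content_eq_0_iff[of E] by (cases E) (auto simp: sum_power2_gt_zero_iff)
  ultimately have dot: "dot A B \<ge> 0 \<longleftrightarrow> t \<ge> 0"
    using a by (simp add: zero_le_mult_iff mult.assoc)
  show thesis
  proof (cases "t \<ge> 0")
    case True
    then show thesis using same[of E a "nat t"] E A B a dot by auto
  next
    case False
    then show thesis using opposite[of E a "nat (- t)"] E A B a dot by auto
  qed
qed

lemma scale_add: "(fst (scale a E) + fst (scale b E), snd (scale a E) + snd (scale b E)) = scale (a + b) E"
  and scale_diff: "(fst (scale a E) - fst (scale b E), snd (scale a E) - snd (scale b E)) = scale (a - b) E"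
  by (simp_all add: scale_def algebra_simps)

text \<open>A pair of parallel vectors is recovered from their sum (or from their difference, if they
  point in opposite directions) together with the content of the first one.\<close>

lemma sum_parallel_pairs:
  fixes F :: "int \<times> int \<Rightarrow> int"
  assumes n: "n > 0"
  shows "(\<Sum>(A, B)\<in>parallel_pairs n. F A) = (\<Sum>C\<in>hexagon n.
    (\<Sum>i\<le>vec_content C. F (scale (int i) (prim C))) + (\<Sum>i\<in>{0<..<vec_content C}. F (scale (int i) (prim C))))"
proof -
  define S where "S = {(A, B) \<in> parallel_pairs n. dot A B \<ge> 0}"
  define O' where "O' = {(A, B) \<in> parallel_pairs n. dot A B < 0}"
  have "parallel_pairs n = S \<union> O'" by (auto simp: S_def O'_def)
  moreover have "finite S" "finite O'" "S \<inter> O' = {}"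
    by (auto simp: S_def O'_def intro: finite_subset[OF _ finite_parallel_pairs])
  ultimately have split: "(\<Sum>(A, B)\<in>parallel_pairs n. F A) = (\<Sum>(A, B)\<in>S. F A) + (\<Sum>(A, B)\<in>O'. F A)"
    by (simp add: sum.union_disjoint)
  have nz: "C \<noteq> (0, 0)" if "C \<in> hexagon n" for C
    using that n hexnorm_eq_0_iff[of C] by (auto simp: hexagon_def)
  have pnz: "(A, B) \<noteq> ((0, 0), (0, 0))" if "(A, B) \<in> parallel_pairs n" for A B
    using that n by (auto simp: parallel_pairs_def hexnorm_def)
  have hp: "int (vec_content C) * hexnorm (prim C) = hexnorm C" for C
    using hexnorm_scale[of "int (vec_content C)" "prim C"] by (simp add: scale_prim)
  have S_cases: "\<exists>E a b. vec_content E = 1 \<and> p = (scale (int a) E, scale (int b) E) \<and> a + b > 0 \<and> scale (int (a + b)) E \<in> hexagon n"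
    if "p \<in> S" for p
  proof -
    obtain A B where p: "p = (A, B)" by (cases p)
    have *: "fst A * snd B = snd A * fst B" "hexnorm A + hexnorm B = 2 * int n" "dot A B \<ge> 0" "(A, B) \<in> parallel_pairs n"
      using that p by (auto simp: S_def parallel_pairs_def)
    show ?thesis
      by (rule parallel_cases[OF *(1) pnz[OF *(4)]])
        (use * p in \<open>auto simp: hexagon_def hexnorm_scale algebra_simps intro!: exI\<close>)
  qed
  have O_cases: "\<exists>E a b. vec_content E = 1 \<and> p = (scale (int a) E, scale (- int b) E) \<and> a > 0 \<and> b > 0 \<and> scale (int (a + b)) E \<in> hexagon n"
    if "p \<in> O'" for p
  proof -
    obtain A B where p: "p = (A, B)" by (cases p)
    have *: "fst A * snd B = snd A * fst B" "hexnorm A + hexnorm B = 2 * int n" "dot A B < 0" "(A, B) \<in> parallel_pairs n"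
      using that p by (auto simp: O'_def parallel_pairs_def)
    show ?thesis
      by (rule parallel_cases[OF *(1) pnz[OF *(4)]])
        (use * p in \<open>auto simp: hexagon_def hexnorm_scale algebra_simps intro!: exI\<close>)
  qed
  have "(\<Sum>(A, B)\<in>S. F A) = (\<Sum>(C, i)\<in>(SIGMA C:hexagon n. {..vec_content C}). F (scale (int i) (prim C)))"
  proof (rule sum.reindex_bij_witness[of _
        "\<lambda>(C, i). (scale (int i) (prim C), scale (int (vec_content C) - int i) (prim C))"
        "\<lambda>(A, B). ((fst A + fst B, snd A + snd B), vec_content A)"])
    fix p assume "p \<in> S"
    then obtain E a b where *: "vec_content E = 1" "p = (scale (int a) E, scale (int b) E)" "a + b > 0"
      "scale (int (a + b)) E \<in> hexagon n" using S_cases by blast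
    show "(case case p of (A, B) \<Rightarrow> ((fst A + fst B, snd A + snd B), vec_content A) of
        (C, i) \<Rightarrow> (scale (int i) (prim C), scale (int (vec_content C) - int i) (prim C))) = p"
      "(case p of (A, B) \<Rightarrow> ((fst A + fst B, snd A + snd B), vec_content A)) \<in> (SIGMA C:hexagon n. {..vec_content C})"
      "(case case p of (A, B) \<Rightarrow> ((fst A + fst B, snd A + snd B), vec_content A) of (C, i) \<Rightarrow> F (scale (int i) (prim C)))
        = (case p of (A, B) \<Rightarrow> F A)"
      using * prim_scale[OF *(1), of "int a + int b"] by (auto simp: scale_add vec_content_scale nat_add_distrib)
  next
    fix q assume q: "q \<in> (SIGMA C:hexagon n. {..vec_content C})"
    then obtain C i where Ci: "q = (C, i)" "C \<in> hexagon n" "i \<le> vec_content C" by auto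
    note E = vec_content_prim[OF nz[OF Ci(2)]]
    have "int i * (int (vec_content C) - int i) * ((fst (prim C))\<^sup>2 + (snd (prim C))\<^sup>2) \<ge> 0" using Ci by simp
    then have "dot (scale (int i) (prim C)) (scale (int (vec_content C) - int i) (prim C)) \<ge> 0"
      by (simp add: dot_def scale_def power2_eq_square algebra_simps)
    then show "(case q of (C, i) \<Rightarrow> (scale (int i) (prim C), scale (int (vec_content C) - int i) (prim C))) \<in> S"
      using Ci hp[of C] by (simp add: S_def parallel_pairs_def hexnorm_scale hexagon_def algebra_simps)
        (simp add: scale_def)
    show "(case case q of (C, i) \<Rightarrow> (scale (int i) (prim C), scale (int (vec_content C) - int i) (prim C)) of
        (A, B) \<Rightarrow> ((fst A + fst B, snd A + snd B), vec_content A)) = q"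
      using Ci E by (simp add: scale_add vec_content_scale scale_prim)
  qed
  \<comment> \<open>Both end points are excluded here: there one vector is zero, and the pair has
    been counted in \<open>S\<close>.\<close>
  moreover have "(\<Sum>(A, B)\<in>O'. F A) = (\<Sum>(C, i)\<in>(SIGMA C:hexagon n. {0<..<vec_content C}). F (scale (int i) (prim C)))"
  proof (rule sum.reindex_bij_witness[of _
        "\<lambda>(C, i). (scale (int i) (prim C), scale (int i - int (vec_content C)) (prim C))"
        "\<lambda>(A, B). ((fst A - fst B, snd A - snd B), vec_content A)"])
    fix p assume "p \<in> O'"
    then obtain E a b where *: "vec_content E = 1" "p = (scale (int a) E, scale (- int b) E)" "a > 0" "b > 0"
      "scale (int (a + b)) E \<in> hexagon n" using O_cases by blast
    show "(case case p of (A, B) \<Rightarrow> ((fst A - fst B, snd A - snd B), vec_content A) of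
        (C, i) \<Rightarrow> (scale (int i) (prim C), scale (int i - int (vec_content C)) (prim C))) = p"
      "(case p of (A, B) \<Rightarrow> ((fst A - fst B, snd A - snd B), vec_content A)) \<in> (SIGMA C:hexagon n. {0<..<vec_content C})"
      "(case case p of (A, B) \<Rightarrow> ((fst A - fst B, snd A - snd B), vec_content A) of (C, i) \<Rightarrow> F (scale (int i) (prim C)))
        = (case p of (A, B) \<Rightarrow> F A)"
      using * prim_scale[of E "int (a + b)"] by (simp_all add: scale_diff vec_content_scale nat_add_distrib)
  next
    fix q assume q: "q \<in> (SIGMA C:hexagon n. {0<..<vec_content C})"
    then obtain C i where Ci: "q = (C, i)" "C \<in> hexagon n" "0 < i" "i < vec_content C" by auto
    note E = vec_content_prim[OF nz[OF Ci(2)]]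
    have "(fst (prim C))\<^sup>2 + (snd (prim C))\<^sup>2 > 0"
      using E vec_content_eq_0_iff[of "prim C"] by (cases "prim C") (auto simp: sum_power2_gt_zero_iff)
    then have "int i * (int (vec_content C) - int i) * ((fst (prim C))\<^sup>2 + (snd (prim C))\<^sup>2) > 0" using Ci by simp
    then have "dot (scale (int i) (prim C)) (scale (int i - int (vec_content C)) (prim C)) < 0"
      by (simp add: dot_def scale_def power2_eq_square algebra_simps)
    then show "(case q of (C, i) \<Rightarrow> (scale (int i) (prim C), scale (int i - int (vec_content C)) (prim C))) \<in> O'"
      using Ci hp[of C] by (simp add: O'_def parallel_pairs_def hexnorm_scale hexagon_def algebra_simps)
        (simp add: scale_def)
    show "(case case q of (C, i) \<Rightarrow> (scale (int i) (prim C), scale (int i - int (vec_content C)) (prim C)) of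
        (A, B) \<Rightarrow> ((fst A - fst B, snd A - snd B), vec_content A)) = q"
      using Ci E by (simp add: scale_diff vec_content_scale scale_prim)
  qed
  ultimately show ?thesis
    unfolding split by (simp add: sum.Sigma[symmetric] finite_hexagon sum.distrib)
qed

text \<open>A vector of content g arises from (g + 1) + (g - 1) = 2 g pairs.\<close>

lemma card_parallel_pairs: "n > 0 \<Longrightarrow> card (parallel_pairs n) = 12 * pillai n"
proof -
  assume n: "n > 0"
  have "int (card (parallel_pairs n)) = (\<Sum>(A, B)\<in>parallel_pairs n. 1)" by (simp add: case_prod_unfold)
  also have "\<dots> = (\<Sum>C\<in>hexagon n. 2 * int (vec_content C))"
    unfolding sum_parallel_pairs[OF n, of "\<lambda>_. 1"]
  proof (rule sum.cong)
    fix C assume "C \<in> hexagon n"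
    then have "vec_content C > 0" using n hexnorm_eq_0_iff[of C] vec_content_eq_0_iff[of C] by (auto simp: hexagon_def)
    then show "(\<Sum>i\<le>vec_content C. 1) + (\<Sum>i\<in>{0<..<vec_content C}. 1) = 2 * int (vec_content C)" by simp
  qed simp
  also have "\<dots> = 12 * int (pillai n)"
    using sum_vec_content_hexagon[OF n] by (simp flip: sum_distrib_left)
  finally show ?thesis by linarith
qed

text \<open>For content g the multipliers i of the two kinds of pairs add up to g^2, so a vector
  contributes its own weight times its content.\<close>

lemma sum_abs_parallel_pairs:
  assumes n: "n > 0"
  shows "(\<Sum>(A, B)\<in>parallel_pairs n. \<bar>fst A + snd A\<bar>) = 4 * int n * int (pillai n)"
  unfolding sum_parallel_pairs[OF n, of "\<lambda>A. \<bar>fst A + snd A\<bar>"] sum_vec_content_abs_hexagon[OF n, symmetric]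
proof (rule sum.cong)
  fix C assume "C \<in> hexagon n"
  define E g where "E = prim C" and "g = vec_content C"
  have g: "g > 0" using \<open>C \<in> hexagon n\<close> n hexnorm_eq_0_iff[of C] vec_content_eq_0_iff[of C]
    by (auto simp: hexagon_def g_def)
  have C: "C = scale (int g) E" by (simp add: E_def g_def scale_prim)
  have abs: "\<bar>fst (scale (int i) E) + snd (scale (int i) E)\<bar> = int i * \<bar>fst E + snd E\<bar>" for i
    by (simp add: scale_def abs_mult flip: distrib_left)
  have "(\<Sum>i\<le>m. int i) + (\<Sum>i\<in>{0<..<m}. int i) = int m * int m" if "m > 0" for m
    using that
  proof (induction m rule: nat_induct_non_zero)
    case (Suc m)
    have "{0<..<Suc m} = insert m {0<..<m}" using Suc by auto
    then show ?case using Suc by (simp add: algebra_simps)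
  qed simp
  from this[OF g] have "(\<Sum>i\<le>g. int i * \<bar>fst E + snd E\<bar>) + (\<Sum>i\<in>{0<..<g}. int i * \<bar>fst E + snd E\<bar>) =
      int g * int g * \<bar>fst E + snd E\<bar>"
    by (simp flip: sum_distrib_right distrib_right)
  then show "(\<Sum>i\<le>vec_content C. \<bar>fst (scale (int i) (prim C)) + snd (scale (int i) (prim C))\<bar>) +
      (\<Sum>i\<in>{0<..<vec_content C}. \<bar>fst (scale (int i) (prim C)) + snd (scale (int i) (prim C))\<bar>) =
      \<bar>fst C + snd C\<bar> * int (vec_content C)"
    unfolding E_def[symmetric] g_def[symmetric] abs unfolding C abs by (simp add: mult_ac)
qed simp

section \<open>D-finiteness under a rational substitution\<close>

unbundle fps_syntax

section \<open>The Euler operator and polynomial recurrences\<close>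

text \<open>It multiplies the coefficient at n by n, so polynomial recurrences become linear
  differential equations in this operator.\<close>

definition theta :: "int fps \<Rightarrow> int fps" where
  "theta f = fps_X * fps_deriv f"

lemma theta_sum: "theta (sum f A) = (\<Sum>x\<in>A. theta (f x))"
  by (simp add: theta_def fps_deriv_sum sum_distrib_left)

lemma theta_mult: "theta (f * g) = theta f * g + f * theta g"
  by (simp add: theta_def algebra_simps)

lemma theta_fps_of_poly: "theta (fps_of_poly p) = fps_of_poly ([:0, 1:] * pderiv p)"
  unfolding theta_def fps_of_poly_mult by (simp add: fps_of_poly_pderiv)

lemma theta_nth: "theta f $ n = int n * f $ n"
  by (cases n) (simp_all add: theta_def)

lemma theta_power_nth: "(theta ^^ j) f $ n = int n ^ j * f $ n"
  by (induction j) (simp_all add: theta_nth)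

lemma poly_as_sum: "degree p \<le> d \<Longrightarrow> poly p x = (\<Sum>j\<le>d. coeff p j * x ^ j)" for p :: "int poly"
  unfolding poly_altdef by (rule sum.mono_neutral_left) (auto simp: coeff_eq_0)

lemma theta_power: "theta (f ^ Suc n) = of_nat (Suc n) * f ^ n * theta f"
  by (induction n) (simp_all add: theta_mult[of f] algebra_simps)

lemma theta_sum_mult:
  "theta (\<Sum>s\<le>j. b s * (theta ^^ s) H) =
     (\<Sum>s\<le>j. theta (b s) * (theta ^^ s) H) + (\<Sum>s\<le>j. b s * (theta ^^ Suc s) H)"
  by (simp add: theta_sum theta_mult sum.distrib)

text \<open>The substitution acts triangularly on derivatives; a nonzero top coefficient is what can
  be followed through it.\<close>

definition satisfies_ode :: "nat \<Rightarrow> (nat \<Rightarrow> int poly) \<Rightarrow> int fps \<Rightarrow> bool" where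
  "satisfies_ode J A f \<longleftrightarrow> A J \<noteq> 0 \<and> (\<Sum>j\<le>J. fps_of_poly (A j) * (theta ^^ j) f) = 0"

lemma fps_of_poly_mult_nth:
  "degree p \<le> d \<Longrightarrow> (fps_of_poly p * f) $ n = (\<Sum>i\<le>d. if i \<le> n then coeff p i * f $ (n - i) else 0)"
  for f :: "int fps"
proof -
  assume d: "degree p \<le> d"
  have "(fps_of_poly p * f) $ n = (\<Sum>i = 0..n. coeff p i * f $ (n - i))"
    by (simp add: fps_mult_nth)
  also have "\<dots> = (\<Sum>i \<le> max d n. if i \<le> n then coeff p i * f $ (n - i) else 0)"
    by (rule sum.mono_neutral_cong_left) auto
  also have "\<dots> = (\<Sum>i\<le>d. if i \<le> n then coeff p i * f $ (n - i) else 0)"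
    by (rule sum.mono_neutral_right) (use d in \<open>auto simp: coeff_eq_0\<close>)
  finally show ?thesis .
qed

lemma ode_of_D_finite:
  assumes "D_finite f"
  obtains J A where "satisfies_ode J A f"
proof -
  obtain k and p :: "nat \<Rightarrow> int poly" where p0: "p 0 \<noteq> 0"
    and rec: "\<And>n. n \<ge> k \<Longrightarrow> (\<Sum>i\<le>k. poly (p i) (int n) * f $ (n - i)) = 0"
    using assms unfolding D_finite_def by blast
  \<comment> \<open>The recurrence is known only from index \<open>k\<close> on; this polynomial
    vanishes at 0, ..., k - 1 and makes it hold everywhere.\<close>
  define P :: "int poly" where "P = (\<Prod>s<k. [:- int s, 1:])"
  have P: "P \<noteq> 0" by (simp add: P_def)
  \<comment> \<open>The shift expresses the coefficients in n - i, the index at which the Euler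
    operator acts on the term.\<close>
  define q where "q i = pcompose (p i * P) [:int i, 1:]" for i
  have q: "poly (q i) (int m) = poly (p i) (int (m + i)) * (\<Prod>s<k. int (m + i) - int s)" for i m
    by (simp add: q_def P_def poly_pcompose poly_prod algebra_simps)
  define d where "d = Max ((degree \<circ> q) ` {..k})"
  have d: "degree (q i) \<le> d" if "i \<le> k" for i
    unfolding d_def using that by (intro Max_ge) auto
  define A where "A j = (\<Sum>i\<le>k. monom (coeff (q i) j) i)" for j
  have coeff_A: "coeff (A j) i = (if i \<le> k then coeff (q i) j else 0)" for i j
    by (simp add: A_def coeff_sum)
  have degA: "degree (A j) \<le> k" for j
    by (rule degree_le) (simp add: coeff_A)
  have sum0: "(\<Sum>j\<le>d. fps_of_poly (A j) * (theta ^^ j) f) = 0"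
  proof (rule fps_ext)
    fix n
    have "(\<Sum>j\<le>d. fps_of_poly (A j) * (theta ^^ j) f) $ n =
        (\<Sum>j\<le>d. \<Sum>i\<le>k. if i \<le> n then coeff (q i) j * (int (n - i) ^ j * f $ (n - i)) else 0)"
      by (simp add: fps_sum_nth fps_of_poly_mult_nth[OF degA] theta_power_nth coeff_A cong: if_cong)
    also have "\<dots> = (\<Sum>i\<le>k. if i \<le> n then (\<Sum>j\<le>d. coeff (q i) j * int (n - i) ^ j) * f $ (n - i) else 0)"
      by (subst sum.swap) (auto intro!: sum.cong simp: sum_distrib_right mult.assoc)
    also have "\<dots> = (\<Sum>i\<le>k. if i \<le> n then poly (q i) (int (n - i)) * f $ (n - i) else 0)"
      by (intro sum.cong HOL.refl if_cong) (simp add: poly_as_sum[OF d])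
    also have "\<dots> = (\<Sum>i\<le>k. if i \<le> n then (\<Prod>s<k. int n - int s) * (poly (p i) (int n) * f $ (n - i)) else 0)"
    proof -
      have "poly (q i) (int (n - i)) = poly (p i) (int n) * (\<Prod>s<k. int n - int s)" if "i \<le> n" for i
        using q[of i "n - i"] that by simp
      then show ?thesis by (intro sum.cong HOL.refl if_cong) simp
    qed
    also have "\<dots> = 0"
    proof (cases "n < k")
      case True
      then have "(\<Prod>s<k. int n - int s) = 0" by auto
      then show ?thesis by (simp only: mult_zero_left if_cancel sum.neutral_const)
    next
      case False
      then have "(\<Sum>i\<le>k. if i \<le> n then (\<Prod>s<k. int n - int s) * (poly (p i) (int n) * f $ (n - i)) else 0)
        = (\<Prod>s<k. int n - int s) * (\<Sum>i\<le>k. poly (p i) (int n) * f $ (n - i))"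
        by (simp add: sum_distrib_left)
      then show ?thesis using rec False by simp
    qed
    finally show "(\<Sum>j\<le>d. fps_of_poly (A j) * (theta ^^ j) f) $ n = 0 $ n" by simp
  qed
  \<comment> \<open>The leading coefficient of \<open>q 0\<close> is the constant term of some
    \<open>A j\<close>, so the equation is not trivial.\<close>
  have "q 0 \<noteq> 0" using p0 P by (simp add: q_def pcompose_eq_0_iff)
  then have "coeff (A (degree (q 0))) 0 \<noteq> 0" by (simp add: coeff_A)
  then have ex: "A (degree (q 0)) \<noteq> 0 \<and> degree (q 0) \<le> d" using d[of 0] by auto
  define J where "J = (GREATEST j. A j \<noteq> 0 \<and> j \<le> d)"
  have J: "A J \<noteq> 0" "J \<le> d"
    unfolding J_def using GreatestI_nat[of "\<lambda>j. A j \<noteq> 0 \<and> j \<le> d", OF ex] by blast+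
  have zero: "A j = 0" if "j \<le> d" "J < j" for j
    using Greatest_le_nat[of "\<lambda>j. A j \<noteq> 0 \<and> j \<le> d" j d] that unfolding J_def by fastforce
  have "(\<Sum>j\<le>J. fps_of_poly (A j) * (theta ^^ j) f) = (\<Sum>j\<le>d. fps_of_poly (A j) * (theta ^^ j) f)"
    by (rule sum.mono_neutral_left) (use J zero in auto)
  then show thesis using J sum0 that[of J A] by (simp add: satisfies_ode_def)
qed

text \<open>Comparing coefficients gives a recurrence at every index, with terms of negative index
  dropped.\<close>

lemma D_finite_of_ode:
  assumes "satisfies_ode J E f"
  shows "D_finite f"
proof -
  have EJ: "E J \<noteq> 0" and ode: "(\<Sum>s\<le>J. fps_of_poly (E s) * (theta ^^ s) f) = 0"
    using assms by (auto simp: satisfies_ode_def)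
  define d where "d = Max ((degree \<circ> E) ` {..J})"
  have d: "degree (E s) \<le> d" if "s \<le> J" for s
    unfolding d_def using that by (intro Max_ge) auto
  define q where "q i = (\<Sum>s\<le>J. monom (coeff (E s) i) s)" for i
  have coeff_q: "coeff (q i) s = (if s \<le> J then coeff (E s) i else 0)" for i s
    by (simp add: q_def coeff_sum)
  define c where "c i = pcompose (q i) [:- int i, 1:]" for i
  have poly_c: "poly (c i) (int n) = (\<Sum>s\<le>J. coeff (E s) i * int (n - i) ^ s)" if "i \<le> n" for i n
    using that by (simp add: c_def q_def poly_pcompose poly_sum poly_monom of_nat_diff algebra_simps)
  have rec: "(\<Sum>i\<le>d. if i \<le> n then poly (c i) (int n) * f $ (n - i) else 0) = 0" for n
  proof -
    have "0 = (\<Sum>s\<le>J. fps_of_poly (E s) * (theta ^^ s) f) $ n"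
      by (simp add: ode)
    also have "\<dots> = (\<Sum>s\<le>J. \<Sum>i\<le>d. if i \<le> n then coeff (E s) i * (int (n - i) ^ s * f $ (n - i)) else 0)"
      unfolding fps_sum_nth
    proof (rule sum.cong)
      fix s assume "s \<in> {..J}"
      then have "degree (E s) \<le> d" by (simp add: d)
      then show "(fps_of_poly (E s) * (theta ^^ s) f) $ n =
          (\<Sum>i\<le>d. if i \<le> n then coeff (E s) i * (int (n - i) ^ s * f $ (n - i)) else 0)"
        by (simp add: fps_of_poly_mult_nth theta_power_nth cong: if_cong)
    qed simp
    also have "\<dots> = (\<Sum>i\<le>d. if i \<le> n then poly (c i) (int n) * f $ (n - i) else 0)"
      by (subst sum.swap) (auto intro!: sum.cong simp: poly_c sum_distrib_right mult.assoc)
    finally show ?thesis by simp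
  qed
  have "q (degree (E J)) \<noteq> 0"
    using EJ coeff_q[of "degree (E J)" J] by (auto simp: leading_coeff_0_iff)
  then have c_ne: "c (degree (E J)) \<noteq> 0" by (simp add: c_def pcompose_eq_0_iff)
  \<comment> \<open>The first polynomial of the recurrence must be nonzero: the leading zero
    polynomials are discarded and the index is shifted accordingly.\<close>
  define i0 where "i0 = (LEAST i. c i \<noteq> 0)"
  have i0: "c i0 \<noteq> 0" "\<And>i. i < i0 \<Longrightarrow> c i = 0"
    unfolding i0_def using LeastI[of "\<lambda>i. c i \<noteq> 0", OF c_ne] not_less_Least by blast+
  have i0d: "i0 \<le> d" unfolding i0_def using Least_le[of "\<lambda>i. c i \<noteq> 0", OF c_ne] d[of J] by simp
  define c' where "c' i = pcompose (c (i + i0)) [:int i0, 1:]" for i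
  have "c' 0 \<noteq> 0" using i0 by (simp add: c'_def pcompose_eq_0_iff)
  moreover have "(\<Sum>i\<le>d - i0. poly (c' i) (int n) * f $ (n - i)) = 0" if n: "n \<ge> d - i0" for n
  proof -
    have "0 = (\<Sum>i\<le>d. if i \<le> n + i0 then poly (c i) (int (n + i0)) * f $ (n + i0 - i) else 0)"
      using rec by simp
    also have "\<dots> = (\<Sum>i\<le>d. poly (c i) (int (n + i0)) * f $ (n + i0 - i))"
      using n by (intro sum.cong) auto
    also have "\<dots> = (\<Sum>i\<in>{i0..d}. poly (c i) (int (n + i0)) * f $ (n + i0 - i))"
      by (rule sum.mono_neutral_right) (auto simp: i0)
    also have "\<dots> = (\<Sum>i\<le>d - i0. poly (c (i + i0)) (int (n + i0)) * f $ (n + i0 - (i + i0)))"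
      by (rule sum.reindex_bij_witness[of _ "\<lambda>i. i + i0" "\<lambda>i. i - i0"]) (use i0d in auto)
    finally show ?thesis by (simp add: c'_def poly_pcompose add_ac)
  qed
  ultimately show ?thesis
    unfolding D_finite_def by (intro exI[of _ "d - i0"] exI[of _ c']) auto
qed

text \<open>The substitution $z = X / (1 + X^2)$ trades counting all words for counting reduced words:
  the walks on \<open>\<int>\<close> from \<open>0\<close> to \<open>a\<close> have generating function
  $X^{|a|} (1 + X^2) / (1 - X^2)$ in the new variable.\<close>

definition zeta :: "int fps" where
  "zeta = Abs_fps (\<lambda>n. if odd n then (- 1) ^ (n div 2) else 0)"

section \<open>Differential equations along \<open>zeta\<close>\<close>

definition Up :: "int poly" where "Up = [:1, 0, 1:]"
definition Vp :: "int poly" where "Vp = [:1, 0, - 1:]"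

lemma fps_Up: "fps_of_poly Up = 1 + fps_X ^ 2" and fps_Vp: "fps_of_poly Vp = 1 - fps_X ^ 2"
  by (simp_all add: Up_def Vp_def fps_of_poly_pCons power2_eq_square algebra_simps)

lemma UV_nonzero: "Up \<noteq> 0" "Vp \<noteq> 0"
  by (simp_all add: Up_def Vp_def)

lemma zeta_0 [simp]: "zeta $ 0 = 0"
  by (simp add: zeta_def)

lemma Up_zeta: "fps_of_poly Up * zeta = fps_X"
proof (rule fps_ext)
  fix n
  show "(fps_of_poly Up * zeta) $ n = fps_X $ n"
  proof (cases "n < 2")
    case True
    then consider "n = 0" | "n = 1" by linarith
    then show ?thesis by cases (simp_all add: fps_Up zeta_def distrib_right fps_X_power_mult_nth)
  next
    case False
    then obtain m where "n = m + 2" by (metis add.commute le_Suc_ex not_less)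
    then show ?thesis by (simp add: fps_Up zeta_def distrib_right fps_X_power_mult_nth)
  qed
qed

text \<open>Chain rule: the logarithmic derivative of X / (1 + X^2) under the Euler operator is (1 -
  X^2) / (1 + X^2).\<close>

lemma theta_compose_zeta: "fps_of_poly Up * theta (f oo zeta) = fps_of_poly Vp * (theta f oo zeta)"
proof -
  have "fps_deriv (fps_of_poly Up * zeta) = 1" by (simp add: Up_zeta)
  then have "fps_X * (2 * fps_X * zeta + fps_of_poly Up * fps_deriv zeta) = fps_X"
    by (simp add: fps_Up fps_deriv_power numeral_2_eq_2 algebra_simps)
  then have "fps_of_poly Up * (fps_X * fps_deriv zeta) = fps_X - 2 * fps_X ^ 2 * zeta"
    by (simp add: algebra_simps power2_eq_square)
  also have "\<dots> = fps_of_poly Up * zeta - 2 * fps_X ^ 2 * zeta"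
    by (simp add: Up_zeta)
  also have "\<dots> = fps_of_poly Vp * zeta"
    by (simp add: fps_Up fps_Vp algebra_simps)
  finally have "(fps_deriv f oo zeta) * (fps_of_poly Up * (fps_X * fps_deriv zeta)) =
    (fps_deriv f oo zeta) * (fps_of_poly Vp * zeta)" by simp
  then show ?thesis
    by (simp add: theta_def fps_compose_deriv fps_compose_mult_distrib algebra_simps)
qed

text \<open>Horner's scheme: a polynomial in \<open>zeta\<close> has a power of \<open>Up\<close> as
  denominator.\<close>

lemma fps_of_poly_compose_zeta:
  "\<exists>k B. (A \<noteq> 0 \<longrightarrow> B \<noteq> 0) \<and> fps_of_poly Up ^ k * (fps_of_poly A oo zeta) = fps_of_poly B"
proof (induction A)
  case 0
  show ?case by (intro exI[of _ 0]) simp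
next
  case (pCons a A)
  then obtain k B where B: "A \<noteq> 0 \<longrightarrow> B \<noteq> 0"
    "fps_of_poly Up ^ k * (fps_of_poly A oo zeta) = fps_of_poly B" by blast
  let ?B = "smult a (Up ^ Suc k) + pCons 0 B"
  have "fps_of_poly Up ^ Suc k * (fps_of_poly (pCons a A) oo zeta) =
    fps_const a * fps_of_poly Up ^ Suc k + (fps_of_poly Up * zeta) * (fps_of_poly Up ^ k * (fps_of_poly A oo zeta))"
    by (simp add: fps_of_poly_pCons fps_compose_add_distrib fps_compose_mult_distrib algebra_simps)
  also have "\<dots> = fps_of_poly ?B"
    unfolding B(2) Up_zeta fps_of_poly_add fps_of_poly_smult fps_of_poly_power
    by (simp add: fps_of_poly_pCons)
  finally have "fps_of_poly Up ^ Suc k * (fps_of_poly (pCons a A) oo zeta) = fps_of_poly ?B" .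
  moreover have "?B \<noteq> 0"
  proof (cases "a = 0")
    case False
    \<comment> \<open>\<open>Up\<close> has constant term 1, and the other summand has none.\<close>
    have "coeff ?B 0 = a" by (simp add: coeff_mult Up_def coeff_0_power)
    then show ?thesis using False by (metis coeff_0)
  qed (use B pCons in auto)
  ultimately show ?case by blast
qed

lemma sum_shift_combine:
  fixes T :: "nat \<Rightarrow> 'a :: comm_ring_1"
  shows "(\<Sum>s\<le>j. a s * T s) + (\<Sum>s\<le>j. b s * T (Suc s)) =
    (\<Sum>s\<le>Suc j. ((if s \<le> j then a s else 0) + (if s = 0 then 0 else b (s - 1))) * T s)"
proof -
  have "(\<Sum>s\<le>Suc j. (if s \<le> j then a s else 0) * T s) = (\<Sum>s\<le>j. a s * T s)"
    by (rule sum.mono_neutral_cong_right) auto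
  moreover have "(\<Sum>s\<le>Suc j. (if s = 0 then 0 else b (s - 1)) * T s) = (\<Sum>s\<le>j. b s * T (Suc s))"
    by (subst sum.atMost_Suc_shift) simp
  ultimately show ?thesis
    by (simp only: distrib_right sum.distrib)
qed

text \<open>The chain rule is inverted step by step. Each step multiplies the top coefficient by
  \<open>Up * Vp\<close>, so it remains nonzero; the lower ones absorb the derivatives of the
  factors.\<close>

lemma theta_power_compose_zeta:
  assumes "H = fps_of_poly Vp ^ e * (f oo zeta)"
  shows "\<exists>N B. B j \<noteq> 0 \<and>
    fps_of_poly Vp ^ N * ((theta ^^ j) f oo zeta) = (\<Sum>s\<le>j. fps_of_poly (B s) * (theta ^^ s) H)"
proof (induction j)
  case 0
  show ?case
    by (intro exI[of _ e] exI[of _ "\<lambda>_. 1"]) (simp add: assms)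
next
  case (Suc j)
  then obtain N B where B: "B j \<noteq> 0"
    "fps_of_poly Vp ^ N * ((theta ^^ j) f oo zeta) = (\<Sum>s\<le>j. fps_of_poly (B s) * (theta ^^ s) H)"
    by blast
  let ?U = "fps_of_poly Up" and ?V = "fps_of_poly Vp"
  let ?X = "(theta ^^ j) f oo zeta" and ?S = "\<Sum>s\<le>j. fps_of_poly (B s) * (theta ^^ s) H"
  define D where "D p = [:0, 1:] * pderiv p" for p :: "int poly"
  define Q where "Q s = Up * Vp * D (B s) - Up * of_nat N * D Vp * B s" for s
  have theta_poly: "theta (fps_of_poly p) = fps_of_poly (D p)" for p
    by (simp add: D_def theta_fps_of_poly)
  \<comment> \<open>Multiplying by \<open>Vp\<close> keeps the exponent at \<open>N\<close> and
    covers N = 0.\<close>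
  have theta_V: "?V * theta (?V ^ N) = of_nat N * ?V ^ N * fps_of_poly (D Vp)"
    using theta_power[of ?V] unfolding theta_poly[symmetric]
    by (cases N) (simp_all add: algebra_simps del: power_Suc, simp_all add: theta_def)
  have "?U * ?V * theta (?V ^ N * ?X) =
      ?U * (?V * theta (?V ^ N)) * ?X + ?V ^ (N + 1) * (?U * theta ?X)"
    by (simp add: theta_mult algebra_simps)
  also have "\<dots> = ?U * of_nat N * fps_of_poly (D Vp) * ?S + ?V ^ (N + 2) * ((theta ^^ Suc j) f oo zeta)"
    unfolding theta_V theta_compose_zeta B(2)[symmetric] by (simp add: algebra_simps)
  finally have "?V ^ (N + 2) * ((theta ^^ Suc j) f oo zeta) =
      ?U * ?V * theta ?S - ?U * of_nat N * fps_of_poly (D Vp) * ?S"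
    unfolding B(2) by (simp add: algebra_simps)
  also have "\<dots> = (\<Sum>s\<le>j. fps_of_poly (Q s) * (theta ^^ s) H)
      + (\<Sum>s\<le>j. fps_of_poly (Up * Vp * B s) * (theta ^^ Suc s) H)"
  proof -
    have N: "fps_of_poly (of_nat N) = of_nat N"
      by (simp add: of_nat_poly fps_of_poly_const fps_of_nat)
    show ?thesis
      unfolding Q_def theta_sum_mult theta_poly fps_of_poly_mult fps_of_poly_diff N
      by (simp only: left_diff_distrib distrib_left sum_distrib_left sum_subtractf mult.assoc diff_add_eq)
  qed
  also have "\<dots> = (\<Sum>s\<le>Suc j. fps_of_poly ((if s \<le> j then Q s else 0)
        + (if s = 0 then 0 else Up * Vp * B (s - 1))) * (theta ^^ s) H)"
    unfolding sum_shift_combine[of "\<lambda>s. fps_of_poly (Q s)" "\<lambda>s. (theta ^^ s) H" j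
        "\<lambda>s. fps_of_poly (Up * Vp * B s)"]
    by (intro sum.cong HOL.refl) (simp add: fps_of_poly_add)
  finally show ?case
    using B(1) UV_nonzero
    by (intro exI[of _ "N + 2"] exI[of _ "\<lambda>s. (if s \<le> j then Q s else 0)
        + (if s = 0 then 0 else Up * Vp * B (s - 1))"]) simp
qed

text \<open>Compose the equation for \<open>f\<close> with \<open>zeta\<close>, clear denominators
  by common powers of \<open>Up\<close> and \<open>Vp\<close>, and regroup by derivatives of the new
  series.\<close>

theorem D_finite_compose_zeta:
  assumes "D_finite f"
  shows "D_finite (fps_of_poly Vp ^ e * (f oo zeta))"
proof -
  define H where "H = fps_of_poly Vp ^ e * (f oo zeta)"
  let ?U = "fps_of_poly Up" and ?V = "fps_of_poly Vp"
  obtain J A where AJ: "A J \<noteq> 0" and ode: "(\<Sum>j\<le>J. fps_of_poly (A j) * (theta ^^ j) f) = 0"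
    using ode_of_D_finite[OF assms] unfolding satisfies_ode_def by blast
  obtain k A' where A': "\<And>j. A j \<noteq> 0 \<longrightarrow> A' j \<noteq> 0"
    "\<And>j. ?U ^ k j * (fps_of_poly (A j) oo zeta) = fps_of_poly (A' j)"
  proof -
    have "\<forall>j. \<exists>k B. (A j \<noteq> 0 \<longrightarrow> B \<noteq> 0) \<and> ?U ^ k * (fps_of_poly (A j) oo zeta) = fps_of_poly B"
      using fps_of_poly_compose_zeta by blast
    then show thesis using that unfolding choice_iff by blast
  qed
  have "\<forall>j. \<exists>N B. B j \<noteq> 0 \<and>
      ?V ^ N * ((theta ^^ j) f oo zeta) = (\<Sum>s\<le>j. fps_of_poly (B s) * (theta ^^ s) H)"
    using theta_power_compose_zeta[OF H_def] by blast
  then obtain N B where B: "\<And>j. B j j \<noteq> 0"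
    "\<And>j. ?V ^ N j * ((theta ^^ j) f oo zeta) = (\<Sum>s\<le>j. fps_of_poly (B j s) * (theta ^^ s) H)"
    unfolding choice_iff by blast
  define m where "m = (\<Sum>j\<le>J. k j + N j)"
  have m: "k j \<le> m" "N j \<le> m" if "j \<le> J" for j
    using member_le_sum[of j "{..J}" "\<lambda>j. k j + N j"] that by (simp_all add: m_def)
  define C where "C j s = (if s \<le> j then Up ^ (m - k j) * Vp ^ (m - N j) * A' j * B j s else 0)" for j s
  have summand: "?U ^ m * ?V ^ m * ((fps_of_poly (A j) * (theta ^^ j) f) oo zeta) =
      (\<Sum>s\<le>J. fps_of_poly (C j s) * (theta ^^ s) H)" if j: "j \<le> J" for j
  proof -
    have UV: "?U ^ m = ?U ^ (m - k j) * ?U ^ k j" "?V ^ m = ?V ^ (m - N j) * ?V ^ N j"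
      using m[OF j] by (simp_all flip: power_add)
    have "?U ^ m * ?V ^ m * ((fps_of_poly (A j) * (theta ^^ j) f) oo zeta) =
        ?U ^ (m - k j) * ?V ^ (m - N j) * (?U ^ k j * (fps_of_poly (A j) oo zeta)) *
          (?V ^ N j * ((theta ^^ j) f oo zeta))"
      unfolding UV fps_compose_mult_distrib[OF zeta_0] by (simp only: mult_ac)
    also have "\<dots> = (\<Sum>s\<le>j. fps_of_poly (C j s) * (theta ^^ s) H)"
      unfolding A' B by (simp add: C_def fps_of_poly_mult fps_of_poly_power sum_distrib_left mult.assoc)
    also have "\<dots> = (\<Sum>s\<le>J. fps_of_poly (C j s) * (theta ^^ s) H)"
      by (rule sum.mono_neutral_left) (use j in \<open>auto simp: C_def\<close>)
    finally show ?thesis .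
  qed
  define E where "E s = (\<Sum>j\<le>J. C j s)" for s
  have "(\<Sum>s\<le>J. fps_of_poly (E s) * (theta ^^ s) H) =
      (\<Sum>j\<le>J. \<Sum>s\<le>J. fps_of_poly (C j s) * (theta ^^ s) H)"
    by (subst sum.swap) (simp add: E_def fps_of_poly_sum sum_distrib_right)
  also have "\<dots> = ?U ^ m * ?V ^ m * ((\<Sum>j\<le>J. fps_of_poly (A j) * (theta ^^ j) f) oo zeta)"
    unfolding fps_compose_sum_distrib sum_distrib_left by (intro sum.cong HOL.refl) (simp add: summand)
  finally have "(\<Sum>s\<le>J. fps_of_poly (E s) * (theta ^^ s) H) = 0"
    by (simp add: ode)
  \<comment> \<open>By triangularity only the term of top order contributes to the top
    coefficient.\<close>
  moreover have "E J = C J J"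
  proof -
    have "E J = (\<Sum>j\<in>{J}. C j J)"
      unfolding E_def by (rule sum.mono_neutral_right) (auto simp: C_def)
    then show ?thesis by simp
  qed
  then have "E J \<noteq> 0"
    using AJ A'(1)[of J] B(1)[of J] UV_nonzero by (simp add: C_def)
  ultimately have "satisfies_ode J E H"
    by (simp add: satisfies_ode_def)
  then show ?thesis
    unfolding H_def[symmetric] by (rule D_finite_of_ode)
qed

section \<open>2-adic relations along a residue class\<close>

lemma cong_poly_int: "[x = y] (mod m) \<Longrightarrow> [poly p x = poly p y] (mod m)" for p :: "int poly" and x y m :: int
  by (induction p) (simp_all add: cong_add cong_mult)

text \<open>Eliminating between shifts of the recurrence at one fixed argument leaves a relation
  that only involves the positions congruent to \<open>r\<close> modulo \<open>M\<close>; after division by the largest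
  common power of \<open>2\<close> it holds modulo $2^b$ at all \<open>2\<close>-adically close arguments.\<close>

lemma D_finite_section_relation:
  fixes H :: "int fps" and M r b :: nat
  assumes "D_finite H" and M: "M > 0"
  shows "\<exists>E (w :: nat \<Rightarrow> int) i K. (\<exists>e\<le>E. odd (w e)) \<and>
    (\<forall>s>E. [s = i] (mod 2 ^ K) \<longrightarrow> [(\<Sum>e\<le>E. w e * H $ (M * (s - e) + r)) = 0] (mod 2 ^ b))"
proof -
  obtain d and p :: "nat \<Rightarrow> int poly" where p0: "p 0 \<noteq> 0"
    and rec: "\<And>n. n \<ge> d \<Longrightarrow> (\<Sum>i\<le>d. poly (p i) (int n) * H $ (n - i)) = 0"
    using assms(1) unfolding D_finite_def by blast
  \<comment> \<open>A window of M n positions holds m = M n - d shifts of the recurrence. Since n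
    exceeds d, this is more than the (M - 1) n positions in \<open>Q\<close> to be
    cancelled.\<close>
  define n where "n = Suc d"
  define m where "m = M * n - d"
  define Q where "Q = {e. e < M * n \<and> \<not> M dvd e}"
  have Mn: "d < M * n" using M unfolding n_def by (cases M) auto
  have "(M - 1) * n = M * n - n" by (simp add: diff_mult_distrib)
  moreover have "n \<le> M * n" using M by simp
  ultimately have "(M - 1) * n < m" using n_def m_def by linarith
  then have Q: "finite Q" "card Q < card {..<m}"
    using card_multiples_less[OF M, of n] by (simp_all add: Q_def)
  have "finite {y. poly (p 0) y = 0}" by (rule poly_roots_finite[OF p0])
  then have "bdd_above {y. poly (p 0) y = 0}" by (rule bdd_above_finite)
  then obtain B where B: "\<And>y. poly (p 0) y = 0 \<Longrightarrow> y \<le> B"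
    unfolding bdd_above_def by blast
  \<comment> \<open>Chosen so large that the first polynomial has no zero at any x - s with s below
    \<open>m\<close>.\<close>
  define i where "i = nat B + 1 + m"
  define x where "x = M * i + r"
  have "i \<le> M * i" using M by simp
  then have xB: "nat B + 1 + m \<le> x" by (simp add: x_def i_def)
  have x: "poly (p 0) (int x - int s) \<noteq> 0" if "s < m" for s
  proof
    assume "poly (p 0) (int x - int s) = 0"
    then have "int x - int s \<le> B" by (rule B)
    moreover have "B \<le> int (nat B)" by simp
    ultimately show False using that xB by linarith
  qed
  \<comment> \<open>The coefficient at distance \<open>e\<close> below \<open>y\<close> of the
    recurrence at index y - s. The multipliers \<open>l\<close> are found at \<open>x\<close> once
    and used at every \<open>y\<close>, on which the coefficients depend polynomially.\<close>
  define A where "A y e s = (if s \<le> e \<and> e - s \<le> d then poly (p (e - s)) (y - int s) else 0)" for y :: int and e s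
  obtain l where l: "\<exists>s<m. l s \<noteq> 0" "\<forall>e\<in>Q. (\<Sum>s<m. l s * A (int x) e s) = 0"
    using homogeneous_system_int[OF Q(1) _ Q(2), of "A (int x)"] by auto
  define U where "U y e = (\<Sum>s<m. l s * A y e s)" for y e
  define s0 where "s0 = (LEAST s. s < m \<and> l s \<noteq> 0)"
  have s0: "s0 < m" "l s0 \<noteq> 0" and s0_least: "\<And>s. s < s0 \<Longrightarrow> l s = 0 \<or> \<not> s < m"
    using LeastI_ex[OF l(1)] not_less_Least[of _ "\<lambda>s. s < m \<and> l s \<noteq> 0"]
    unfolding s0_def by blast+
  \<comment> \<open>At the first shift with a nonzero multiplier no other shift interferes, so the
    combined relation is not trivial.\<close>
  have "U (int x) s0 = (\<Sum>s\<in>{s0}. l s * A (int x) s0 s)"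
    unfolding U_def by (rule sum.mono_neutral_right) (use s0 s0_least in \<open>auto simp: A_def\<close>)
  then have U0: "U (int x) s0 \<noteq> 0" using s0 x by (simp add: A_def)
  have s0M: "s0 < M * n" using s0(1) m_def by linarith
  have rel: "(\<Sum>e<M * n. U (int k) e * H $ (k - e)) = 0" if k: "k \<ge> M * n" for k
  proof -
    have "(\<Sum>e<M * n. A (int k) e s * H $ (k - e)) = 0" if "s < m" for s
    proof -
      have sd: "s + d < M * n" using that m_def by linarith
      have "(\<Sum>e<M * n. A (int k) e s * H $ (k - e)) = (\<Sum>e\<in>{s..s + d}. A (int k) e s * H $ (k - e))"
        by (rule sum.mono_neutral_right) (use sd in \<open>auto simp: A_def\<close>)
      also have "\<dots> = (\<Sum>i\<le>d. poly (p i) (int (k - s)) * H $ (k - s - i))"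
        by (rule sum.reindex_bij_witness[of _ "\<lambda>i. s + i" "\<lambda>e. e - s"])
          (use k sd in \<open>auto simp: A_def of_nat_diff\<close>)
      also have "\<dots> = 0" by (rule rec) (use k sd in linarith)
      finally show ?thesis .
    qed
    then have "(\<Sum>s<m. l s * (\<Sum>e<M * n. A (int k) e s * H $ (k - e))) = 0" by simp
    then show ?thesis
      unfolding U_def sum_distrib_left sum_distrib_right by (subst sum.swap) (simp add: mult.assoc)
  qed
  have U_cong: "[U y e = U y' e] (mod c)" if "[y = y'] (mod c)" for y y' c e
    unfolding U_def A_def using that by (intro cong_sum cong_mult) (auto intro!: cong_poly_int cong_diff)
  \<comment> \<open>The largest such \<open>v\<close> exists because one entry is nonzero; after
    division by 2^v some coefficient is odd.\<close>
  define P where "P v = (\<forall>e<M * n. 2 ^ v dvd U (int x) e)" for v :: nat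
  have "\<not> P (nat \<bar>U (int x) s0\<bar>)"
  proof
    assume "P (nat \<bar>U (int x) s0\<bar>)"
    then have "2 ^ nat \<bar>U (int x) s0\<bar> \<le> \<bar>U (int x) s0\<bar>"
      using U0 s0M by (auto simp: P_def intro: zdvd_imp_le dest: dvd_imp_le_int)
    moreover have "int (nat \<bar>U (int x) s0\<bar>) < int (2 ^ nat \<bar>U (int x) s0\<bar>)"
      by (simp only: of_nat_less_iff less_exp)
    ultimately show False by simp
  qed
  moreover have "P v" if "\<And>v. P v \<Longrightarrow> P (Suc v)" for v
    by (induction v) (auto simp: P_def[of 0] intro: that)
  ultimately obtain v where v: "P v" "\<not> P (Suc v)" by blast
  define w where "w e = U (int x) (M * e) div 2 ^ v" for e
  have w: "U (int x) (M * e) = 2 ^ v * w e" if "e \<le> d" for e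
  proof -
    have "M * e < M * n" using that M by (simp add: n_def del: mult_Suc_right)
    then show ?thesis using v(1) by (simp add: w_def P_def)
  qed
  obtain e0 where e0: "e0 < M * n" "\<not> 2 ^ Suc v dvd U (int x) e0" using v(2) by (auto simp: P_def)
  have "U (int x) e0 \<noteq> 0" using e0 by auto
  then have "e0 \<notin> Q" using l(2) by (auto simp: U_def)
  then obtain e1 where e1: "e0 = M * e1" "e1 \<le> d"
    using e0(1) M by (auto simp: Q_def n_def less_Suc_eq_le simp del: mult_Suc_right elim!: dvdE)
  have "odd (w e1)"
    using e0(2) w[OF e1(2)] by (auto simp: e1(1))
  then have "\<exists>e\<le>d. odd (w e)" using e1(2) by blast
  \<comment> \<open>Arguments close modulo 2^(v + b) are needed, since the division by 2^v costs
    \<open>v\<close> powers of 2.\<close>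
  moreover have "[(\<Sum>e\<le>d. w e * H $ (M * (s - e) + r)) = 0] (mod 2 ^ b)"
    if s: "s > d" "[s = i] (mod 2 ^ (v + b))" for s
  proof -
    define k where "k = M * s + r"
    have "M * n \<le> M * s" using s(1) by (intro mult_le_mono2) (simp add: n_def)
    then have k: "k \<ge> M * n" unfolding k_def by (rule trans_le_add1)
    have "[int s = int i] (mod int (2 ^ (v + b)))" using s(2) cong_int_iff by blast
    then have "[int k = int x] (mod 2 ^ (v + b))"
      unfolding k_def x_def by (simp add: cong_add cong_mult)
    then have "[(\<Sum>e<M * n. U (int k) e * H $ (k - e)) = (\<Sum>e<M * n. U (int x) e * H $ (k - e))] (mod 2 ^ (v + b))"
      by (intro cong_sum cong_mult U_cong) simp_all
    moreover have "(\<Sum>e<M * n. U (int x) e * H $ (k - e)) = (\<Sum>e\<in>(\<lambda>e. M * e) ` {..d}. U (int x) e * H $ (k - e))"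
    proof (rule sum.mono_neutral_right)
      show "(\<lambda>e. M * e) ` {..d} \<subseteq> {..<M * n}" using M by (auto simp: n_def less_Suc_eq_le simp del: mult_Suc_right)
      show "\<forall>e\<in>{..<M * n} - (\<lambda>e. M * e) ` {..d}. U (int x) e * H $ (k - e) = 0"
      proof
        fix e assume e: "e \<in> {..<M * n} - (\<lambda>e. M * e) ` {..d}"
        then have "e \<in> Q" using M by (auto simp: Q_def n_def less_Suc_eq_le simp del: mult_Suc_right elim!: dvdE)
        then show "U (int x) e * H $ (k - e) = 0" using l(2) by (simp add: U_def)
      qed
    qed simp
    moreover have "\<dots> = (\<Sum>e\<le>d. U (int x) (M * e) * H $ (k - M * e))"
      using M by (subst sum.reindex) (auto simp: inj_on_def)
    moreover have "\<dots> = 2 ^ v * (\<Sum>e\<le>d. w e * H $ (M * (s - e) + r))"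
      unfolding sum_distrib_left
    proof (rule sum.cong)
      fix e assume e: "e \<in> {..d}"
      then have "M * e \<le> M * s" using s(1) by simp
      then have "k - M * e = M * (s - e) + r" by (simp add: k_def diff_mult_distrib2)
      then show "U (int x) (M * e) * H $ (k - M * e) = 2 ^ v * (w e * H $ (M * (s - e) + r))"
        using w e by simp
    qed simp
    ultimately have "[2 ^ v * (\<Sum>e\<le>d. w e * H $ (M * (s - e) + r)) = 0] (mod 2 ^ v * 2 ^ b)"
      using rel[OF k] by (simp add: power_add cong_def)
    then show ?thesis
      by (simp add: cong_0_iff)
  qed
  ultimately show ?thesis by blast
qed

section \<open>The group and its walks\<close>

type_synonym heis_state = "int \<times> int \<times> int \<times> bool"

text \<open>The state \<open>(a, b, c, e)\<close> stands for $x^a y^b z^c t^e$ with $z = [x, y]$ central, and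
  \<open>xmove k\<close> for right multiplication by $x^k$.\<close>

fun xmove :: "int \<Rightarrow> heis_state \<Rightarrow> heis_state" where
  "xmove k (a, b, c, e) = (if e then (a, b + k, c, e) else (a + k, b, c - b * k, e))"

fun flip :: "heis_state \<Rightarrow> heis_state" where
  "flip (a, b, c, e) = (a, b, c, \<not> e)"

definition origin :: heis_state where
  "origin = (0, 0, 0, False)"

fun letter_act :: "heis_gen \<times> bool \<Rightarrow> heis_state \<Rightarrow> heis_state" where
  "letter_act (Gen_x, i) s = xmove (if i then 1 else - 1) s"
| "letter_act (Gen_y, i) s = flip (xmove (if i then 1 else - 1) (flip s))"
| "letter_act (Gen_t, i) s = flip s"

lemma xmove_add [simp]: "xmove k (xmove l s) = xmove (l + k) s"
  by (cases s) (simp add: algebra_simps)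

lemma xmove_0 [simp]: "xmove 0 s = s"
  by (cases s) simp

lemma flip_flip [simp]: "flip (flip s) = s"
  by (cases s) simp

text \<open>Checking the relators and free cancellation makes the words act through the presented
  group; this is how elements are told apart.\<close>

lemma fold_letter_act_pres_rel:
  "(u, v) \<in> pres_rel heis_C2_relations \<Longrightarrow> fold letter_act u s = fold letter_act v s"
proof (induction arbitrary: s rule: pres_rel.induct)
  case (relation u v)
  obtain a b c e where "s = (a, b, c, e)" by (cases s)
  then show ?case
    using relation
    by (auto simp: heis_C2_relations_def Let_def gword_comm_def gword_inv_def algebra_simps)
next
  case (cancel g e)
  show ?case by (cases g) auto
qed auto

section \<open>Multiplication of normal forms\<close>

context group
begin

lemma int_pow_intertwine:
  assumes "x \<in> carrier G" "v \<in> carrier G" "w \<in> carrier G" "x \<otimes> w = v \<otimes> x"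
  shows "x \<otimes> w [^] (i :: int) = v [^] i \<otimes> x"
proof -
  have nat: "x \<otimes> w [^] n = v [^] n \<otimes> x" for n :: nat
  proof (induction n)
    case (Suc n)
    have "x \<otimes> w [^] Suc n = (x \<otimes> w [^] n) \<otimes> w"
      using assms by (simp add: m_assoc)
    also have "\<dots> = v [^] n \<otimes> (x \<otimes> w)"
      using assms Suc by (simp add: m_assoc)
    also have "\<dots> = v [^] Suc n \<otimes> x"
      using assms by (simp add: m_assoc)
    finally show ?case .
  qed (use assms in simp)
  show ?thesis
  proof (cases i)
    case (nonneg n)
    then show ?thesis using nat by (simp add: int_pow_int)
  next
    case (neg n)
    let ?m = "Suc n"
    have "x \<otimes> inv (w [^] ?m) = inv (v [^] ?m) \<otimes> (v [^] ?m \<otimes> x) \<otimes> inv (w [^] ?m)"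
      using assms by (simp add: inv_solve_left m_assoc del: nat_pow_Suc)
    also have "\<dots> = inv (v [^] ?m) \<otimes> (x \<otimes> w [^] ?m) \<otimes> inv (w [^] ?m)"
      by (simp only: nat)
    also have "\<dots> = inv (v [^] ?m) \<otimes> x"
      using assms by (simp add: m_assoc del: nat_pow_Suc)
    finally show ?thesis
      using assms by (simp add: neg int_pow_neg int_pow_int del: nat_pow_Suc of_nat_Suc)
  qed
qed

text \<open>The relations alone imply that right multiplication by x and t moves normal forms as
  \<open>xmove\<close> and \<open>flip\<close> prescribe; this complements the action on
  states.\<close>

lemma heis_normal_form_mult:
  fixes x y t
  defines "z \<equiv> x \<otimes> y \<otimes> inv x \<otimes> inv y"
  defines "nf \<equiv> \<lambda>(a :: int, b :: int, c :: int, e). x [^] a \<otimes> y [^] b \<otimes> z [^] c \<otimes> (if e then t else \<one>)"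
  assumes cl: "x \<in> carrier G" "y \<in> carrier G" "t \<in> carrier G"
    and zx: "z \<otimes> x = x \<otimes> z" and zy: "z \<otimes> y = y \<otimes> z"
    and tt: "t \<otimes> t = \<one>" and conj: "t \<otimes> x \<otimes> t = y"
  shows "nf s \<otimes> x = nf (xmove 1 s)" "nf s \<otimes> t = nf (flip s)"
proof -
  obtain a b c e where s: "s = (a, b, c, e)" by (cases s)
  have z: "z \<in> carrier G" using cl by (simp add: z_def)
  have zc: "z [^] c \<otimes> x = x \<otimes> z [^] c" "z [^] c \<otimes> y = y \<otimes> z [^] c"
    using int_pow_intertwine[of x z z c] int_pow_intertwine[of y z z c] cl z zx zy by auto
  have xy: "x \<otimes> y = z \<otimes> (y \<otimes> x)"
  proof -
    have "inv y \<otimes> (y \<otimes> x) = x" using cl by (simp flip: m_assoc)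
    then show ?thesis using cl by (simp add: z_def m_assoc)
  qed
  have zy': "y \<otimes> inv z = inv z \<otimes> y"
    using cl z zy by (metis inv_closed inv_solve_left inv_solve_right m_assoc m_closed)
  have "x \<otimes> (y \<otimes> inv z) = inv z \<otimes> (z \<otimes> x) \<otimes> (y \<otimes> inv z)"
    using cl z by (simp flip: m_assoc)
  also have "\<dots> = inv z \<otimes> (x \<otimes> z) \<otimes> (inv z \<otimes> y)"
    by (simp only: zx zy')
  also have "\<dots> = inv z \<otimes> (x \<otimes> ((z \<otimes> inv z) \<otimes> y))"
    using cl z by (simp only: m_assoc inv_closed m_closed)
  also have "\<dots> = inv z \<otimes> (x \<otimes> y)"
    using cl z by simp
  also have "\<dots> = y \<otimes> x"
    using cl z unfolding xy by (simp flip: m_assoc)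
  finally have yx: "x \<otimes> (y \<otimes> inv z) = y \<otimes> x" .
  \<comment> \<open>Moving x to the left past y turns y into y z^-1; powers of this give the
    correction -b in the exponent of z.\<close>
  have "y [^] b \<otimes> x = x \<otimes> (y \<otimes> inv z) [^] b"
    using int_pow_intertwine[OF _ _ _ yx, of b] cl z by simp
  also have "(y \<otimes> inv z) [^] b = y [^] b \<otimes> z [^] (- b)"
    using int_pow_mult_distrib[OF zy', of b] cl z by (simp add: int_pow_inv int_pow_neg)
  finally have yb: "y [^] b \<otimes> x = x \<otimes> (y [^] b \<otimes> z [^] (- b))" .
  have tx: "t \<otimes> x = y \<otimes> t"
    using cl tt conj by (metis m_assoc m_closed r_one)
  have p1: "g [^] (i + 1) = g [^] i \<otimes> g" if "g \<in> carrier G" for g and i :: int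
    using that by (simp add: int_pow_mult)
  have zd: "z [^] (c - b) = z [^] (- b) \<otimes> z [^] c"
    using z by (simp flip: int_pow_mult)
  show "nf s \<otimes> x = nf (xmove 1 s)"
  proof (cases e)
    case True
    have "nf s \<otimes> x = x [^] a \<otimes> y [^] b \<otimes> z [^] c \<otimes> (t \<otimes> x)"
      using cl z True by (simp add: s nf_def m_assoc)
    also have "\<dots> = x [^] a \<otimes> y [^] b \<otimes> (z [^] c \<otimes> y) \<otimes> t"
      using cl z unfolding tx by (simp add: m_assoc)
    also have "\<dots> = nf (xmove 1 s)"
      using cl z True unfolding zc by (simp add: s nf_def m_assoc p1)
    finally show ?thesis .
  next
    case False
    have "nf s \<otimes> x = x [^] a \<otimes> y [^] b \<otimes> (z [^] c \<otimes> x)"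
      using cl z False by (simp add: s nf_def m_assoc)
    also have "\<dots> = x [^] a \<otimes> (y [^] b \<otimes> x) \<otimes> z [^] c"
      using cl z unfolding zc by (simp add: m_assoc)
    also have "\<dots> = nf (xmove 1 s)"
      using cl z False unfolding yb by (simp add: s nf_def m_assoc p1 zd)
    finally show ?thesis .
  qed
  show "nf s \<otimes> t = nf (flip s)"
    using cl z tt by (cases e) (simp_all add: s nf_def m_assoc)
qed

end

section \<open>The word problem in the presented group\<close>

abbreviation heis_class :: "heis_gen gword \<Rightarrow> heis_gen gword set" where
  "heis_class w \<equiv> pres_rel heis_C2_relations `` {w}"

definition class_act :: "heis_gen gword set \<Rightarrow> heis_state \<Rightarrow> heis_state" where
  "class_act A = fold letter_act (SOME u. A = heis_class u)"

lemma class_act_class: "class_act (heis_class u) = fold letter_act u"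
proof -
  let ?v = "SOME v. heis_class u = heis_class v"
  have "heis_class u = heis_class ?v"
    by (rule someI[of "\<lambda>v. heis_class u = heis_class v" u]) simp
  then have "(u, ?v) \<in> pres_rel heis_C2_relations"
    using eq_equiv_class[OF _ equiv_pres_rel] by blast
  then show ?thesis
    unfolding class_act_def by (intro ext fold_letter_act_pres_rel[symmetric])
qed

lemma heis_class_mult: "heis_class u \<otimes>\<^bsub>heis_C2\<^esub> heis_class v = heis_class (u @ v)"
  unfolding heis_C2_def by (rule presented_group_mult)

lemma heis_class_one: "\<one>\<^bsub>heis_C2\<^esub> = heis_class []"
  unfolding heis_C2_def by (rule presented_group_one)

lemma heis_C2_carrier: "A \<in> carrier heis_C2 \<longleftrightarrow> (\<exists>u. A = heis_class u)"
  unfolding heis_C2_def by (rule presented_group_carrier)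

lemma heis_class_eq: "(u, v) \<in> pres_rel heis_C2_relations \<Longrightarrow> heis_class u = heis_class v"
  by (rule equiv_class_eq[OF equiv_pres_rel])

lemma heis_class_carrier: "heis_class u \<in> carrier heis_C2"
  by (auto simp: heis_C2_carrier)

lemma class_act_mult:
  assumes "A \<in> carrier heis_C2" "B \<in> carrier heis_C2"
  shows "class_act (A \<otimes>\<^bsub>heis_C2\<^esub> B) s = class_act B (class_act A s)"
  using assms by (auto simp: heis_C2_carrier heis_class_mult class_act_class)

lemma class_act_one: "class_act \<one>\<^bsub>heis_C2\<^esub> s = s"
  by (simp add: heis_class_one class_act_class)

lemma heis_class_inv: "inv\<^bsub>heis_C2\<^esub> (heis_class u) = heis_class (gword_inv u)"
proof -
  interpret group heis_C2 by (rule group_heis_C2)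
  show ?thesis
    by (rule inv_equality)
      (auto simp: heis_class_mult heis_class_one heis_class_carrier intro!: heis_class_eq gword_inv_left)
qed

lemma heis_x_class: "heis_x = heis_class [(Gen_x, True)]"
  and heis_t_class: "heis_t = heis_class [(Gen_t, True)]"
  and heis_x_inv_class: "inv\<^bsub>heis_C2\<^esub> heis_x = heis_class [(Gen_x, False)]"
  by (simp_all add: heis_x_def heis_t_def pres_gen_def heis_class_inv gword_inv_def)

text \<open>Multiplying the normal form of the origin, which is the identity, by A follows the
  action on states. Thus A is the normal form of the state it produces, and that state decides
  whether A is trivial.\<close>

lemma heis_C2_eq_one_iff:
  assumes "A \<in> carrier heis_C2"
  shows "A = \<one>\<^bsub>heis_C2\<^esub> \<longleftrightarrow> class_act A origin = origin"
proof -
  interpret group heis_C2 by (rule group_heis_C2)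
  let ?x = "heis_class [(Gen_x, True)]" and ?y = "heis_class [(Gen_y, True)]"
    and ?t = "heis_class [(Gen_t, True)]"
  define z where "z = ?x \<otimes>\<^bsub>heis_C2\<^esub> ?y \<otimes>\<^bsub>heis_C2\<^esub> inv\<^bsub>heis_C2\<^esub> ?x \<otimes>\<^bsub>heis_C2\<^esub> inv\<^bsub>heis_C2\<^esub> ?y"
  define nf where "nf = (\<lambda>(a :: int, b :: int, c :: int, e). ?x [^]\<^bsub>heis_C2\<^esub> a \<otimes>\<^bsub>heis_C2\<^esub>
    ?y [^]\<^bsub>heis_C2\<^esub> b \<otimes>\<^bsub>heis_C2\<^esub> z [^]\<^bsub>heis_C2\<^esub> c \<otimes>\<^bsub>heis_C2\<^esub> (if e then ?t else \<one>\<^bsub>heis_C2\<^esub>))"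
  have z: "z = heis_class (gword_comm [(Gen_x, True)] [(Gen_y, True)])"
    by (simp add: z_def heis_class_inv heis_class_mult gword_comm_def)
  have nf_closed: "nf s \<in> carrier heis_C2" for s
    by (cases s) (auto simp: nf_def z heis_class_carrier intro!: m_closed int_pow_closed)
  have comm: "heis_class v \<otimes>\<^bsub>heis_C2\<^esub> heis_class u = heis_class u \<otimes>\<^bsub>heis_C2\<^esub> heis_class v"
    if "(gword_comm u v, []) \<in> heis_C2_relations" for u v
  proof -
    have "heis_class (gword_comm u v) = \<one>\<^bsub>heis_C2\<^esub>"
      unfolding heis_class_one using that by (intro heis_class_eq pres_rel.relation)
    then have "heis_class u \<otimes>\<^bsub>heis_C2\<^esub> heis_class v \<otimes>\<^bsub>heis_C2\<^esub>
        inv\<^bsub>heis_C2\<^esub> heis_class u \<otimes>\<^bsub>heis_C2\<^esub> inv\<^bsub>heis_C2\<^esub> heis_class v = \<one>\<^bsub>heis_C2\<^esub>"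
      by (simp add: heis_class_inv heis_class_mult gword_comm_def)
    then show ?thesis
      by (metis heis_class_carrier inv_closed inv_equality inv_inv inv_solve_right m_closed l_one)
  qed
  have nf_x: "nf s \<otimes>\<^bsub>heis_C2\<^esub> ?x = nf (xmove 1 s)"
    and nf_t: "nf s \<otimes>\<^bsub>heis_C2\<^esub> ?t = nf (flip s)" for s
  proof -
    have 1: "z \<otimes>\<^bsub>heis_C2\<^esub> ?x = ?x \<otimes>\<^bsub>heis_C2\<^esub> z" and 2: "z \<otimes>\<^bsub>heis_C2\<^esub> ?y = ?y \<otimes>\<^bsub>heis_C2\<^esub> z"
      unfolding z by (intro comm; simp add: heis_C2_relations_def Let_def)+
    have 3: "?t \<otimes>\<^bsub>heis_C2\<^esub> ?t = \<one>\<^bsub>heis_C2\<^esub>"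
      unfolding heis_class_mult heis_class_one
      by (intro heis_class_eq pres_rel.relation) (simp add: heis_C2_relations_def Let_def)
    have 4: "?t \<otimes>\<^bsub>heis_C2\<^esub> ?x \<otimes>\<^bsub>heis_C2\<^esub> ?t = ?y"
      unfolding heis_class_mult
      by (intro heis_class_eq pres_rel.relation) (simp add: heis_C2_relations_def Let_def)
    note nfm = heis_normal_form_mult[OF heis_class_carrier heis_class_carrier heis_class_carrier
        1[unfolded z_def] 2[unfolded z_def] 3 4, folded z_def, folded nf_def]
    show "nf s \<otimes>\<^bsub>heis_C2\<^esub> ?x = nf (xmove 1 s)" by (rule nfm(1))
    show "nf s \<otimes>\<^bsub>heis_C2\<^esub> ?t = nf (flip s)" by (rule nfm(2))
  qed
  have "nf s \<otimes>\<^bsub>heis_C2\<^esub> heis_class u = nf (fold letter_act u s)" for s u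
  proof (induction u arbitrary: s)
    case Nil
    show ?case by (simp add: nf_closed flip: heis_class_one)
  next
    case (Cons l u)
    \<comment> \<open>Inverse letters are reduced to positive ones: it suffices that the letter
      itself leads from the claimed result back.\<close>
    have cancel: "A \<otimes>\<^bsub>heis_C2\<^esub> inv\<^bsub>heis_C2\<^esub> heis_class v = B"
      if "B \<otimes>\<^bsub>heis_C2\<^esub> heis_class v = A" "B \<in> carrier heis_C2" for A B v
      using that heis_class_carrier by (metis inv_solve_right m_closed)
    have x: "nf s \<otimes>\<^bsub>heis_C2\<^esub> heis_class [(Gen_x, i)] = nf (letter_act (Gen_x, i) s)" for i s
    proof (cases i)
      case False
      have "nf s \<otimes>\<^bsub>heis_C2\<^esub> inv\<^bsub>heis_C2\<^esub> ?x = nf (xmove (- 1) s)"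
        by (rule cancel) (simp_all add: nf_x nf_closed)
      then show ?thesis using False by (simp add: heis_class_inv gword_inv_def)
    qed (simp add: nf_x)
    have t: "nf s \<otimes>\<^bsub>heis_C2\<^esub> heis_class [(Gen_t, i)] = nf (letter_act (Gen_t, i) s)" for i s
    proof (cases i)
      case False
      have "nf s \<otimes>\<^bsub>heis_C2\<^esub> inv\<^bsub>heis_C2\<^esub> ?t = nf (flip s)"
        by (rule cancel) (simp_all add: nf_t nf_closed)
      then show ?thesis using False by (simp add: heis_class_inv gword_inv_def)
    qed (simp add: nf_t)
    have y1: "nf s \<otimes>\<^bsub>heis_C2\<^esub> ?y = nf (letter_act (Gen_y, True) s)" for s
    proof -
      have y: "?y = ?t \<otimes>\<^bsub>heis_C2\<^esub> ?x \<otimes>\<^bsub>heis_C2\<^esub> ?t"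
        unfolding heis_class_mult
        by (intro heis_class_eq pres_rel.sym[OF pres_rel.relation]) (simp add: heis_C2_relations_def Let_def)
      have "nf s \<otimes>\<^bsub>heis_C2\<^esub> ?y = nf s \<otimes>\<^bsub>heis_C2\<^esub> ?t \<otimes>\<^bsub>heis_C2\<^esub> ?x \<otimes>\<^bsub>heis_C2\<^esub> ?t"
        unfolding y by (simp only: m_assoc m_closed nf_closed heis_class_carrier)
      then show ?thesis by (simp add: nf_x nf_t)
    qed
    have y: "nf s \<otimes>\<^bsub>heis_C2\<^esub> heis_class [(Gen_y, i)] = nf (letter_act (Gen_y, i) s)" for i s
    proof (cases i)
      case False
      have "nf s \<otimes>\<^bsub>heis_C2\<^esub> inv\<^bsub>heis_C2\<^esub> ?y = nf (letter_act (Gen_y, False) s)"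
        by (rule cancel) (simp_all add: y1 nf_closed)
      then show ?thesis using False by (simp add: heis_class_inv gword_inv_def)
    qed (simp add: y1)
    have "nf s \<otimes>\<^bsub>heis_C2\<^esub> heis_class [l] = nf (letter_act l s)"
      using x y t by (cases l; cases "fst l") (metis fst_conv)+
    moreover have "heis_class (l # u) = heis_class [l] \<otimes>\<^bsub>heis_C2\<^esub> heis_class u"
      by (simp add: heis_class_mult)
    ultimately show ?case
      using Cons.IH by (simp add: nf_closed heis_class_carrier flip: m_assoc)
  qed
  moreover obtain u where "A = heis_class u"
    using assms by (auto simp: heis_C2_carrier)
  ultimately have "nf origin \<otimes>\<^bsub>heis_C2\<^esub> A = nf (class_act A origin)"
    by (simp only: class_act_class)
  moreover have "nf origin = \<one>\<^bsub>heis_C2\<^esub>"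
    by (simp add: nf_def origin_def z heis_class_carrier)
  ultimately show ?thesis
    using assms by (auto simp: class_act_one)
qed

section \<open>Counting words by their action\<close>

text \<open>The initial state varies, because splitting off the first letter changes it.\<close>

definition walk_count :: "nat \<Rightarrow> heis_state \<Rightarrow> nat" where
  "walk_count l s = card {ss. set ss \<subseteq> mset_copies heis_C2_gens \<and> length ss = l \<and>
     class_act (foldr (\<otimes>\<^bsub>heis_C2\<^esub>) (map fst ss) \<one>\<^bsub>heis_C2\<^esub>) s = origin}"

lemma class_act_gens:
  "class_act heis_x = xmove 1" "class_act (inv\<^bsub>heis_C2\<^esub> heis_x) = xmove (- 1)" "class_act heis_t = flip"
  by (auto simp: heis_x_class heis_x_inv_class[unfolded heis_x_class] heis_t_class class_act_class)

lemma heis_gens_distinct: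
  "heis_x \<noteq> inv\<^bsub>heis_C2\<^esub> heis_x" "heis_x \<noteq> heis_t" "inv\<^bsub>heis_C2\<^esub> heis_x \<noteq> heis_t"
proof -
  have "class_act heis_x origin \<noteq> class_act (inv\<^bsub>heis_C2\<^esub> heis_x) origin"
    "class_act heis_x origin \<noteq> class_act heis_t origin"
    "class_act (inv\<^bsub>heis_C2\<^esub> heis_x) origin \<noteq> class_act heis_t origin"
    by (simp_all add: class_act_gens origin_def)
  then show "heis_x \<noteq> inv\<^bsub>heis_C2\<^esub> heis_x" "heis_x \<noteq> heis_t" "inv\<^bsub>heis_C2\<^esub> heis_x \<noteq> heis_t"
    by metis+
qed

lemma mset_copies_heis:
  "mset_copies heis_C2_gens =
     {(heis_x, 0), (inv\<^bsub>heis_C2\<^esub> heis_x, 0)} \<union> Pair heis_t ` {..<8}"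
  using heis_gens_distinct by (auto simp: mset_copies_def heis_C2_gens_def split: if_splits)

lemma heis_gens_carrier: "a \<in> mset_copies heis_C2_gens \<Longrightarrow> fst a \<in> carrier heis_C2"
  using heis_class_carrier by (auto simp: mset_copies_heis heis_x_class heis_class_inv heis_t_class)

lemma heis_prod_carrier:
  "set ss \<subseteq> mset_copies heis_C2_gens \<Longrightarrow>
    foldr (\<otimes>\<^bsub>heis_C2\<^esub>) (map fst ss) \<one>\<^bsub>heis_C2\<^esub> \<in> carrier heis_C2"
proof (induction ss)
  case Nil
  show ?case by (simp add: heis_class_one heis_class_carrier)
next
  case (Cons a ss)
  interpret group heis_C2 by (rule group_heis_C2)
  show ?case using Cons by (simp add: heis_gens_carrier)
qed

lemma walk_count_0: "walk_count 0 s = (if s = origin then 1 else 0)"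
proof -
  have "{ss. set ss \<subseteq> mset_copies heis_C2_gens \<and> length ss = 0 \<and>
     class_act (foldr (\<otimes>\<^bsub>heis_C2\<^esub>) (map fst ss) \<one>\<^bsub>heis_C2\<^esub>) s = origin}
     = (if s = origin then {[]} else {})"
    by (auto simp: class_act_one)
  then show ?thesis by (simp add: walk_count_def)
qed

text \<open>The first letter acts first; the eight copies of \<open>heis_t\<close> share one
  term.\<close>

lemma walk_count_Suc:
  "walk_count (Suc l) s =
     walk_count l (xmove 1 s) + walk_count l (xmove (- 1) s) + 8 * walk_count l (flip s)"
proof -
  let ?C = "mset_copies heis_C2_gens"
  let ?W = "\<lambda>l s. {ss. set ss \<subseteq> ?C \<and> length ss = l \<and>
     class_act (foldr (\<otimes>\<^bsub>heis_C2\<^esub>) (map fst ss) \<one>\<^bsub>heis_C2\<^esub>) s = origin}"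
  have finC: "finite ?C" by (simp add: mset_copies_heis)
  have finW: "finite (?W l s)" for l s
    by (rule finite_subset[OF _ finite_lists_length_eq[OF finC, of l]]) auto
  have "?W (Suc l) s = (\<Union>a\<in>?C. Cons a ` ?W l (class_act (fst a) s))"
    by (auto simp: length_Suc_conv image_iff class_act_mult heis_gens_carrier[of "(_, _)", simplified]
        heis_prod_carrier)
  then have "walk_count (Suc l) s = card (\<Union>a\<in>?C. Cons a ` ?W l (class_act (fst a) s))"
    by (simp only: walk_count_def)
  also have "\<dots> = (\<Sum>a\<in>?C. card (Cons a ` ?W l (class_act (fst a) s)))"
    by (rule card_UN_disjoint) (use finC finW in auto)
  also have "\<dots> = (\<Sum>a\<in>?C. walk_count l (class_act (fst a) s))"
    unfolding walk_count_def by (intro sum.cong card_image) auto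
  also have "\<dots> = walk_count l (xmove 1 s) + walk_count l (xmove (- 1) s) + 8 * walk_count l (flip s)"
    using heis_gens_distinct
    by (simp add: mset_copies_heis sum.union_disjoint image_iff class_act_gens sum.reindex inj_on_def)
  finally show ?thesis .
qed

lemma green_coeff_walk_count: "green_coeff heis_C2 heis_C2_gens l = walk_count l origin"
  unfolding green_coeff_def walk_count_def
  using heis_C2_eq_one_iff[OF heis_prod_carrier] by (intro arg_cong[where f = card]) blast

section \<open>Reduced words\<close>

fun run :: "int list \<Rightarrow> heis_state \<Rightarrow> heis_state" where
  "run [] s = s"
| "run [a] s = xmove a s"
| "run (a # as) s = run as (flip (xmove a s))"

text \<open>Only the letters x and x^-1 are counted; the letters t are recorded by the length of the
  list.\<close>

definition weight :: "int list \<Rightarrow> nat" where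
  "weight as = (\<Sum>a\<leftarrow>as. nat \<bar>a\<bar>)"

text \<open>A list \<open>[a\<^sub>0, \<dots>, a\<^sub>m]\<close> encodes the reduced word $x^{a_0} t x^{a_1} t \cdots t x^{a_m}$.\<close>

definition reduced :: "nat \<Rightarrow> heis_state \<Rightarrow> nat \<Rightarrow> int list set" where
  "reduced m s k = {as. length as = Suc m \<and> weight as = k \<and> run as s = origin}"

definition red_fps :: "nat \<Rightarrow> heis_state \<Rightarrow> int fps" where
  "red_fps m s = Abs_fps (\<lambda>k. int (card (reduced m s k)))"

definition walk_fps :: "heis_state \<Rightarrow> int fps" where
  "walk_fps s = Abs_fps (\<lambda>l. int (walk_count l s))"

lemma weight_simps [simp]: "weight [] = 0" "weight (a # as) = nat \<bar>a\<bar> + weight as"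
  by (simp_all add: weight_def)

lemma run_xmove: "run (a # as) (xmove k s) = run ((k + a) # as) s"
  by (cases as) (simp_all add: add.commute)

lemma abs_le_weight: "a \<in> set as \<Longrightarrow> nat \<bar>a\<bar> \<le> weight as"
  by (induction as) auto

lemma finite_reduced: "finite (reduced m s k)"
proof (rule finite_subset)
  show "reduced m s k \<subseteq> {as. set as \<subseteq> {- int k..int k} \<and> length as = Suc m}"
    using abs_le_weight by (fastforce simp: reduced_def)
  show "finite {as. set as \<subseteq> {- int k..int k} \<and> length as = Suc m}"
    by (rule finite_lists_length_eq) simp
qed

section \<open>Recurrences for reduced words\<close>

definition head_part :: "(int \<Rightarrow> bool) \<Rightarrow> nat \<Rightarrow> heis_state \<Rightarrow> int fps" where
  "head_part P m s = Abs_fps (\<lambda>k. int (card {as \<in> reduced m s k. P (hd as)}))"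

lemma head_part_split:
  assumes "\<And>a. P a \<longleftrightarrow> Q a \<or> R a" "\<And>a. \<not> (Q a \<and> R a)"
  shows "head_part P m s = head_part Q m s + head_part R m s"
proof (rule fps_ext)
  fix k
  have "{as \<in> reduced m s k. P (hd as)} = {as \<in> reduced m s k. Q (hd as)} \<union> {as \<in> reduced m s k. R (hd as)}"
    using assms by auto
  moreover have "card ({as \<in> reduced m s k. Q (hd as)} \<union> {as \<in> reduced m s k. R (hd as)}) =
      card {as \<in> reduced m s k. Q (hd as)} + card {as \<in> reduced m s k. R (hd as)}"
    using assms by (intro card_Un_disjoint) (auto simp: finite_reduced)
  ultimately show "head_part P m s $ k = (head_part Q m s + head_part R m s) $ k"
    by (simp add: head_part_def)
qed

text \<open>One letter x^d is taken off the first exponent and absorbed by the state. For d = 1 the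
  condition \<open>P\<close> is a > 0 and \<open>Q\<close> is a >= 0; for d = -1 the signs are
  reversed.\<close>

lemma head_part_shift:
  assumes d: "\<bar>d\<bar> = 1" and P: "\<And>a. P a \<Longrightarrow> \<bar>a\<bar> = \<bar>a - d\<bar> + 1" and Q: "\<And>a. Q a \<longleftrightarrow> P (a + d)"
  shows "head_part P m s = fps_X * head_part Q m (xmove d s)"
proof (rule fps_ext)
  fix k
  show "head_part P m s $ k = (fps_X * head_part Q m (xmove d s)) $ k"
  proof (cases k)
    case 0
    have "{as \<in> reduced m s 0. P (hd as)} = {}"
    proof safe
      fix as assume as: "as \<in> reduced m s 0" "P (hd as)"
      then obtain a r where "as = a # r" by (cases as) (auto simp: reduced_def)
      then show "as \<in> {}" using as P[of a] by (auto simp: reduced_def)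
    qed
    then have "card {as \<in> reduced m s 0. P (hd as)} = 0" by (simp only: card.empty)
    then show ?thesis using 0 by (simp add: head_part_def)
  next
    case (Suc l)
    have "card {as \<in> reduced m s (Suc l). P (hd as)} = card {as \<in> reduced m (xmove d s) l. Q (hd as)}"
    proof (rule bij_betw_same_card[OF bij_betw_byWitness[where f = "\<lambda>as. (hd as - d) # tl as" and f' = "\<lambda>as. (hd as + d) # tl as"]])
      show "\<forall>as\<in>{as \<in> reduced m s (Suc l). P (hd as)}. (hd ((hd as - d) # tl as) + d) # tl ((hd as - d) # tl as) = as"
        by (auto simp: reduced_def) (metis list.collapse list.size(3) nat.distinct(1))
      show "\<forall>as\<in>{as \<in> reduced m (xmove d s) l. Q (hd as)}. (hd ((hd as + d) # tl as) - d) # tl ((hd as + d) # tl as) = as"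
        by (auto simp: reduced_def) (metis list.collapse list.size(3) nat.distinct(1))
      show "(\<lambda>as. (hd as - d) # tl as) ` {as \<in> reduced m s (Suc l). P (hd as)} \<subseteq> {as \<in> reduced m (xmove d s) l. Q (hd as)}"
      proof safe
        fix as assume as: "as \<in> reduced m s (Suc l)" "P (hd as)"
        then obtain a r where ar: "as = a # r" by (cases as) (auto simp: reduced_def)
        have "nat \<bar>a\<bar> = Suc (nat \<bar>a - d\<bar>)" using P[of a] as ar by simp
        then show "(hd as - d) # tl as \<in> reduced m (xmove d s) l" "Q (hd ((hd as - d) # tl as))"
          using as ar by (auto simp: reduced_def run_xmove Q)
      qed
      show "(\<lambda>as. (hd as + d) # tl as) ` {as \<in> reduced m (xmove d s) l. Q (hd as)} \<subseteq> {as \<in> reduced m s (Suc l). P (hd as)}"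
      proof safe
        fix as assume as: "as \<in> reduced m (xmove d s) l" "Q (hd as)"
        then obtain a r where ar: "as = a # r" by (cases as) (auto simp: reduced_def)
        have "nat \<bar>a + d\<bar> = Suc (nat \<bar>a\<bar>)" using P[of "a + d"] as ar Q by simp
        then show "(hd as + d) # tl as \<in> reduced m s (Suc l)" "P (hd ((hd as + d) # tl as))"
          using as ar by (auto simp: reduced_def run_xmove Q add.commute)
      qed
    qed
    then show ?thesis using Suc by (simp add: head_part_def)
  qed
qed

lemma head_part_0:
  "head_part (\<lambda>a. a = 0) 0 s = (if s = origin then 1 else 0)"
proof (rule fps_ext)
  fix k
  have "{as \<in> reduced 0 s k. hd as = 0} = (if k = 0 \<and> s = origin then {[0]} else {})"
    by (auto simp: reduced_def length_Suc_conv)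
  then show "head_part (\<lambda>a. a = 0) 0 s $ k = (if s = origin then 1 else 0) $ k"
    by (simp add: head_part_def)
qed

lemma head_part_Suc: "head_part (\<lambda>a. a = 0) (Suc m) s = red_fps m (flip s)"
proof (rule fps_ext)
  fix k
  have "{as \<in> reduced (Suc m) s k. hd as = 0} = Cons 0 ` reduced m (flip s) k"
    by (auto simp: reduced_def length_Suc_conv image_iff)
  then show "head_part (\<lambda>a. a = 0) (Suc m) s $ k = red_fps m (flip s) $ k"
    by (simp add: head_part_def red_fps_def card_image)
qed

text \<open>A positive first exponent shrinks under x and a negative one under x^-1; the moves in
  the wrong direction cost X^2. The left-hand operator is thus the one of the walks after the
  substitution.\<close>

lemma red_fps_recurrence:
  "fps_of_poly Up * red_fps m s = fps_X * (red_fps m (xmove 1 s) + red_fps m (xmove (- 1) s))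
     + fps_of_poly Vp * head_part (\<lambda>a. a = 0) m s"
proof -
  let ?P = "head_part (\<lambda>a. a > 0) m" and ?N = "head_part (\<lambda>a. a < 0) m" and ?Z = "head_part (\<lambda>a. a = 0) m"
  have red: "red_fps m s = ?P s + ?N s + ?Z s" for s
  proof -
    have "red_fps m s = head_part (\<lambda>_. True) m s" by (simp add: red_fps_def head_part_def)
    also have "\<dots> = head_part (\<lambda>a. a \<noteq> 0) m s + ?Z s" by (rule head_part_split) auto
    also have "head_part (\<lambda>a. a \<noteq> 0) m s = ?P s + ?N s" by (rule head_part_split) auto
    finally show ?thesis .
  qed
  have P: "?P s = fps_X * (?P (xmove 1 s) + ?Z (xmove 1 s))" for s
  proof -
    have "?P s = fps_X * head_part (\<lambda>a. a \<ge> 0) m (xmove 1 s)" by (rule head_part_shift) auto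
    also have "head_part (\<lambda>a. a \<ge> 0) m (xmove 1 s) = ?P (xmove 1 s) + ?Z (xmove 1 s)"
      by (rule head_part_split) auto
    finally show ?thesis .
  qed
  have N: "?N s = fps_X * (?N (xmove (- 1) s) + ?Z (xmove (- 1) s))" for s
  proof -
    have "?N s = fps_X * head_part (\<lambda>a. a \<le> 0) m (xmove (- 1) s)" by (rule head_part_shift) auto
    also have "head_part (\<lambda>a. a \<le> 0) m (xmove (- 1) s) = ?N (xmove (- 1) s) + ?Z (xmove (- 1) s)"
      by (rule head_part_split) auto
    finally show ?thesis .
  qed
  have "fps_X * (red_fps m (xmove 1 s) + red_fps m (xmove (- 1) s)) =
      fps_X * (?P (xmove 1 s) + ?Z (xmove 1 s)) + fps_X * ?N (xmove 1 s) +
      fps_X * (?N (xmove (- 1) s) + ?Z (xmove (- 1) s)) + fps_X * ?P (xmove (- 1) s)"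
    unfolding red by (simp only: distrib_left add_ac)
  also have "\<dots> = ?P s + fps_X * (fps_X * (?N s + ?Z s)) + ?N s + fps_X * (fps_X * (?P s + ?Z s))"
    unfolding P[of s, symmetric] N[of s, symmetric]
    using N[of "xmove 1 s"] P[of "xmove (- 1) s"] by simp
  finally show ?thesis
    unfolding red[of s] fps_Up fps_Vp by (simp add: algebra_simps power2_eq_square)
qed

lemma walk_fps_recurrence:
  "walk_fps s = (if s = origin then 1 else 0)
     + fps_X * (walk_fps (xmove 1 s) + walk_fps (xmove (- 1) s) + 8 * walk_fps (flip s))"
proof (rule fps_ext)
  fix n
  show "walk_fps s $ n = ((if s = origin then 1 else 0)
     + fps_X * (walk_fps (xmove 1 s) + walk_fps (xmove (- 1) s) + 8 * walk_fps (flip s))) $ n"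
    by (cases n) (auto simp: walk_fps_def walk_count_0 walk_count_Suc fps_numeral_nth numeral_fps_const
        fps_mult_left_const_nth)
qed

text \<open>The exponent \<open>8\<close> clears the denominators of the terms with at most seven letters \<open>t\<close>;
  the others vanish modulo $8^8 = 2^{24}$.\<close>

definition walk_series :: "heis_state \<Rightarrow> int fps" where
  "walk_series s = fps_of_poly Vp ^ 8 * (walk_fps s oo zeta)"

text \<open>Each of the m + 1 blocks carries a walk factor \<open>Up\<close> / \<open>Vp\<close> and
  each letter t a factor 8 X / \<open>Up\<close>. Multiplied by the eighth power of
  \<open>Vp\<close>, this gives the stated coefficients.\<close>

definition reduced_series :: "heis_state \<Rightarrow> int fps" where
  "reduced_series s = (\<Sum>m\<le>7. 8 ^ m * fps_of_poly Vp ^ (7 - m) * fps_of_poly Up * fps_X ^ m * red_fps m s)"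

lemma walk_series_recurrence:
  "fps_of_poly Up * walk_series s = (if s = origin then fps_of_poly Up * fps_of_poly Vp ^ 8 else 0)
     + fps_X * (walk_series (xmove 1 s) + walk_series (xmove (- 1) s) + 8 * walk_series (flip s))"
proof -
  let ?U = "fps_of_poly Up" and ?V = "fps_of_poly Vp" and ?c = "\<lambda>s. walk_fps s oo zeta"
  have "walk_fps s oo zeta = (if s = origin then 1 else 0)
     + zeta * (?c (xmove 1 s) + ?c (xmove (- 1) s) + 8 * ?c (flip s))"
    by (subst walk_fps_recurrence)
      (simp add: fps_compose_add_distrib fps_compose_mult_distrib numeral_fps_const)
  then have "?U * walk_series s = ?U * ?V ^ 8 * ((if s = origin then 1 else 0)
     + zeta * (?c (xmove 1 s) + ?c (xmove (- 1) s) + 8 * ?c (flip s)))"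
    by (simp add: walk_series_def mult.assoc)
  also have "\<dots> = (if s = origin then ?U * ?V ^ 8 else 0)
     + (?U * zeta) * (?V ^ 8 * (?c (xmove 1 s) + ?c (xmove (- 1) s) + 8 * ?c (flip s)))"
    by (simp add: distrib_left mult_ac)
  also have "\<dots> = (if s = origin then ?U * ?V ^ 8 else 0)
     + fps_X * (walk_series (xmove 1 s) + walk_series (xmove (- 1) s) + 8 * walk_series (flip s))"
    unfolding Up_zeta walk_series_def by (simp add: distrib_left mult_ac)
  finally show ?thesis .
qed

text \<open>Words starting with t and having m + 1 such letters yield 8 X times level m at the
  flipped state. Only level 7 lacks a partner, and this is the error term 8^8.\<close>

lemma reduced_series_recurrence:
  "fps_of_poly Up * reduced_series s + 8 ^ 8 * fps_of_poly Up * fps_X ^ 8 * red_fps 7 (flip s) =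
     (if s = origin then fps_of_poly Up * fps_of_poly Vp ^ 8 else 0)
     + fps_X * (reduced_series (xmove 1 s) + reduced_series (xmove (- 1) s) + 8 * reduced_series (flip s))"
proof -
  let ?U = "fps_of_poly Up" and ?V = "fps_of_poly Vp"
  define c where "c m = 8 ^ m * ?V ^ (7 - m) * ?U * fps_X ^ m" for m :: nat
  define Z where "Z m = head_part (\<lambda>a. a = 0) m s" for m
  have rs: "reduced_series s = (\<Sum>m\<le>7. c m * red_fps m s)" for s
    by (simp add: reduced_series_def c_def)
  have "?U * reduced_series s = (\<Sum>m\<le>7. c m * (?U * red_fps m s))"
    by (simp add: rs sum_distrib_left mult_ac)
  also have "\<dots> = (\<Sum>m\<le>7. fps_X * (c m * red_fps m (xmove 1 s)) + fps_X * (c m * red_fps m (xmove (- 1) s))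
      + c m * ?V * Z m)"
    unfolding red_fps_recurrence Z_def by (intro sum.cong HOL.refl) (simp add: algebra_simps)
  also have "\<dots> = fps_X * (reduced_series (xmove 1 s) + reduced_series (xmove (- 1) s)) + (\<Sum>m\<le>7. c m * ?V * Z m)"
    by (simp add: rs sum.distrib sum_distrib_left distrib_left)
  also have "(\<Sum>m\<le>7. c m * ?V * Z m) = c 0 * ?V * Z 0 + (\<Sum>m\<le>6. c (Suc m) * ?V * Z (Suc m))"
    using sum.atMost_Suc_shift[of "\<lambda>m. c m * ?V * Z m" 6] by simp
  also have "(\<Sum>m\<le>6. c (Suc m) * ?V * Z (Suc m)) = (\<Sum>m\<le>6. 8 * fps_X * (c m * red_fps m (flip s)))"
  proof (rule sum.cong[OF HOL.refl])
    fix m :: nat assume "m \<in> {..6}"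
    then have "7 - m = Suc (7 - Suc m)" by auto
    then have "?V ^ (7 - m) = ?V * ?V ^ (7 - Suc m)" by (metis power_Suc)
    then show "c (Suc m) * ?V * Z (Suc m) = 8 * fps_X * (c m * red_fps m (flip s))"
      by (simp add: c_def Z_def head_part_Suc mult_ac)
  qed
  also have "\<dots> = 8 * fps_X * (reduced_series (flip s) - c 7 * red_fps 7 (flip s))"
    using sum.atMost_Suc[of "\<lambda>m. c m * red_fps m (flip s)" 6] by (simp add: rs sum_distrib_left)
  also have "c 0 * ?V * Z 0 = (if s = origin then ?U * ?V ^ 8 else 0)"
    by (simp add: c_def Z_def head_part_0 eval_nat_numeral mult_ac)
  finally have main: "?U * reduced_series s =
      fps_X * (reduced_series (xmove 1 s) + reduced_series (xmove (- 1) s))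
      + ((if s = origin then ?U * ?V ^ 8 else 0) + 8 * fps_X * (reduced_series (flip s) - c 7 * red_fps 7 (flip s)))" .
  have c7: "8 * fps_X * (c 7 * red_fps 7 (flip s)) = 8 ^ 8 * ?U * fps_X ^ 8 * red_fps 7 (flip s)"
    using power_Suc[of "fps_X :: int fps" 7] by (simp add: c_def mult_ac)
  show ?thesis
    unfolding c7[symmetric] main by (simp add: algebra_simps)
qed

text \<open>The difference of the two series solves the common recurrence with source divisible by
  2^24; induction on the coefficient index, for all states at once, yields the divisibility.\<close>

theorem walk_series_cong: "[walk_series s $ n = reduced_series s $ n] (mod 2 ^ 24)"
proof -
  define Delta where "Delta s = walk_series s - reduced_series s" for s
  have rec: "fps_of_poly Up * Delta s = fps_X * (Delta (xmove 1 s) + Delta (xmove (- 1) s) + 8 * Delta (flip s))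
      + 2 ^ 24 * (fps_of_poly Up * fps_X ^ 8 * red_fps 7 (flip s))" for s
    using walk_series_recurrence[of s] reduced_series_recurrence[of s]
    by (simp add: Delta_def algebra_simps)
  have "2 ^ 24 dvd Delta s $ n" for s n
  proof (induction n arbitrary: s rule: less_induct)
    case (less n)
    have c: "(2 ^ 24 * f) $ n = 2 ^ 24 * f $ n" "(8 * f) $ k = 8 * f $ k" for f :: "int fps" and k
      by (simp_all add: numeral_fps_const)
    have "Delta s $ n + (if n < 2 then 0 else Delta s $ (n - 2)) =
      (if n = 0 then 0 else Delta (xmove 1 s) $ (n - 1) + Delta (xmove (- 1) s) $ (n - 1) + 8 * Delta (flip s) $ (n - 1))
      + 2 ^ 24 * (fps_of_poly Up * fps_X ^ 8 * red_fps 7 (flip s)) $ n"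
      using arg_cong[OF rec[of s], of "\<lambda>f. f $ n"]
      unfolding fps_add_nth c fps_X_mult_nth fps_Up distrib_right fps_X_power_mult_nth
      by (simp add: c)
    moreover have "2 ^ 24 dvd (if n < 2 then 0 else Delta s $ (n - 2))"
      using less.IH[of "n - 2" s] by auto
    moreover have "2 ^ 24 dvd (if n = 0 then 0 else Delta (xmove 1 s) $ (n - 1) + Delta (xmove (- 1) s) $ (n - 1)
        + 8 * Delta (flip s) $ (n - 1))"
      using less.IH[of "n - 1"] by (auto intro!: dvd_add dvd_mult)
    ultimately show ?case
      by (metis dvd_add dvd_add_left_iff dvd_triv_left)
  qed
  then show ?thesis
    by (simp add: Delta_def cong_iff_dvd_diff)
qed

section \<open>Closed reduced words with at most seven letters t\<close>

lemmas reduced_explicit = reduced_def length_Suc_conv origin_def eval_nat_numeral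

lemma red_fps_odd:
  assumes "m \<in> {1, 3, 5, 7}"
  shows "red_fps m origin = 0"
proof (rule fps_ext)
  fix k
  have "reduced m origin k = {}" using assms by (auto simp: reduced_explicit)
  then show "red_fps m origin $ k = 0 $ k" by (simp add: red_fps_def)
qed

lemma red_fps_0: "red_fps 0 origin = 1"
proof (rule fps_ext)
  fix k
  have "reduced 0 origin k = (if k = 0 then {[0]} else {})" by (auto simp: reduced_explicit)
  then show "red_fps 0 origin $ k = 1 $ k" by (simp add: red_fps_def)
qed

lemma card_reduced_2: "card (reduced 2 origin k) = (if odd k then 0 else if k = 0 then 1 else 2)"
proof -
  let ?f = "\<lambda>a. [a, 0, - a] :: int list"
  have "reduced 2 origin k = ?f ` {a. 2 * nat \<bar>a\<bar> = k}"
    by (auto simp: reduced_explicit)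
  then have c: "card (reduced 2 origin k) = card {a :: int. 2 * nat \<bar>a\<bar> = k}"
    by (simp add: card_image inj_on_def)
  show ?thesis
  proof (cases "odd k")
    case True
    then have "{a :: int. 2 * nat \<bar>a\<bar> = k} = {}" by auto
    then show ?thesis using c True by simp
  next
    case False
    then obtain j where "k = 2 * j" by blast
    then have "{a :: int. 2 * nat \<bar>a\<bar> = k} = {int j, - int j}" by auto
    then show ?thesis using c False \<open>k = 2 * j\<close> by (auto simp: card_insert_if)
  qed
qed

lemma red_fps_2: "fps_of_poly Vp * red_fps 2 origin = 1 + fps_X ^ 2"
proof (rule fps_ext)
  fix k :: nat
  have "k = 0 \<or> k = 1 \<or> k = 2 \<or> k > 2" by linarith
  then show "(fps_of_poly Vp * red_fps 2 origin) $ k = (1 + fps_X ^ 2) $ k"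
    by (auto simp: fps_Vp left_diff_distrib fps_X_power_mult_nth red_fps_def card_reduced_2)
qed

text \<open>The central coordinate forces a1 b = 0. For k = 2 j > 0, the case b = 0 gives the 6 j
  points of a hexagon, and b nonzero gives the 4 j - 2 pairs with |a0| + |b| = j.\<close>

lemma card_reduced_4:
  "card (reduced 4 origin k) = (if odd k then 0 else if k = 0 then 1 else 5 * k - 2)"
proof -
  have expl: "reduced 4 origin k = {as. \<exists>a0 b a1. as = [a0, b, a1, - b, - (a0 + a1)] \<and> a1 * b = 0 \<and>
      2 * nat \<bar>b\<bar> + nat \<bar>a0\<bar> + nat \<bar>a1\<bar> + nat \<bar>a0 + a1\<bar> = k}"
  proof -
    have "a0 + a1 + a2 = 0 \<longleftrightarrow> a2 = - (a0 + a1)" "b1 + b2 = 0 \<longleftrightarrow> b2 = - b1"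
      "\<bar>- a0 - a1\<bar> = \<bar>a0 + a1\<bar>" for a0 a1 a2 b1 b2 :: int
      by linarith+
    note this[simp]
    show ?thesis
      by (auto simp: reduced_explicit mult.commute)
  qed
  show ?thesis
  proof (cases "odd k")
    case True
    have "as \<notin> reduced 4 origin k" for as
    proof
      assume "as \<in> reduced 4 origin k"
      then obtain a0 b a1 :: int where "k = 2 * nat \<bar>b\<bar> + nat \<bar>a0\<bar> + nat \<bar>a1\<bar> + nat \<bar>a0 + a1\<bar>"
        unfolding expl by blast
      then have "even k \<longleftrightarrow> even (a0 + a1 + (a0 + a1))" by (simp add: even_nat_iff)
      then show False using True by simp
    qed
    then have "reduced 4 origin k = {}" by blast
    then show ?thesis using True by simp
  next
    case False
    then obtain j where k: "k = 2 * j" by blast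
    show ?thesis
    proof (cases "j = 0")
      case True
      then have "reduced 4 origin k = {[0, 0, 0, 0, 0]}" unfolding k expl[unfolded k] by auto
      then show ?thesis using True k by simp
    next
      case j: False
      let ?f = "\<lambda>(x, y). [x, 0, y, 0, - (x + y)] :: int list"
      let ?g = "\<lambda>(a, b). [a, b, 0, - b, - a] :: int list"
      let ?B = "SIGMA a:{- (int j - 1)..int j - 1}. {int j - \<bar>a\<bar>, - (int j - \<bar>a\<bar>)}"
      have "reduced 4 origin k = ?f ` hexagon j \<union> ?g ` ?B"
      proof (intro equalityI subsetI)
        fix as assume "as \<in> reduced 4 origin k"
        then obtain a0 b a1 where *: "as = [a0, b, a1, - b, - (a0 + a1)]" "a1 * b = 0"
          "2 * nat \<bar>b\<bar> + nat \<bar>a0\<bar> + nat \<bar>a1\<bar> + nat \<bar>a0 + a1\<bar> = 2 * j"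
          unfolding k expl[unfolded k] by blast
        show "as \<in> ?f ` hexagon j \<union> ?g ` ?B"
        proof (cases "b = 0")
          case True
          then have "(a0, a1) \<in> hexagon j" using * by (simp add: hexagon_def hexnorm_def)
          then show ?thesis using * True by force
        next
          case False
          then have "a1 = 0" "(a0, b) \<in> ?B" using * by auto
          then show ?thesis using * by force
        qed
      next
        fix as assume "as \<in> ?f ` hexagon j \<union> ?g ` ?B"
        then show "as \<in> reduced 4 origin k"
        proof
          assume "as \<in> ?f ` hexagon j"
          then show ?thesis unfolding k expl[unfolded k] by (auto simp: hexagon_def hexnorm_def)
        next
          assume "as \<in> ?g ` ?B"
          then show ?thesis unfolding k expl[unfolded k] by auto
        qed
      qed
      moreover have "?f ` hexagon j \<inter> ?g ` ?B = {}" by auto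
      moreover have "card (?f ` hexagon j) = 6 * j"
        using j by (subst card_image) (auto simp: inj_on_def card_hexagon)
      moreover have "card (?g ` ?B) = 4 * j - 2"
      proof -
        have "card (?g ` ?B) = card ?B" by (rule card_image) (auto simp: inj_on_def)
        also have "\<dots> = (\<Sum>a\<in>{- (int j - 1)..int j - 1}. card {int j - \<bar>a\<bar>, - (int j - \<bar>a\<bar>)})"
          by (rule card_SigmaI) auto
        also have "\<dots> = (\<Sum>a\<in>{- (int j - 1)..int j - 1}. 2)"
          by (rule sum.cong) (auto simp: card_insert_if)
        also have "\<dots> = 4 * j - 2" using j by (simp add: nat_diff_distrib)
        finally show ?thesis .
      qed
      ultimately have "card (reduced 4 origin k) = 6 * j + (4 * j - 2)"
        by (simp add: card_Un_disjoint finite_hexagon)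
      then show ?thesis using j k by simp
    qed
  qed
qed

lemma red_fps_4: "fps_of_poly Vp ^ 2 * red_fps 4 origin = 1 + 6 * fps_X ^ 2 + 3 * fps_X ^ 4"
proof (rule fps_ext)
  fix k :: nat
  have V: "fps_of_poly Vp ^ 2 = 1 - 2 * fps_X ^ 2 + fps_X ^ 4"
    by (simp add: fps_Vp power2_diff flip: power_mult)
  have c: "(2 * f) $ k = 2 * f $ k" "(6 * f) $ k = 6 * f $ k" "(3 * f) $ k = 3 * f $ k" for f :: "int fps"
    by (simp_all add: numeral_fps_const)
  have "k = 0 \<or> k = 1 \<or> k = 2 \<or> k = 3 \<or> k = 4 \<or> k > 4" by linarith
  then show "(fps_of_poly Vp ^ 2 * red_fps 4 origin) $ k = (1 + 6 * fps_X ^ 2 + 3 * fps_X ^ 4) $ k"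
    unfolding V distrib_right left_diff_distrib fps_add_nth fps_sub_nth c mult.assoc
      fps_X_power_mult_nth
    by (auto simp: red_fps_def card_reduced_4 of_nat_diff)
qed

text \<open>The sum |a| + |a + s| is constant on the segment between 0 and -s and grows by 2 per
  step outside it.\<close>

lemma card_run_split:
  fixes s :: int
  shows "finite {a. \<bar>a\<bar> + \<bar>a + s\<bar> = \<bar>s\<bar> + 2 * int j}"
    "int (card {a. \<bar>a\<bar> + \<bar>a + s\<bar> = \<bar>s\<bar> + 2 * int j}) = (if j = 0 then \<bar>s\<bar> + 1 else 2)"
proof -
  let ?A = "{a. \<bar>a\<bar> + \<bar>a + s\<bar> = \<bar>s\<bar> + 2 * int j}"
  have "finite ?A \<and> int (card ?A) = (if j = 0 then \<bar>s\<bar> + 1 else 2)"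
  proof (cases "j = 0")
    case True
    then have "?A = {min 0 (- s)..max 0 (- s)}" by auto
    then show ?thesis using True by (simp add: max_def min_def)
  next
    case False
    have "x \<in> ?A \<longleftrightarrow> x \<in> (if s \<ge> 0 then {int j, - s - int j} else {- int j, - s + int j})" for x
      by (cases "s \<ge> 0"; cases "x \<ge> 0"; cases "x + s \<ge> 0") (use False in auto)
    then have "?A = (if s \<ge> 0 then {int j, - s - int j} else {- int j, - s + int j})" by blast
    then show ?thesis using False by (simp add: card_insert_if)
  qed
  then show "finite ?A" "int (card ?A) = (if j = 0 then \<bar>s\<bar> + 1 else 2)" by simp_all
qed

text \<open>The central coordinate says that (a1, a2) and (b3, b1) are parallel. The exponent a0 is
  free; its excess 2 j over the minimum reduces the joint norm of the pair to 2 (k - j).\<close>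

lemma card_reduced_6:
  "int (card (reduced 6 origin (2 * k))) =
     (\<Sum>(A, B)\<in>parallel_pairs k. \<bar>fst A + snd A\<bar>) + int (card (parallel_pairs k))
       + 2 * (\<Sum>i<k. int (card (parallel_pairs i)))"
proof -
  define R where "R j A = {a. \<bar>a\<bar> + \<bar>a + (fst A + snd A)\<bar> = \<bar>fst A + snd A\<bar> + 2 * int j}" for j :: nat and A :: "int \<times> int"
  let ?T = "SIGMA j:{..k}. SIGMA p:parallel_pairs (k - j). R j (fst p)"
  \<comment> \<open>The order (b3, b1) turns a1 b1 = a2 b3 into parallelism.\<close>
  define f where "f = (\<lambda>(j :: nat, ((a1 :: int, a2 :: int), (b3 :: int, b1 :: int)), a0 :: int).
    [a0, b1, a1, - (b1 + b3), a2, b3, - (a0 + a1 + a2)])"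
  have run7: "run [a0, b1, a1, b2, a2, b3, a3] origin = origin \<longleftrightarrow>
      a3 = - (a0 + a1 + a2) \<and> b2 = - (b1 + b3) \<and> a1 * b1 = a2 * b3" for a0 b1 a1 b2 a2 b3 a3
  proof -
    have "run [a0, b1, a1, b2, a2, b3, a3] origin =
        (a0 + a1 + a2 + a3, b1 + b2 + b3, - (b1 * a1) - (b1 + b2) * a2 - (b1 + b2 + b3) * a3, False)"
      by (simp add: origin_def algebra_simps)
    moreover have "a0 + a1 + a2 + a3 = 0 \<longleftrightarrow> a3 = - (a0 + a1 + a2)" "b1 + b2 + b3 = 0 \<longleftrightarrow> b2 = - (b1 + b3)"
      by linarith+
    ultimately show ?thesis
      by (auto simp: origin_def mult.commute)
  qed
  have weight7: "weight [a0, b1, a1, b2, a2, b3, a3] = 2 * k \<longleftrightarrow>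
      \<bar>a0\<bar> + \<bar>a1\<bar> + \<bar>a2\<bar> + \<bar>a3\<bar> + \<bar>b1\<bar> + \<bar>b3\<bar> + \<bar>b2\<bar> = 2 * int k" for a0 b1 a1 b2 a2 b3 a3 k
  proof -
    have "int (weight [a0, b1, a1, b2, a2, b3, a3]) = \<bar>a0\<bar> + \<bar>a1\<bar> + \<bar>a2\<bar> + \<bar>a3\<bar> + \<bar>b1\<bar> + \<bar>b3\<bar> + \<bar>b2\<bar>"
      by simp
    then show ?thesis by linarith
  qed
  have abs: "\<bar>- x - y\<bar> = \<bar>x + y\<bar>" "\<bar>- x - y - z\<bar> = \<bar>x + y + z\<bar>" for x y z :: int
    by linarith+
  have expl: "reduced 6 origin (2 * k) = {as. \<exists>a0 b1 a1 a2 b3.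
      as = [a0, b1, a1, - (b1 + b3), a2, b3, - (a0 + a1 + a2)] \<and> a1 * b1 = a2 * b3 \<and>
      \<bar>a0\<bar> + \<bar>a1\<bar> + \<bar>a2\<bar> + \<bar>a0 + a1 + a2\<bar> + \<bar>b1\<bar> + \<bar>b3\<bar> + \<bar>b1 + b3\<bar> = 2 * int k}"
  proof (intro equalityI subsetI)
    fix as assume as: "as \<in> reduced 6 origin (2 * k)"
    then have "length as = Suc (Suc (Suc (Suc (Suc (Suc (Suc 0))))))" by (simp add: reduced_def)
    then obtain a0 b1 a1 b2 a2 b3 a3 where l: "as = [a0, b1, a1, b2, a2, b3, a3]"
      by (auto simp: length_Suc_conv)
    have "run as origin = origin" "weight as = 2 * k" using as by (simp_all only: reduced_def mem_Collect_eq)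
    then have eqs: "a3 = - (a0 + a1 + a2)" "b2 = - (b1 + b3)" "a1 * b1 = a2 * b3"
      and wt: "\<bar>a0\<bar> + \<bar>a1\<bar> + \<bar>a2\<bar> + \<bar>a3\<bar> + \<bar>b1\<bar> + \<bar>b3\<bar> + \<bar>b2\<bar> = 2 * int k"
      unfolding l run7 weight7 by simp_all
    have "\<bar>a0\<bar> + \<bar>a1\<bar> + \<bar>a2\<bar> + \<bar>a0 + a1 + a2\<bar> + \<bar>b1\<bar> + \<bar>b3\<bar> + \<bar>b1 + b3\<bar> = 2 * int k"
      using wt unfolding eqs(1,2) by (simp add: abs)
    then show "as \<in> {as. \<exists>a0 b1 a1 a2 b3.
      as = [a0, b1, a1, - (b1 + b3), a2, b3, - (a0 + a1 + a2)] \<and> a1 * b1 = a2 * b3 \<and>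
      \<bar>a0\<bar> + \<bar>a1\<bar> + \<bar>a2\<bar> + \<bar>a0 + a1 + a2\<bar> + \<bar>b1\<bar> + \<bar>b3\<bar> + \<bar>b1 + b3\<bar> = 2 * int k}"
      using eqs(3) unfolding l eqs(1,2) by blast
  next
    fix as assume "as \<in> {as. \<exists>a0 b1 a1 a2 b3.
      as = [a0, b1, a1, - (b1 + b3), a2, b3, - (a0 + a1 + a2)] \<and> a1 * b1 = a2 * b3 \<and>
      \<bar>a0\<bar> + \<bar>a1\<bar> + \<bar>a2\<bar> + \<bar>a0 + a1 + a2\<bar> + \<bar>b1\<bar> + \<bar>b3\<bar> + \<bar>b1 + b3\<bar> = 2 * int k}"
    then obtain a0 b1 a1 a2 b3 where as: "as = [a0, b1, a1, - (b1 + b3), a2, b3, - (a0 + a1 + a2)]"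
      "a1 * b1 = a2 * b3"
      "\<bar>a0\<bar> + \<bar>a1\<bar> + \<bar>a2\<bar> + \<bar>a0 + a1 + a2\<bar> + \<bar>b1\<bar> + \<bar>b3\<bar> + \<bar>b1 + b3\<bar> = 2 * int k"
      by blast
    have "length as = 7" using as(1) by simp
    then show "as \<in> reduced 6 origin (2 * k)"
      using as(2,3) run7[of a0 b1 a1 "- (b1 + b3)" a2 b3 "- (a0 + a1 + a2)"]
        weight7[of a0 b1 a1 "- (b1 + b3)" a2 b3 "- (a0 + a1 + a2)" k]
      unfolding as(1) by (simp add: reduced_def abs del: run.simps weight_simps)
  qed
  have "reduced 6 origin (2 * k) = f ` ?T"
  proof (intro equalityI subsetI)
    fix as assume "as \<in> reduced 6 origin (2 * k)"
    then obtain a0 b1 a1 a2 b3 where *: "as = [a0, b1, a1, - (b1 + b3), a2, b3, - (a0 + a1 + a2)]"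
      "a1 * b1 = a2 * b3"
      "\<bar>a0\<bar> + \<bar>a1\<bar> + \<bar>a2\<bar> + \<bar>a0 + a1 + a2\<bar> + \<bar>b1\<bar> + \<bar>b3\<bar> + \<bar>b1 + b3\<bar> = 2 * int k"
      unfolding expl by blast
    define s where "s = a1 + a2"
    have "\<exists>j :: nat. \<bar>a0\<bar> + \<bar>a0 + s\<bar> = \<bar>s\<bar> + 2 * int j"
    proof -
      have "even (\<bar>a0\<bar> + \<bar>a0 + s\<bar> - \<bar>s\<bar>)" "\<bar>a0\<bar> + \<bar>a0 + s\<bar> - \<bar>s\<bar> \<ge> 0" by presburger+
      then show ?thesis by (intro exI[of _ "nat ((\<bar>a0\<bar> + \<bar>a0 + s\<bar> - \<bar>s\<bar>) div 2)"]) auto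
    qed
    then obtain j :: nat where j: "\<bar>a0\<bar> + \<bar>a0 + s\<bar> = \<bar>s\<bar> + 2 * int j" by blast
    have "j \<le> k" using * j s_def by linarith
    then have "(j, ((a1, a2), (b3, b1)), a0) \<in> ?T"
      using * j by (simp add: R_def parallel_pairs_def hexnorm_def s_def of_nat_diff add_ac)
    then show "as \<in> f ` ?T" using * by (force simp: f_def)
  next
    fix as assume "as \<in> f ` ?T"
    then obtain j a1 a2 b3 b1 a0 where *: "as = f (j, ((a1, a2), (b3, b1)), a0)"
      "(j, ((a1, a2), (b3, b1)), a0) \<in> ?T" by force
    then have "\<bar>a0\<bar> + \<bar>a1\<bar> + \<bar>a2\<bar> + \<bar>a0 + a1 + a2\<bar> + \<bar>b1\<bar> + \<bar>b3\<bar> + \<bar>b1 + b3\<bar> = 2 * int k"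
      "a1 * b1 = a2 * b3"
      by (auto simp: R_def parallel_pairs_def hexnorm_def of_nat_diff add_ac)
    then show "as \<in> reduced 6 origin (2 * k)" using * unfolding expl f_def by auto
  qed
  moreover have "inj_on f ?T"
    by (auto simp: inj_on_def f_def R_def)
  ultimately have "card (reduced 6 origin (2 * k)) = card ?T" by (simp add: card_image)
  also have "\<dots> = (\<Sum>j\<le>k. \<Sum>p\<in>parallel_pairs (k - j). card (R j (fst p)))"
  proof -
    have fin: "finite (R j A)" for j A by (simp add: R_def card_run_split(1))
    have "card (SIGMA p:parallel_pairs (k - j). R j (fst p)) = (\<Sum>p\<in>parallel_pairs (k - j). card (R j (fst p)))" for j
      by (rule card_SigmaI) (simp_all add: finite_parallel_pairs fin)
    then show ?thesis
      by (subst card_SigmaI) (simp_all add: finite_parallel_pairs fin finite_SigmaI)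
  qed
  finally have "int (card (reduced 6 origin (2 * k))) =
      (\<Sum>j\<le>k. \<Sum>(A, B)\<in>parallel_pairs (k - j). if j = 0 then \<bar>fst A + snd A\<bar> + 1 else 2)"
    by (simp add: case_prod_unfold R_def card_run_split(2))
  also have "\<dots> = (\<Sum>(A, B)\<in>parallel_pairs k. \<bar>fst A + snd A\<bar> + 1)
      + (\<Sum>j\<in>{1..k}. 2 * int (card (parallel_pairs (k - j))))"
  proof -
    have "{..k} = insert 0 {1..k}" by auto
    then show ?thesis by (simp add: case_prod_unfold mult.commute)
  qed
  also have "(\<Sum>j\<in>{1..k}. 2 * int (card (parallel_pairs (k - j)))) = (\<Sum>i<k. 2 * int (card (parallel_pairs i)))"
    by (rule sum.reindex_bij_witness[of _ "\<lambda>i. k - i" "\<lambda>j. k - j"]) auto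
  finally show ?thesis
    by (simp add: case_prod_unfold sum.distrib sum_distrib_left)
qed

text \<open>The cumulative sum over smaller radii cancels up to two terms. The shift by 2 comes from
  the factor \<open>Vp * Up\<close> = 1 - X^4 in the series.\<close>

lemma card_reduced_6_diff:
  assumes "n \<ge> 3"
  shows "int (card (reduced 6 origin (2 * n))) - int (card (reduced 6 origin (2 * (n - 2)))) =
    4 * ((int n + 3) * int (pillai n) - (int n - 5) * int (pillai (n - 2)) + 6 * int (pillai (n - 1)))"
proof -
  define m where "m = n - 2"
  have n: "n = Suc (Suc m)" "n - 2 = m" "n - 1 = Suc m" using assms by (auto simp: m_def)
  have "(\<Sum>i<n. int (card (parallel_pairs i))) = (\<Sum>i<n - 2. int (card (parallel_pairs i)))
      + int (card (parallel_pairs (n - 2))) + int (card (parallel_pairs (n - 1)))"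
    unfolding n(2,3) unfolding n(1) by simp
  then show ?thesis
    using assms unfolding card_reduced_6
    by (simp add: sum_abs_parallel_pairs card_parallel_pairs of_nat_diff algebra_simps)
qed

text \<open>For m = 0, 2, 4 the powers of \<open>Vp\<close> absorb all denominators and leave a
  polynomial.\<close>

lemma reduced_series_origin:
  "\<exists>Q. reduced_series origin = fps_of_poly Q + 8 ^ 6 * (fps_X ^ 6 * red_fps 6 origin - fps_X ^ 10 * red_fps 6 origin)"
proof -
  let ?U = "fps_of_poly Up" and ?V = "fps_of_poly Vp"
  have range: "{..7 :: nat} = {0, 1, 2, 3, 4, 5, 6, 7}" by auto
  have X: "fps_X ^ 10 = fps_X ^ 4 * (fps_X ^ 6 :: int fps)" by (simp flip: power_add)
  have VU: "?V * ?U = 1 - fps_X ^ 4"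
    by (simp add: fps_Up fps_Vp algebra_simps flip: power_add)
  have "reduced_series origin = ?V ^ 7 * ?U + 8 ^ 2 * ?V ^ 5 * ?U * fps_X ^ 2 * red_fps 2 origin
      + 8 ^ 4 * ?V ^ 3 * ?U * fps_X ^ 4 * red_fps 4 origin + 8 ^ 6 * ?V * ?U * fps_X ^ 6 * red_fps 6 origin"
    unfolding reduced_series_def range by (simp add: red_fps_odd red_fps_0 add.assoc)
  also have "8 ^ 2 * ?V ^ 5 * ?U * fps_X ^ 2 * red_fps 2 origin =
      8 ^ 2 * ?V ^ 4 * ?U * fps_X ^ 2 * (?V * red_fps 2 origin)"
    using power_Suc[of ?V 4] by (simp add: mult_ac)
  also have "8 ^ 4 * ?V ^ 3 * ?U * fps_X ^ 4 * red_fps 4 origin =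
      8 ^ 4 * ?V * ?U * fps_X ^ 4 * (?V ^ 2 * red_fps 4 origin)"
    using power_Suc[of ?V 2] by (simp add: mult_ac)
  also have "8 ^ 6 * ?V * ?U * fps_X ^ 6 * red_fps 6 origin = 8 ^ 6 * ((?V * ?U * fps_X ^ 6) * red_fps 6 origin)"
    by (simp only: mult_ac)
  also have "?V * ?U * fps_X ^ 6 = fps_X ^ 6 - fps_X ^ 10"
    unfolding VU X by (simp add: left_diff_distrib)
  finally have "reduced_series origin = (?V ^ 7 * ?U
      + 8 ^ 2 * ?V ^ 4 * ?U * fps_X ^ 2 * (1 + fps_X ^ 2)
      + 8 ^ 4 * ?V * ?U * fps_X ^ 4 * (1 + 6 * fps_X ^ 2 + 3 * fps_X ^ 4))
      + 8 ^ 6 * (fps_X ^ 6 * red_fps 6 origin - fps_X ^ 10 * red_fps 6 origin)"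
    unfolding red_fps_2 red_fps_4 by (simp only: left_diff_distrib)
  moreover have "fps_of_poly (Vp ^ 7 * Up + 8 ^ 2 * Vp ^ 4 * Up * [:0, 1:] ^ 2 * (1 + [:0, 1:] ^ 2)
      + 8 ^ 4 * Vp * Up * [:0, 1:] ^ 4 * (1 + 6 * [:0, 1:] ^ 2 + 3 * [:0, 1:] ^ 4)) =
      ?V ^ 7 * ?U + 8 ^ 2 * ?V ^ 4 * ?U * fps_X ^ 2 * (1 + fps_X ^ 2)
      + 8 ^ 4 * ?V * ?U * fps_X ^ 4 * (1 + 6 * fps_X ^ 2 + 3 * fps_X ^ 4)"
    by (simp only: fps_of_poly_add fps_of_poly_mult fps_of_poly_power fps_of_poly_fps_X
        fps_of_poly_1 fps_of_poly_numeral)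
  ultimately show ?thesis by metis
qed

section \<open>The visible residue and the contradiction\<close>

text \<open>Here n = 2 (8 s - 1), n - 2 = 4 (4 s - 1) with P(4) = 8, and n - 1 is odd; so one
  unknown value survives, with coefficient n + 3 = 1 modulo 8.\<close>

lemma pillai_bracket_mod_8:
  assumes "s > 0" and n: "n = 16 * s - 2"
  shows "[(int n + 3) * int (pillai n) - (int n - 5) * int (pillai (n - 2)) + 6 * int (pillai (n - 1))
    = 3 * int (pillai (8 * s - 1)) + 6] (mod 8)"
proof -
  have "odd (8 * s - 1)" "odd (4 * s - 1)" "odd (n - 1)" using assms by auto
  have "n = 2 * (8 * s - 1)" using n by simp
  then have "pillai n = 3 * pillai (8 * s - 1)"
    using pillai_mult[of 2 "8 * s - 1"] \<open>odd (8 * s - 1)\<close> by (simp add: pillai_2)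
  then have p0: "[int (pillai n) = 3 * int (pillai (8 * s - 1))] (mod 8)" by simp
  have "n - 2 = 4 * (4 * s - 1)" using n by simp
  moreover have "coprime 4 (4 * s - 1)"
    using \<open>odd (4 * s - 1)\<close> coprime_power_left_iff[of 2 2 "4 * s - 1"] by simp
  ultimately have "pillai (n - 2) = 8 * pillai (4 * s - 1)"
    using pillai_mult[of 4 "4 * s - 1"] by (simp add: pillai_4)
  then have p2: "[int (pillai (n - 2)) = 0] (mod 8)" by (simp add: cong_def)
  have "pillai (n - 1) mod 4 = 1" by (rule pillai_odd_mod_4) fact
  then have "pillai (n - 1) = 4 * (pillai (n - 1) div 4) + 1" by presburger
  then have "6 * int (pillai (n - 1)) - 6 = 8 * (3 * int (pillai (n - 1) div 4))" by linarith
  then have p1: "[6 * int (pillai (n - 1)) = 6] (mod 8)"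
    by (metis cong_iff_dvd_diff dvd_triv_left)
  have n3: "[int n + 3 = 1] (mod 8)"
  proof -
    have "int n + 3 - 1 = 8 * (2 * int s)" using assms by simp
    then show ?thesis by (metis cong_iff_dvd_diff dvd_triv_left)
  qed
  have "[(int n + 3) * int (pillai n) - (int n - 5) * int (pillai (n - 2)) + 6 * int (pillai (n - 1))
    = 1 * (3 * int (pillai (8 * s - 1))) - (int n - 5) * 0 + 6] (mod 8)"
    by (intro cong_add cong_diff cong_mult n3 p0 p1 p2) simp_all
  then show ?thesis by simp
qed

text \<open>Beyond the degree of the polynomial part only m = 6 counts; 2^20 is 8^6 times the factor
  4 of the difference.\<close>

theorem walk_series_mod:
  "\<exists>L. \<forall>s\<ge>L. [walk_series origin $ (32 * s + 2) = 2 ^ 20 * (3 * int (pillai (8 * s - 1)) + 6)] (mod 2 ^ 23)"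
proof -
  obtain Q where Q: "reduced_series origin =
      fps_of_poly Q + 8 ^ 6 * (fps_X ^ 6 * red_fps 6 origin - fps_X ^ 10 * red_fps 6 origin)"
    using reduced_series_origin by blast
  have "[walk_series origin $ (32 * s + 2) = 2 ^ 20 * (3 * int (pillai (8 * s - 1)) + 6)] (mod 2 ^ 23)"
    if s: "s \<ge> Suc (degree Q)" for s
  proof -
    define n where "n = 16 * s - 2"
    have n: "n \<ge> 3" "32 * s + 2 - 6 = 2 * n" "32 * s + 2 - 10 = 2 * (n - 2)" using s by (simp_all add: n_def)
    let ?b = "(int n + 3) * int (pillai n) - (int n - 5) * int (pillai (n - 2)) + 6 * int (pillai (n - 1))"
    have c: "(8 ^ 6 * f) $ k = 8 ^ 6 * f $ k" for f :: "int fps" and k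
      by (simp add: numeral_fps_const)
    have "reduced_series origin $ (32 * s + 2) = 8 ^ 6 * (int (card (reduced 6 origin (2 * n)))
        - int (card (reduced 6 origin (2 * (n - 2)))))"
      using s unfolding Q fps_add_nth c fps_sub_nth fps_X_power_mult_nth n
      by (simp add: red_fps_def coeff_eq_0)
    also have "\<dots> = 2 ^ 20 * ?b"
      unfolding card_reduced_6_diff[OF n(1)] by simp
    finally have "reduced_series origin $ (32 * s + 2) = 2 ^ 20 * ?b" .
    moreover have "[2 ^ 20 * ?b = 2 ^ 20 * (3 * int (pillai (8 * s - 1)) + 6)] (mod 2 ^ 20 * 8)"
      using pillai_bracket_mod_8[OF _ n_def] s
      unfolding cong_iff_dvd_diff right_diff_distrib[symmetric] by (intro mult_dvd_mono) simp_all
    moreover have "[walk_series origin $ (32 * s + 2) = reduced_series origin $ (32 * s + 2)] (mod 2 ^ 23)"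
      by (rule cong_dvd_modulus[OF walk_series_cong]) (simp add: le_imp_power_dvd)
    ultimately show ?thesis by (simp add: cong_def)
  qed
  then show ?thesis by blast
qed

theorem theorem1: "\<not> D_finite (green_series heis_C2 heis_C2_gens)"
proof
  assume "D_finite (green_series heis_C2 heis_C2_gens)"
  moreover have "green_series heis_C2 heis_C2_gens = walk_fps origin"
    by (simp add: green_series_def walk_fps_def green_coeff_walk_count)
  ultimately have "D_finite (walk_series origin)"
    unfolding walk_series_def by (simp only: D_finite_compose_zeta)
  then obtain E i K :: nat and w :: "nat \<Rightarrow> int" where "\<exists>e\<le>E. odd (w e)"
    and rel: "\<And>s. s > E \<Longrightarrow> [s = i] (mod 2 ^ K) \<Longrightarrow>
      [(\<Sum>e\<le>E. w e * walk_series origin $ (32 * (s - e) + 2)) = 0] (mod 2 ^ 23)"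
    using D_finite_section_relation[where M = 32 and r = 2 and b = 23, OF _ zero_less_numeral] by blast
  then obtain e0 where e0: "e0 \<le> E" "odd (w e0)" by blast
  obtain L where L: "\<And>s. s \<ge> L \<Longrightarrow>
      [walk_series origin $ (32 * s + 2) = 2 ^ 20 * (3 * int (pillai (8 * s - 1)) + 6)] (mod 2 ^ 23)"
    using walk_series_mod by blast
  \<comment> \<open>The relation after division by 2^20, to be read modulo 8.\<close>
  define g where "g s = (\<Sum>e\<le>E. w e * (3 * int (pillai (8 * (s - e) - 1)) + 6))" for s
  have g: "8 dvd g s" if "s \<ge> L + E + 1" "[s = i] (mod 2 ^ K)" for s
  proof -
    have "[(\<Sum>e\<le>E. w e * walk_series origin $ (32 * (s - e) + 2)) =
        (\<Sum>e\<le>E. w e * (2 ^ 20 * (3 * int (pillai (8 * (s - e) - 1)) + 6)))] (mod 2 ^ 23)"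
      using that(1) by (intro cong_sum cong_scalar_left L) auto
    moreover have "(\<Sum>e\<le>E. w e * (2 ^ 20 * (3 * int (pillai (8 * (s - e) - 1)) + 6))) = 2 ^ 20 * g s"
      unfolding g_def sum_distrib_left by (intro sum.cong) auto
    ultimately have "[2 ^ 20 * g s = 0] (mod 2 ^ 23)"
      using rel[of s] that by (simp add: cong_def)
    then have "2 ^ 20 * 8 dvd 2 ^ 20 * g s" by (simp add: cong_0_iff)
    then show ?thesis by (simp only: dvd_mult_cancel_left) simp
  qed
  \<comment> \<open>Lies in the class of \<open>i\<close> and beyond all thresholds.\<close>
  define s0 where "s0 = i + 2 ^ K * (L + E + 1)"
  have "1 * (L + E + 1) \<le> 2 ^ K * (L + E + 1)" by (rule mult_right_mono) simp_all
  then have s0: "s0 \<ge> L + E + 1" by (simp add: s0_def)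
  have s0_cong: "[s0 = i] (mod 2 ^ K)" unfolding s0_def cong_def by (rule mod_mult_self2)
  obtain s where s: "s \<ge> s0" "[s = s0] (mod 2 ^ K)"
    and flip: "[pillai (8 * (s - e0) - 1) = 5 * pillai (8 * (s0 - e0) - 1)] (mod 8)"
    and other: "\<And>e. e \<le> E \<Longrightarrow> e \<noteq> e0 \<Longrightarrow> [pillai (8 * (s - e) - 1) = pillai (8 * (s0 - e) - 1)] (mod 8)"
    using pillai_flip[of E s0 e0 K] s0 e0(1) by auto
  define P where "P = int (pillai (8 * (s0 - e0) - 1))"
  \<comment> \<open>Multiplying the value at \<open>e0\<close> by 5 adds 3 * 4 times it; all other
    terms are unchanged modulo 8.\<close>
  have "[w e * (3 * int (pillai (8 * (s - e) - 1)) + 6) =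
      w e * (3 * int (pillai (8 * (s0 - e) - 1)) + 6) + (if e = e0 then 12 * w e0 * P else 0)] (mod 8)"
    if e: "e \<le> E" for e
  proof (cases "e = e0")
    case True
    have "[int (pillai (8 * (s - e0) - 1)) = int (5 * pillai (8 * (s0 - e0) - 1))] (mod int 8)"
      using flip by (simp only: cong_int_iff)
    then have "[w e0 * (3 * int (pillai (8 * (s - e0) - 1)) + 6) = w e0 * (3 * (5 * P) + 6)] (mod 8)"
      unfolding P_def by (intro cong_scalar_left cong_add cong_refl) simp_all
    then show ?thesis using True by (simp add: P_def algebra_simps)
  next
    case False
    have "[int (pillai (8 * (s - e) - 1)) = int (pillai (8 * (s0 - e) - 1))] (mod int 8)"
      using other[OF e False] by (simp only: cong_int_iff)
    then have "[w e * (3 * int (pillai (8 * (s - e) - 1)) + 6) = w e * (3 * int (pillai (8 * (s0 - e) - 1)) + 6)] (mod 8)"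
      by (intro cong_scalar_left cong_add cong_refl) simp_all
    then show ?thesis using False by simp
  qed
  then have "[g s = (\<Sum>e\<le>E. w e * (3 * int (pillai (8 * (s0 - e) - 1)) + 6) + (if e = e0 then 12 * w e0 * P else 0))] (mod 8)"
    unfolding g_def by (intro cong_sum) auto
  also have "(\<Sum>e\<le>E. w e * (3 * int (pillai (8 * (s0 - e) - 1)) + 6) + (if e = e0 then 12 * w e0 * P else 0))
      = g s0 + 12 * w e0 * P"
    using e0(1) by (simp add: g_def sum.distrib)
  finally have "[g s = g s0 + 12 * w e0 * P] (mod 8)" .
  moreover have "8 dvd g s" "8 dvd g s0"
    using g[of s] g[OF s0 s0_cong] s s0 cong_trans[OF s(2) s0_cong] by auto
  ultimately have "8 dvd 12 * w e0 * P"
    by (metis cong_dvd_iff dvd_add_right_iff dvd_refl cong_0_iff cong_sym cong_trans)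
  \<comment> \<open>Only the parity of w e0 P is left, and both factors are odd.\<close>
  then have "4 * 2 dvd 4 * (3 * (w e0 * P))" by (simp add: mult.assoc)
  then have "even (3 * (w e0 * P))" by (simp only: dvd_mult_cancel_left) simp
  moreover have "odd P"
  proof -
    have "odd (8 * (s0 - e0) - 1)" using s0 e0(1) by simp
    then have "pillai (8 * (s0 - e0) - 1) mod 4 = 1" by (rule pillai_odd_mod_4)
    then have "odd (pillai (8 * (s0 - e0) - 1))" by presburger
    then show ?thesis by (simp add: P_def)
  qed
  ultimately show False using e0(2) by simp
qed

end
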